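(* Let $C$ and $X$ be compact connected Riemann surfaces of genus one, let $d\geq 2$ be an integer, let $\omega$ be a meromorphic one-form on $C$ whose polar divisor is $x_1+\dots+x_d$ and whose zero divisor is $y_1+\dots+y_d$, where $x_1,\dots,x_d$ are pairwise distinct, $y_1,\dots,y_d$ are pairwise distinct, and $\{x_1,\dots,x_d\}\cap\{y_1,\dots,y_d\}=\emptyset$, and let $\beta$ be a nonzero holomorphic one-form on $X$. Let $\mathcal{F}\subset T(C\times X)$ be the nonsingular holomorphic foliation on $C\times X$ defined by $\phi_C^*\omega+\phi_X^*\beta$ (see context), where $\phi_C:C\times X\to C$ and $\phi_X:C\times X\to X$ are the projections. Then there is at most one $\mathcal{F}$-projective structure on $C\times X$.
   Context: **Foliation.** Let $L=\phi_C^*\mathcal{O}_C(-\sum_{i=1}^d x_i)$ (functions vanishing on $\{x_1,\dots,x_d\}\times X$). The map $\vartheta:L\to\Omega^1_{C\times X}$, $s\mapsto s\cdot(\phi_C^*\omega+\phi_X^*\beta)$, embeds $L$ as a holomorphic line subbundle of $\Omega^1_{C\times X}$, and $\mathcal{F}:=\ker(\vartheta(L))\subset T(C\times X)$ is the rank-one nonsingular holomorphic foliation annihilated by this subbundle. **$\mathcal{F}$-projective structure.** Let $M$ be a complex manifold with a nonsingular holomorphic foliation $\mathcal{F}\subset TM$ of codimension one. An $\mathcal{F}$-chart is a pair $(U,f)$ with $U\subset M$ open and $f:U\to\mathbb{CP}^1$ a holomorphic submersion mapping each connected component of each leaf of $(U,\mathcal{F}|_U)$ to a point. An $\mathcal{F}$-atlas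 is a collection $\{(U_i,f_i)\}_{i\in I}$ of $\mathcal{F}$-charts with $\bigcup_i U_i=M$. An $\mathcal{F}$-projective structure on $M$ is defined by an $\mathcal{F}$-atlas such that for all $i,j\in I$ and every nonempty connected component $V$ of $U_i\cap U_j$ there is a Möbius transformation $\mathcal{T}^V_{j,i}\in\mathrm{Aut}(\mathbb{CP}^1)$ with $f_j|_V=\mathcal{T}^V_{j,i}\circ f_i|_V$. Two such atlases define the same $\mathcal{F}$-projective structure if their union also satisfies this condition. *)

theory Defs
  imports "HOL-Complex_Analysis.Complex_Analysis" "HOL-Homology.Homology"
begin

section \<open>Complex manifolds\<close>

class complex_euclidean = euclidean_space +
  fixes scaleC :: "complex \<Rightarrow> 'a \<Rightarrow> 'a"  (infixr "*\<^sub>C" 75)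
  assumes scaleC_add_right: "a *\<^sub>C (x + y) = a *\<^sub>C x + a *\<^sub>C y"
    and scaleC_add_left: "(a + b) *\<^sub>C x = a *\<^sub>C x + b *\<^sub>C x"
    and scaleC_scaleC: "a *\<^sub>C (b *\<^sub>C x) = (a * b) *\<^sub>C x"
    and scaleC_of_real: "complex_of_real r *\<^sub>C x = r *\<^sub>R x"

instantiation complex :: complex_euclidean
begin

definition scaleC_complex_def: "a *\<^sub>C (z::complex) = a * z"

instance
  by standard (simp_all add: scaleC_complex_def algebra_simps scaleR_conv_of_real)

end

instantiation prod :: (complex_euclidean, complex_euclidean) complex_euclidean
begin

definition scaleC_prod_def: "a *\<^sub>C v = (a *\<^sub>C fst v, a *\<^sub>C snd v)"

instance
  by standard (simp_all add: scaleC_prod_def scaleC_add_right scaleC_add_left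
      scaleC_scaleC scaleC_of_real scaleR_prod_def)

end

text \<open>Holomorphy in any number of variables (on open sets): total complex differentiability.\<close>

definition cholomorphic_on ::
    "('e::complex_euclidean \<Rightarrow> 'f::complex_euclidean) \<Rightarrow> 'e set \<Rightarrow> bool"
    (infixl "cholomorphic'_on" 50) where
  "f cholomorphic_on S \<longleftrightarrow>
     (\<forall>z\<in>S. \<exists>D. (f has_derivative D) (at z) \<and> (\<forall>a v. D (a *\<^sub>C v) = a *\<^sub>C D v))"

text \<open>A chart is a pair of its domain and its coordinate map; the values of the coordinate map
  outside the domain are irrelevant.\<close>

type_synonym ('m, 'e) chart = "'m set \<times> ('m \<Rightarrow> 'e)"

definition chart_inv :: "('m, 'e) chart \<Rightarrow> 'e \<Rightarrow> 'm" where
  "chart_inv c = inv_into (fst c) (snd c)"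

definition complex_atlas :: "('m::topological_space, 'e::complex_euclidean) chart set \<Rightarrow> bool" where
  "complex_atlas A \<longleftrightarrow>
     (\<Union>c\<in>A. fst c) = UNIV \<and>
     (\<forall>c\<in>A. open (fst c) \<and> open (snd c ` fst c) \<and>
        homeomorphism (fst c) (snd c ` fst c) (snd c) (chart_inv c)) \<and>
     (\<forall>c\<in>A. \<forall>c'\<in>A. (snd c' \<circ> chart_inv c) cholomorphic_on (snd c ` (fst c \<inter> fst c')))"

definition standard_atlas :: "('e, 'e) chart set" where
  "standard_atlas = {(UNIV, \<lambda>z. z)}"

definition product_chart :: "('m, 'e) chart \<Rightarrow> ('n, 'f) chart \<Rightarrow> ('m \<times> 'n, 'e \<times> 'f) chart" where
  "product_chart a b = (fst a \<times> fst b, map_prod (snd a) (snd b))"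

definition product_atlas ::
    "('m, 'e) chart set \<Rightarrow> ('n, 'f) chart set \<Rightarrow> ('m \<times> 'n, 'e \<times> 'f) chart set" where
  "product_atlas A B = {product_chart a b | a b. a \<in> A \<and> b \<in> B}"

text \<open>In the following two definitions \<open>U\<close> is meant to be open in the source manifold.\<close>

definition holomorphic_map_on ::
    "('m::topological_space, 'e::complex_euclidean) chart set \<Rightarrow>
     ('n::topological_space, 'f::complex_euclidean) chart set \<Rightarrow> 'm set \<Rightarrow> ('m \<Rightarrow> 'n) \<Rightarrow> bool" where
  "holomorphic_map_on A B U f \<longleftrightarrow>
     continuous_on U f \<and>
     (\<forall>a\<in>A. \<forall>b\<in>B. (snd b \<circ> f \<circ> chart_inv a) cholomorphic_on
        (snd a ` {p \<in> U \<inter> fst a. f p \<in> fst b}))"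

definition holomorphic_submersion_on ::
    "('m::topological_space, 'e::complex_euclidean) chart set \<Rightarrow>
     ('n::topological_space, 'f::complex_euclidean) chart set \<Rightarrow> 'm set \<Rightarrow> ('m \<Rightarrow> 'n) \<Rightarrow> bool" where
  "holomorphic_submersion_on A B U f \<longleftrightarrow>
     holomorphic_map_on A B U f \<and>
     (\<forall>a\<in>A. \<forall>b\<in>B. \<forall>p\<in>U \<inter> fst a. f p \<in> fst b \<longrightarrow>
        surj (frechet_derivative (snd b \<circ> f \<circ> chart_inv a) (at (snd a p))))"


section \<open>Compact Riemann surfaces and one-forms\<close>

definition compact_connected_riemann_surface :: "('m::t2_space, complex) chart set \<Rightarrow> bool" where
  "compact_connected_riemann_surface A \<longleftrightarrow>
     complex_atlas A \<and> compact (UNIV :: 'm set) \<and> connected (UNIV :: 'm set)"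

text \<open>The genus of a compact connected Riemann surface is half the rank of its first integral
  homology group, which is free of finite rank.\<close>

definition has_genus :: "'m topology \<Rightarrow> nat \<Rightarrow> bool" where
  "has_genus T g \<longleftrightarrow> homology_group 1 T \<cong> free_Abelian_group {..<2 * g}"

text \<open>A one-form on a Riemann surface is the family of its coefficients: in the coordinate \<open>z\<close> of
  the chart \<open>c\<close> the form \<open>\<omega>\<close> is \<open>\<omega> c z dz\<close>.  Meromorphic coefficients are normalised to be zero at
  poles and continuous elsewhere, so the transformation law holds at every point.\<close>

type_synonym 'm one_form = "('m, complex) chart \<Rightarrow> complex \<Rightarrow> complex"

definition compatible_coefficients :: "('m, complex) chart set \<Rightarrow> 'm one_form \<Rightarrow> bool" where
  "compatible_coefficients A \<omega> \<longleftrightarrow>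
     (\<forall>c\<in>A. \<forall>c'\<in>A. \<forall>p\<in>fst c \<inter> fst c'.
        \<omega> c (snd c p) = \<omega> c' (snd c' p) * deriv (snd c' \<circ> chart_inv c) (snd c p))"

definition holomorphic_one_form :: "('m, complex) chart set \<Rightarrow> 'm one_form \<Rightarrow> bool" where
  "holomorphic_one_form A \<omega> \<longleftrightarrow>
     (\<forall>c\<in>A. \<omega> c holomorphic_on (snd c ` fst c)) \<and> compatible_coefficients A \<omega>"

definition meromorphic_one_form :: "('m, complex) chart set \<Rightarrow> 'm one_form \<Rightarrow> bool" where
  "meromorphic_one_form A \<omega> \<longleftrightarrow>
     (\<forall>c\<in>A. \<omega> c nicely_meromorphic_on (snd c ` fst c)) \<and> compatible_coefficients A \<omega>"

definition nonzero_form :: "('m, complex) chart set \<Rightarrow> 'm one_form \<Rightarrow> bool" where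
  "nonzero_form A \<omega> \<longleftrightarrow> (\<exists>c\<in>A. \<exists>p\<in>fst c. \<omega> c (snd c p) \<noteq> 0)"

text \<open>The order of a meromorphic form does not depend on the chart.  \<^const>\<open>zorder\<close> is negative at
  poles and meaningless for functions that vanish identically near the point.\<close>

definition form_has_order :: "('m, complex) chart set \<Rightarrow> 'm one_form \<Rightarrow> 'm \<Rightarrow> int \<Rightarrow> bool" where
  "form_has_order A \<omega> p n \<longleftrightarrow>
     (\<forall>c\<in>A. p \<in> fst c \<longrightarrow>
        (\<exists>\<^sub>F z in at (snd c p). \<omega> c z \<noteq> 0) \<and> zorder (\<omega> c) (snd c p) = n)"

text \<open>Divisors are integer-valued functions.\<close>

definition polar_divisor_is ::
    "('m, complex) chart set \<Rightarrow> 'm one_form \<Rightarrow> ('m \<Rightarrow> int) \<Rightarrow> bool" where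
  "polar_divisor_is A \<omega> D \<longleftrightarrow> (\<forall>p. \<exists>n. form_has_order A \<omega> p n \<and> D p = max 0 (- n))"

definition zero_divisor_is ::
    "('m, complex) chart set \<Rightarrow> 'm one_form \<Rightarrow> ('m \<Rightarrow> int) \<Rightarrow> bool" where
  "zero_divisor_is A \<omega> D \<longleftrightarrow> (\<forall>p. \<exists>n. form_has_order A \<omega> p n \<and> D p = max 0 n)"

definition sum_of_points :: "nat \<Rightarrow> (nat \<Rightarrow> 'm) \<Rightarrow> 'm \<Rightarrow> int" where
  "sum_of_points d x = (\<lambda>p. \<Sum>i=1..d. if p = x i then 1 else 0)"


section \<open>The complex projective line\<close>

quotient_type cp1 = "complex \<times> complex" / partial:
  "\<lambda>v w. v \<noteq> 0 \<and> w \<noteq> 0 \<and> (\<exists>a. a \<noteq> 0 \<and> w = a *\<^sub>C v)"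
proof (rule part_equivpI)
  show "\<exists>v::complex \<times> complex. v \<noteq> 0 \<and> v \<noteq> 0 \<and> (\<exists>a. a \<noteq> 0 \<and> v = a *\<^sub>C v)"
    by (rule exI[of _ "(1, 1)"], intro conjI exI[of _ 1])
      (auto simp: scaleC_prod_def scaleC_complex_def zero_prod_def)
  show "symp (\<lambda>v w::complex \<times> complex. v \<noteq> 0 \<and> w \<noteq> 0 \<and> (\<exists>a. a \<noteq> 0 \<and> w = a *\<^sub>C v))"
  proof (rule sympI, elim conjE exE, intro conjI)
    fix v w :: "complex \<times> complex" and a
    assume "a \<noteq> 0" "w = a *\<^sub>C v"
    then show "\<exists>b. b \<noteq> 0 \<and> v = b *\<^sub>C w"
      using scaleC_of_real[of 1 v] by (intro exI[of _ "inverse a"]) (simp add: scaleC_scaleC)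
  qed
  show "transp (\<lambda>v w::complex \<times> complex. v \<noteq> 0 \<and> w \<noteq> 0 \<and> (\<exists>a. a \<noteq> 0 \<and> w = a *\<^sub>C v))"
  proof (rule transpI, elim conjE exE, intro conjI)
    fix u v w :: "complex \<times> complex" and a b
    assume "a \<noteq> 0" "v = a *\<^sub>C u" "b \<noteq> 0" "w = b *\<^sub>C v"
    then show "\<exists>c. c \<noteq> 0 \<and> w = c *\<^sub>C u"
      by (intro exI[of _ "b * a"]) (auto simp: scaleC_scaleC)
  qed
qed

text \<open>\<open>abs_cp1 (a, b)\<close> is the point with homogeneous coordinates \<open>a : b\<close>, provided
  \<open>(a, b)\<close> is nonzero.  The topology is the quotient topology.\<close>

instantiation cp1 :: topological_space
begin

definition open_cp1_def: "open (S :: cp1 set) \<longleftrightarrow> open {v. v \<noteq> 0 \<and> abs_cp1 v \<in> S}"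

instance
proof
  have "{v. v \<noteq> 0 \<and> abs_cp1 v \<in> (UNIV :: cp1 set)} = - {0}" by auto
  then show "open (UNIV :: cp1 set)" by (simp add: open_cp1_def open_Compl)
next
  fix S T :: "cp1 set"
  assume "open S" "open T"
  moreover have "{v. v \<noteq> 0 \<and> abs_cp1 v \<in> S \<inter> T}
      = {v. v \<noteq> 0 \<and> abs_cp1 v \<in> S} \<inter> {v. v \<noteq> 0 \<and> abs_cp1 v \<in> T}" by auto
  ultimately show "open (S \<inter> T)" by (simp only: open_cp1_def open_Int)
next
  fix K :: "cp1 set set"
  assume "\<forall>S\<in>K. open S"
  moreover have "{v. v \<noteq> 0 \<and> abs_cp1 v \<in> \<Union>K} = (\<Union>S\<in>K. {v. v \<noteq> 0 \<and> abs_cp1 v \<in> S})" by auto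
  ultimately show "open (\<Union>K)" by (simp only: open_cp1_def open_UN)
qed

end

lift_definition cp1_fst_ratio :: "cp1 \<Rightarrow> complex" is "\<lambda>(a, b). a / b"
  by (auto simp: scaleC_prod_def scaleC_complex_def)

lift_definition cp1_snd_ratio :: "cp1 \<Rightarrow> complex" is "\<lambda>(a, b). b / a"
  by (auto simp: scaleC_prod_def scaleC_complex_def)

definition cp1_atlas :: "(cp1, complex) chart set" where
  "cp1_atlas = {({abs_cp1 (a, b) | a b. b \<noteq> 0}, cp1_fst_ratio),
                ({abs_cp1 (a, b) | a b. a \<noteq> 0}, cp1_snd_ratio)}"

definition moebius :: "(cp1 \<Rightarrow> cp1) \<Rightarrow> bool" where
  "moebius T \<longleftrightarrow> (\<exists>a b c d. a * d - b * c \<noteq> 0 \<and>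
     (\<forall>z w. (z, w) \<noteq> 0 \<longrightarrow> T (abs_cp1 (z, w)) = abs_cp1 (a * z + b * w, c * z + d * w)))"


section \<open>Foliations and transverse projective structures\<close>

text \<open>A tangent vector of a manifold with atlas \<open>A\<close> is presented by a triple \<open>(c, p, v)\<close>: the vector
  at the point \<open>p\<close> whose coordinates in the chart \<open>c\<close> of \<open>A\<close> around \<open>p\<close> are \<open>v\<close>.
  A distribution is the set of all presentations of its vectors.\<close>

type_synonym ('m, 'e) distribution = "(('m, 'e) chart \<times> 'm \<times> 'e) set"

definition integral_disc ::
    "('m::topological_space, 'e::complex_euclidean) chart set \<Rightarrow> ('m, 'e) distribution \<Rightarrow>
     'm set \<Rightarrow> (complex \<Rightarrow> 'm) \<Rightarrow> bool" where
  "integral_disc A F U g \<longleftrightarrow>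
     g ` ball 0 1 \<subseteq> U \<and> holomorphic_map_on standard_atlas A (ball 0 1) g \<and>
     (\<forall>t\<in>ball 0 1. \<forall>c\<in>A. g t \<in> fst c \<longrightarrow>
        (let v = frechet_derivative (snd c \<circ> g) (at t) 1 in v \<noteq> 0 \<and> (c, g t, v) \<in> F))"

text \<open>The leaves of the restriction of \<open>F\<close> to the open set \<open>U\<close>: two points lie on the same leaf iff
  they are joined by a finite chain of immersed holomorphic discs in \<open>U\<close> tangent to \<open>F\<close>.\<close>

definition leaves ::
    "('m::topological_space, 'e::complex_euclidean) chart set \<Rightarrow> ('m, 'e) distribution \<Rightarrow>
     'm set \<Rightarrow> 'm set set" where
  "leaves A F U =
     {{q. (\<lambda>r s. \<exists>g. integral_disc A F U g \<and> r \<in> g ` ball 0 1 \<and> s \<in> g ` ball 0 1)\<^sup>*\<^sup>* p q} | p. p \<in> U}"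

definition F_chart ::
    "('m::topological_space, 'e::complex_euclidean) chart set \<Rightarrow> ('m, 'e) distribution \<Rightarrow>
     'm set \<times> ('m \<Rightarrow> cp1) \<Rightarrow> bool" where
  "F_chart A F = (\<lambda>(U, f).
     open U \<and> holomorphic_submersion_on A cp1_atlas U f \<and>
     (\<forall>L\<in>leaves A F U. \<forall>K\<in>components L. \<exists>y. \<forall>p\<in>K. f p = y))"

definition F_atlas ::
    "('m::topological_space, 'e::complex_euclidean) chart set \<Rightarrow> ('m, 'e) distribution \<Rightarrow>
     ('m set \<times> ('m \<Rightarrow> cp1)) set \<Rightarrow> bool" where
  "F_atlas A F \<U> \<longleftrightarrow> (\<forall>u\<in>\<U>. F_chart A F u) \<and> (\<Union>u\<in>\<U>. fst u) = UNIV"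

definition projective_F_atlas ::
    "('m::topological_space, 'e::complex_euclidean) chart set \<Rightarrow> ('m, 'e) distribution \<Rightarrow>
     ('m set \<times> ('m \<Rightarrow> cp1)) set \<Rightarrow> bool" where
  "projective_F_atlas A F \<U> \<longleftrightarrow> F_atlas A F \<U> \<and>
     (\<forall>(U, f)\<in>\<U>. \<forall>(U', f')\<in>\<U>. \<forall>V\<in>components (U \<inter> U').
        \<exists>T. moebius T \<and> (\<forall>p\<in>V. f' p = T (f p)))"

definition F_projective_structures ::
    "('m::topological_space, 'e::complex_euclidean) chart set \<Rightarrow> ('m, 'e) distribution \<Rightarrow>
     ('m set \<times> ('m \<Rightarrow> cp1)) set set set" where
  "F_projective_structures A F =
     {\<U>. projective_F_atlas A F \<U>} //
     {(\<U>, \<V>). projective_F_atlas A F \<U> \<and> projective_F_atlas A F \<V> \<and>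
        projective_F_atlas A F (\<U> \<union> \<V>)}"


section \<open>The foliation on the product of two Riemann surfaces\<close>

text \<open>Let \<open>P\<close> be the set of poles of \<open>\<omega>\<close>, all assumed simple, and \<open>N\<close> an open set of the product in
  the domain of \<open>product_chart a b\<close>, with coordinates \<open>(z, w)\<close>.  Then \<open>s\<close> is a section over \<open>N\<close> of
  the line bundle of functions vanishing on \<open>P \<times> X\<close>, and \<open>\<alpha>\<close> consists of the \<open>dz\<close>- and
  \<open>dw\<close>-coefficients of the image of \<open>s\<close> in the cotangent bundle, i.e. of the holomorphic extension
  of \<open>s \<cdot> (\<omega> a z dz + \<beta> b w dw)\<close> across \<open>P \<times> X\<close>.\<close>

definition conormal_section ::
    "('m::topological_space, complex) chart set \<Rightarrow> ('n::topological_space, complex) chart set \<Rightarrow>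
     'm set \<Rightarrow> 'm one_form \<Rightarrow> 'n one_form \<Rightarrow> ('m, complex) chart \<Rightarrow> ('n, complex) chart \<Rightarrow>
     ('m \<times> 'n) set \<Rightarrow> ('m \<times> 'n \<Rightarrow> complex) \<Rightarrow> ('m \<times> 'n \<Rightarrow> complex \<times> complex) \<Rightarrow> bool" where
  "conormal_section A B P \<omega> \<beta> a b N s \<alpha> \<longleftrightarrow>
     open N \<and> N \<subseteq> fst a \<times> fst b \<and>
     holomorphic_map_on (product_atlas A B) standard_atlas N s \<and>
     (\<forall>q\<in>N. fst q \<in> P \<longrightarrow> s q = 0) \<and>
     holomorphic_map_on (product_atlas A B) standard_atlas N \<alpha> \<and>
     (\<forall>q\<in>N. fst q \<notin> P \<longrightarrow>
        \<alpha> q = (s q * \<omega> a (snd a (fst q)), s q * \<beta> b (snd b (snd q))))"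

definition product_foliation ::
    "('m::topological_space, complex) chart set \<Rightarrow> ('n::topological_space, complex) chart set \<Rightarrow>
     'm set \<Rightarrow> 'm one_form \<Rightarrow> 'n one_form \<Rightarrow> ('m \<times> 'n, complex \<times> complex) distribution" where
  "product_foliation A B P \<omega> \<beta> =
     {(product_chart a b, p, v) | a b p v.
        a \<in> A \<and> b \<in> B \<and> p \<in> fst a \<times> fst b \<and>
        (\<forall>N s \<alpha>. p \<in> N \<and> conormal_section A B P \<omega> \<beta> a b N s \<alpha> \<longrightarrow>
           fst (\<alpha> p) * fst v + snd (\<alpha> p) * snd v = 0)}"

end

theory Submission
  imports Defs
begin

text \<open>A foliated chart is locally a function of \<open>u = \<integral>\<omega> + \<integral>\<beta>\<close>, and \<open>u\<close> is unique up to an additive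
  constant.  The difference of the Schwarzians, with respect to \<open>u\<close>, of the charts of two projective
  structures is therefore a holomorphic function \<open>q\<close> away from the poles of \<open>\<omega>\<close> and the common zeros
  of \<open>\<omega>\<close> and \<open>\<beta>\<close>.  By the maximum principle \<open>q\<close> is constant on almost every fibre \<open>{c} \<times> X\<close>.
  On a curve \<open>C \<times> {w}\<close> with \<open>\<beta>(w) \<noteq> 0\<close>, a local coordinate \<open>z\<close> of \<open>C\<close> gives
  \<open>q = (S\<^sub>z f' - S\<^sub>z f) / \<omega>(z)\<^sup>2\<close>, which tends to \<open>0\<close> at the poles of \<open>\<omega>\<close>; since \<open>\<omega>\<close> has a pole,
  the maximum principle on \<open>C\<close> yields \<open>q = 0\<close>, so that the charts differ by Moebius maps.\<close>

section \<open>The Schwarzian derivative\<close>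

text \<open>Why differences are taken: with
  \<open>u = \<integral>\<omega> + \<integral>\<beta>\<close>, the chain rule along a curve
  \<open>w = const\<close> reads \<open>S_z f = (S_u f) \<omega>(z)^2 + S_z u\<close>. The term
  \<open>S_z u\<close> is singular at a simple pole of \<omega>, but it is the same for both
  structures and cancels. Why a single curve is enough: a fibre over a point where \<omega> is
  finite and nonzero contains no critical point of \<open>u\<close>, so constancy on these fibres
  moves the whole comparison to one slice \<open>w = w\<^sub>0\<close>. Choosing \<beta> nonzero at
  \<open>w\<^sub>0\<close> keeps the zeros of \<omega> on that slice regular for \<open>u\<close>,
  which leaves only the poles to examine. Two obstacles shape the rest. A foliated chart is only
  known to be constant on components of leaves, and leaves are chains of holomorphic discs, so its
  factorization through \<open>u\<close> has to come from explicit discs. And the comparison of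
  Schwarzians yields Moebius relations only off the fibres over poles and zeros of \<omega>; these
  relations must then be carried across those fibres and glued over whole components of
  overlaps.\<close>

definition pre_schwarzian :: "(complex \<Rightarrow> complex) \<Rightarrow> complex \<Rightarrow> complex" where
  "pre_schwarzian f z = deriv (deriv f) z / deriv f z"

text \<open>Expands to the usual \<open>f'''/f' - (3/2) (f''/f')^2\<close>. It is expressed through
  \<open>f''/f'\<close> because that quantity has a simple chain rule of its own, which then needs
  only one more derivative.\<close>

definition schwarzian :: "(complex \<Rightarrow> complex) \<Rightarrow> complex \<Rightarrow> complex" where
  "schwarzian f z = deriv (pre_schwarzian f) z - (pre_schwarzian f z)\<^sup>2 / 2"

section \<open>Germs of analytic functions\<close>

lemma eventually_analytic_at:
  assumes "f analytic_on {z}"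
  shows "eventually (\<lambda>w. f analytic_on {w}) (nhds z)"
proof -
  obtain S where "open S" "z \<in> S" "f holomorphic_on S"
    using assms analytic_at by blast
  then show ?thesis
    using eventually_nhds analytic_at by blast
qed

lemma analytic_deriv_at: "f analytic_on {z} \<Longrightarrow> deriv f analytic_on {z}"
  by (metis analytic_at holomorphic_deriv)

lemma analytic_has_deriv: "f analytic_on {z} \<Longrightarrow> (f has_field_derivative deriv f z) (at z)"
  by (simp add: analytic_on_imp_differentiable_at DERIV_deriv_iff_field_differentiable)

lemma eventually_neq_nhds:
  fixes f :: "'a::t2_space \<Rightarrow> 'b::t1_space"
  assumes "isCont f z" "f z \<noteq> c"
  shows "eventually (\<lambda>w. f w \<noteq> c) (nhds z)"
  using assms tendsto_imp_eventually_ne[of f "f z" "nhds z" c]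
  by (simp add: continuous_at tendsto_at_iff_tendsto_nhds)

lemma eventually_deriv_nz:
  assumes "f analytic_on {z}" "deriv f z \<noteq> 0"
  shows "eventually (\<lambda>w. deriv f w \<noteq> 0) (nhds z)"
  using assms by (intro eventually_neq_nhds analytic_at_imp_isCont analytic_deriv_at)

lemma eventually_nhds_compose:
  assumes "isCont f z" "eventually P (nhds (f z))"
  shows "eventually (\<lambda>w. P (f w)) (nhds z)"
  using assms eventually_compose_filterlim[of P "nhds (f z)" f "nhds z"]
  by (simp add: continuous_at tendsto_at_iff_tendsto_nhds)

lemma analytic_pre_schwarzian:
  assumes "f analytic_on {z}" "deriv f z \<noteq> 0"
  shows "pre_schwarzian f analytic_on {z}"
  unfolding pre_schwarzian_def using assms
  by (intro analytic_on_divide analytic_deriv_at) auto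

lemma analytic_schwarzian:
  assumes "f analytic_on {z}" "deriv f z \<noteq> 0"
  shows "schwarzian f analytic_on {z}"
  unfolding schwarzian_def
  by (intro analytic_intros analytic_deriv_at analytic_pre_schwarzian assms) auto

text \<open>Agreement near \<open>z\<close> is also agreement near every nearby point, so equality
  of germs passes to derivatives as equality of germs and can be iterated.\<close>

lemma deriv_cong_eventually:
  assumes "eventually (\<lambda>w. f w = g w) (nhds z)"
  shows "eventually (\<lambda>w. deriv f w = deriv g w) (nhds z)"
proof -
  have "eventually (\<lambda>w. eventually (\<lambda>v. f v = g v) (nhds w)) (nhds z)"
    using assms by (simp add: eventually_eventually)
  then show ?thesis by eventually_elim (auto intro: deriv_cong_ev)
qed

lemma schwarzian_cong:
  assumes "eventually (\<lambda>w. f w = g w) (nhds z)"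
  shows "schwarzian f z = schwarzian g z"
proof -
  note 1 = deriv_cong_eventually[OF assms]
  note 2 = deriv_cong_eventually[OF 1]
  have 3: "eventually (\<lambda>w. pre_schwarzian f w = pre_schwarzian g w) (nhds z)"
    using 1 2 by eventually_elim (simp add: pre_schwarzian_def)
  show ?thesis
    unfolding schwarzian_def
    using deriv_cong_eventually[OF 3, THEN eventually_nhds_x_imp_x]
      eventually_nhds_x_imp_x[OF 3] by simp
qed

section \<open>The chain rule for the Schwarzian\<close>

lemma deriv_compose_analytic:
  assumes "g analytic_on {z}" "f analytic_on {g z}"
  shows "deriv (\<lambda>w. f (g w)) z = deriv f (g z) * deriv g z"
  by (intro DERIV_imp_deriv DERIV_chain2 analytic_has_deriv assms)

lemma analytic_compose_at:
  assumes "g analytic_on {z}" "f analytic_on {g z}"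
  shows "(\<lambda>w. f (g w)) analytic_on {z}"
  using analytic_on_compose[of g "{z}" f] assms by (simp add: o_def)

text \<open>This is logarithmic differentiation of \<open>(f o g)' = f'(g) g'\<close>.\<close>

lemma pre_schwarzian_compose:
  assumes g: "g analytic_on {z}" and f: "f analytic_on {g z}"
    and nz: "deriv f (g z) \<noteq> 0" "deriv g z \<noteq> 0"
  shows "pre_schwarzian (\<lambda>w. f (g w)) z =
    pre_schwarzian f (g z) * deriv g z + pre_schwarzian g z"
proof -
  have ev: "eventually (\<lambda>w. f analytic_on {g w}) (nhds z)"
    by (rule eventually_nhds_compose[OF analytic_at_imp_isCont[OF g] eventually_analytic_at[OF f]])
  have "eventually (\<lambda>w. deriv (\<lambda>w. f (g w)) w = deriv f (g w) * deriv g w) (nhds z)"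
    using ev eventually_analytic_at[OF g]
    by eventually_elim (rule deriv_compose_analytic)
  then have "deriv (deriv (\<lambda>w. f (g w))) z = deriv (\<lambda>w. deriv f (g w) * deriv g w) z"
    by (intro deriv_cong_ev) auto
  also have "\<dots> = deriv f (g z) * deriv (deriv g) z + deriv (deriv f) (g z) * deriv g z * deriv g z"
  proof (rule DERIV_imp_deriv)
    have "((\<lambda>w. deriv f (g w)) has_field_derivative deriv (deriv f) (g z) * deriv g z) (at z)"
      by (intro DERIV_chain2 analytic_has_deriv analytic_deriv_at f g)
    from DERIV_mult[OF this analytic_has_deriv[OF analytic_deriv_at[OF g]]]
    show "((\<lambda>w. deriv f (g w) * deriv g w) has_field_derivative
        deriv f (g z) * deriv (deriv g) z + deriv (deriv f) (g z) * deriv g z * deriv g z) (at z)"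
      by (simp add: algebra_simps)
  qed
  finally show ?thesis
    using nz by (simp add: pre_schwarzian_def deriv_compose_analytic[OF g f] field_simps)
qed

text \<open>Differentiating the rule for \<open>pre_schwarzian\<close> gives a cross term containing
  \<open>deriv (deriv g) z\<close>. Since \<open>g'' = g' * pre_schwarzian g\<close>, it cancels
  against the mixed term of the square; the factor 1/2 in the definition is what makes this
  happen.\<close>

lemma schwarzian_compose:
  assumes g: "g analytic_on {z}" and f: "f analytic_on {g z}"
    and nz: "deriv f (g z) \<noteq> 0" "deriv g z \<noteq> 0"
  shows "schwarzian (\<lambda>w. f (g w)) z = schwarzian f (g z) * (deriv g z)\<^sup>2 + schwarzian g z"
proof -
  have ev: "eventually (\<lambda>w. f analytic_on {g w} \<and> deriv f (g w) \<noteq> 0) (nhds z)"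
    by (rule eventually_nhds_compose[OF analytic_at_imp_isCont[OF g]
          eventually_conj[OF eventually_analytic_at[OF f] eventually_deriv_nz[OF f nz(1)]]])
  have "eventually (\<lambda>w. pre_schwarzian (\<lambda>w. f (g w)) w =
      pre_schwarzian f (g w) * deriv g w + pre_schwarzian g w) (nhds z)"
    using ev eventually_analytic_at[OF g] eventually_deriv_nz[OF g nz(2)]
    by eventually_elim (intro pre_schwarzian_compose; simp)
  then have "deriv (pre_schwarzian (\<lambda>w. f (g w))) z =
      deriv (\<lambda>w. pre_schwarzian f (g w) * deriv g w + pre_schwarzian g w) z"
    by (intro deriv_cong_ev) auto
  also have "\<dots> = pre_schwarzian f (g z) * deriv (deriv g) z +
      deriv (pre_schwarzian f) (g z) * deriv g z * deriv g z + deriv (pre_schwarzian g) z"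
  proof (rule DERIV_imp_deriv)
    have "((\<lambda>w. pre_schwarzian f (g w)) has_field_derivative
        deriv (pre_schwarzian f) (g z) * deriv g z) (at z)"
      by (intro DERIV_chain2 analytic_has_deriv analytic_pre_schwarzian f g nz)
    from DERIV_add[OF DERIV_mult[OF this analytic_has_deriv[OF analytic_deriv_at[OF g]]]
        analytic_has_deriv[OF analytic_pre_schwarzian[OF g nz(2)]]]
    show "((\<lambda>w. pre_schwarzian f (g w) * deriv g w + pre_schwarzian g w) has_field_derivative
        pre_schwarzian f (g z) * deriv (deriv g) z +
        deriv (pre_schwarzian f) (g z) * deriv g z * deriv g z + deriv (pre_schwarzian g) z) (at z)"
      by (simp add: algebra_simps)
  qed
  finally have *: "deriv (pre_schwarzian (\<lambda>w. f (g w))) z =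
      pre_schwarzian f (g z) * deriv (deriv g) z +
      deriv (pre_schwarzian f) (g z) * deriv g z * deriv g z + deriv (pre_schwarzian g) z" .
  have **: "deriv (deriv g) z = deriv g z * pre_schwarzian g z"
    using nz by (simp add: pre_schwarzian_def)
  show ?thesis
    unfolding schwarzian_def * pre_schwarzian_compose[OF g f nz] **
    by (simp add: algebra_simps power2_eq_square add_divide_distrib diff_divide_distrib)
qed

section \<open>Moebius maps have vanishing Schwarzian\<close>

lemma schwarzian_affine: "schwarzian (\<lambda>w. w + c) z = 0"
proof -
  have "deriv (\<lambda>w. w + c) = (\<lambda>_. 1)"
    by (intro ext DERIV_imp_deriv) (auto intro!: derivative_eq_intros)
  then have "pre_schwarzian (\<lambda>w. w + c) = (\<lambda>_. 0)"
    by (intro ext) (simp add: pre_schwarzian_def)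
  then show ?thesis by (simp add: schwarzian_def)
qed

lemma has_deriv_moebius:
  fixes a b c d z :: complex
  assumes "c * z + d \<noteq> 0"
  shows "((\<lambda>w. (a * w + b) / (c * w + d)) has_field_derivative
     (a * d - b * c) / (c * z + d)\<^sup>2) (at z)"
  using assms by (auto intro!: derivative_eq_intros simp: power2_eq_square field_simps)

lemma schwarzian_moebius:
  fixes a b c d z :: complex
  assumes nz: "c * z + d \<noteq> 0" and det: "a * d - b * c \<noteq> 0"
  shows "schwarzian (\<lambda>w. (a * w + b) / (c * w + d)) z = 0"
proof -
  let ?M = "\<lambda>w. (a * w + b) / (c * w + d)"
  have ev: "eventually (\<lambda>w. c * w + d \<noteq> 0) (nhds z)"
    by (intro eventually_neq_nhds nz continuous_intros)
  have d1: "deriv ?M w = (a * d - b * c) / (c * w + d)\<^sup>2" if "c * w + d \<noteq> 0" for w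
    using that by (intro DERIV_imp_deriv has_deriv_moebius)
  have d2: "deriv (deriv ?M) w = - 2 * c * (a * d - b * c) / (c * w + d) ^ 3"
    if w: "c * w + d \<noteq> 0" for w
  proof -
    have "eventually (\<lambda>w. c * w + d \<noteq> 0) (nhds w)"
      by (intro eventually_neq_nhds w continuous_intros)
    then have "eventually (\<lambda>v. deriv ?M v = (a * d - b * c) / (c * v + d)\<^sup>2) (nhds w)"
      by eventually_elim (rule d1)
    then have "deriv (deriv ?M) w = deriv (\<lambda>v. (a * d - b * c) / (c * v + d)\<^sup>2) w"
      by (intro deriv_cong_ev) auto
    also have "\<dots> = - 2 * c * (a * d - b * c) / (c * w + d) ^ 3"
    proof (rule DERIV_imp_deriv)
      define D where "D = a * d - b * c"
      have "((\<lambda>v. D * inverse ((c * v + d)\<^sup>2)) has_field_derivative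
          D * (- (inverse ((c * w + d)\<^sup>2) * (2 * (c * w + d) * c) * inverse ((c * w + d)\<^sup>2)))) (at w)"
        using w by (auto intro!: derivative_eq_intros)
      also have "D * (- (inverse ((c * w + d)\<^sup>2) * (2 * (c * w + d) * c) * inverse ((c * w + d)\<^sup>2)))
          = - 2 * c * D / (c * w + d) ^ 3"
      proof -
        define q where "q = c * w + d"
        have "q \<noteq> 0" using w by (simp add: q_def)
        then show ?thesis
          unfolding q_def[symmetric] by (simp add: field_simps power2_eq_square power3_eq_cube)
      qed
      finally show "((\<lambda>v. (a * d - b * c) / (c * v + d)\<^sup>2) has_field_derivative
          - 2 * c * (a * d - b * c) / (c * w + d) ^ 3) (at w)"
        unfolding D_def divide_inverse[symmetric] .
    qed
    finally show ?thesis .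
  qed
  have p: "pre_schwarzian ?M w = - 2 * c / (c * w + d)" if "c * w + d \<noteq> 0" for w
  proof -
    define q where "q = c * w + d"
    define D where "D = a * d - b * c"
    have "q \<noteq> 0" "D \<noteq> 0" using that det by (auto simp: q_def D_def)
    then show ?thesis
      unfolding pre_schwarzian_def d1[OF that] d2[OF that] q_def[symmetric] D_def[symmetric]
      by (simp add: divide_simps power2_eq_square power3_eq_cube)
  qed
  have "eventually (\<lambda>w. pre_schwarzian ?M w = - 2 * c / (c * w + d)) (nhds z)"
    using ev by eventually_elim (rule p)
  \<comment> \<open>The numerator is padded to the shape of a fractional linear map, so that
    \<open>has_deriv_moebius\<close> differentiates this quotient as well.\<close>
  then have "deriv (pre_schwarzian ?M) z = deriv (\<lambda>w. (0 * w + - 2 * c) / (c * w + d)) z"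
    by (intro deriv_cong_ev) auto
  also have "\<dots> = (0 * d - (- 2 * c) * c) / (c * z + d)\<^sup>2"
    using nz by (intro DERIV_imp_deriv has_deriv_moebius)
  finally show ?thesis
    by (simp add: schwarzian_def p[OF nz] power_divide power2_eq_square)
qed

text \<open>If the denominator vanished, the relation would make the numerator vanish too, and the
  determinant is a combination of the two.\<close>

lemma moebius_denominator_nz:
  fixes a b c d F F' :: complex
  assumes "F' * (c * F + d) = a * F + b" "a * d - b * c \<noteq> 0"
  shows "c * F + d \<noteq> 0"
proof
  assume z: "c * F + d = 0"
  with assms have "a * F + b = 0" by simp
  have "a * d - b * c = a * (c * F + d) - c * (a * F + b)" by (simp only: algebra_simps)
  with z \<open>a * F + b = 0\<close> assms(2) show False by simp
qed

text \<open>Moebius relations are stated without division, so that they pass to limits.\<close>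

lemma schwarzian_moebius_related:
  assumes f: "f analytic_on {z}" "deriv f z \<noteq> 0" and det: "a * d - b * c \<noteq> 0"
    and rel: "eventually (\<lambda>w. g w * (c * f w + d) = a * f w + b) (nhds z)"
  shows "schwarzian g z = schwarzian f z"
proof -
  let ?M = "\<lambda>w. (a * w + b) / (c * w + d)"
  have nz: "c * f z + d \<noteq> 0"
    using moebius_denominator_nz[OF eventually_nhds_x_imp_x[OF rel] det] .
  have "eventually (\<lambda>w. g w = ?M (f w)) (nhds z)"
    using rel by eventually_elim
      (metis det moebius_denominator_nz nonzero_eq_divide_eq)
  then have "schwarzian g z = schwarzian (\<lambda>w. ?M (f w)) z"
    by (rule schwarzian_cong)
  also have "\<dots> = schwarzian ?M (f z) * (deriv f z)\<^sup>2 + schwarzian f z"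
  proof (rule schwarzian_compose)
    show "?M analytic_on {f z}"
      using nz by (intro analytic_intros) auto
    show "deriv ?M (f z) \<noteq> 0"
      using nz det DERIV_imp_deriv[OF has_deriv_moebius[OF nz, of a b]] by simp
  qed (use f in auto)
  finally show ?thesis using schwarzian_moebius[OF nz det] by simp
qed

section \<open>From equal Schwarzians to a Moebius relation\<close>

lemma analytic_local_inverse:
  assumes f: "f analytic_on {z}" and nz: "deriv f z \<noteq> 0"
  obtains k where "k analytic_on {f z}" "deriv k (f z) \<noteq> 0" "k (f z) = z"
    "eventually (\<lambda>w. k (f w) = w) (nhds z)" "eventually (\<lambda>t. f (k t) = t) (nhds (f z))"
proof -
  obtain S where S: "open S" "z \<in> S" "f holomorphic_on S"
    using f analytic_at by blast
  obtain r where r: "r > 0" "ball z r \<subseteq> S" "open (f ` ball z r)" "inj_on f (ball z r)"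
    using has_complex_derivative_locally_invertible[OF S(3,2,1) nz] by blast
  obtain k where k: "k holomorphic_on f ` ball z r"
      "\<And>w. w \<in> ball z r \<Longrightarrow> deriv f w * deriv k (f w) = 1"
      "\<And>w. w \<in> ball z r \<Longrightarrow> k (f w) = w"
    using holomorphic_has_inverse[of f "ball z r"] S r holomorphic_on_subset by (metis open_ball)
  have z: "z \<in> ball z r" using r by simp
  show ?thesis
  proof (rule that)
    show "k analytic_on {f z}" using k(1) r(3) z analytic_at by blast
    show "deriv k (f z) \<noteq> 0" using k(2)[OF z] by auto
    show "k (f z) = z" using k(3)[OF z] .
    show "eventually (\<lambda>w. k (f w) = w) (nhds z)"
      using k(3) z open_ball eventually_nhds by blast
    show "eventually (\<lambda>t. f (k t) = t) (nhds (f z))"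
      unfolding eventually_nhds using r(3) z k(3) by (intro exI[of _ "f ` ball z r"]) auto
  qed
qed

lemma eventually_nhds_ball:
  fixes z :: "'a::metric_space"
  shows "eventually P (nhds z) \<longleftrightarrow> (\<exists>e>0. \<forall>w\<in>ball z e. P w)"
  by (auto simp: eventually_nhds_metric dist_commute)

lemma zero_derivative_on_ball:
  fixes f :: "complex \<Rightarrow> complex"
  assumes "\<And>w. w \<in> ball z e \<Longrightarrow> (f has_field_derivative 0) (at w)" "e > 0" "w \<in> ball z e"
  shows "f w = f z"
proof -
  have "\<exists>c. \<forall>x\<in>ball z e. f x = c"
    by (rule has_field_derivative_zero_constant[OF convex_ball has_field_derivative_at_within[OF assms(1)]])
  then show ?thesis using assms(2,3) by (metis centre_in_ball)
qed

text \<open>With \<open>u = \<phi>''/\<phi>'\<close> the equation says \<open>u' = u\<^sup>2/2\<close>, so \<open>u\<close> and \<open>v t = 2 + (t - t\<^sub>0) u t\<close>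
  both solve \<open>y' = (u/2) y\<close> and \<open>u/v\<close> is constant; this integrates explicitly.\<close>

lemma schwarzian_zero_imp_moebius:
  assumes ph: "\<phi> analytic_on {t0}" and nz: "deriv \<phi> t0 \<noteq> 0"
    and S: "eventually (\<lambda>t. schwarzian \<phi> t = 0) (nhds t0)"
  shows "\<exists>a b c d. a * d - b * c \<noteq> 0 \<and>
    eventually (\<lambda>t. \<phi> t * (c * t + d) = a * t + b) (nhds t0)"
proof -
  let ?u = "pre_schwarzian \<phi>"
  define v where "v t = 2 + (t - t0) * ?u t" for t
  \<comment> \<open>Since \<open>v t0 = 2\<close>, this is the constant value of \<open>u/v\<close>.
    Solving \<open>u = \<kappa> v\<close> gives \<open>u = 2 \<kappa> / D\<close> with
    \<open>D = 1 - \<kappa> (t - t0)\<close>, which is why \<open>D\<close> appears below.\<close>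
  define \<kappa> where "\<kappa> = ?u t0 / 2"
  have va: "v analytic_on {t0}"
    unfolding v_def by (intro analytic_intros analytic_pre_schwarzian ph nz)
  have "eventually (\<lambda>t. \<phi> analytic_on {t} \<and> deriv \<phi> t \<noteq> 0 \<and> schwarzian \<phi> t = 0 \<and>
      v t \<noteq> 0 \<and> 1 - \<kappa> * (t - t0) \<noteq> 0) (nhds t0)"
    by (intro eventually_conj eventually_analytic_at eventually_deriv_nz ph nz S
        eventually_neq_nhds[where f = v] analytic_at_imp_isCont va
        eventually_neq_nhds[where f = "\<lambda>t. 1 - \<kappa> * (t - t0)"] continuous_intros) (auto simp: v_def)
  then obtain e where e: "e > 0" "\<And>t. t \<in> ball t0 e \<Longrightarrow> \<phi> analytic_on {t}"
      "\<And>t. t \<in> ball t0 e \<Longrightarrow> deriv \<phi> t \<noteq> 0"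
      "\<And>t. t \<in> ball t0 e \<Longrightarrow> schwarzian \<phi> t = 0" "\<And>t. t \<in> ball t0 e \<Longrightarrow> v t \<noteq> 0"
      "\<And>t. t \<in> ball t0 e \<Longrightarrow> 1 - \<kappa> * (t - t0) \<noteq> 0"
    unfolding eventually_nhds_ball by blast
  have du: "(?u has_field_derivative (?u t)\<^sup>2 / 2) (at t)" if "t \<in> ball t0 e" for t
  proof -
    have "deriv ?u t = (?u t)\<^sup>2 / 2"
      using e(4)[OF that] unfolding schwarzian_def by (rule eq_iff_diff_eq_0[THEN iffD2])
    with analytic_has_deriv[OF analytic_pre_schwarzian[OF e(2,3)], OF that that]
    show ?thesis by (simp only:)
  qed
  have dv: "(v has_field_derivative ?u t * v t / 2) (at t)" if "t \<in> ball t0 e" for t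
  proof -
    have "((\<lambda>t. 2 + (t - t0) * ?u t) has_field_derivative
        0 + ((t - t0) * ((?u t)\<^sup>2 / 2) + (1 - 0) * ?u t)) (at t)"
      by (intro DERIV_add DERIV_mult' DERIV_diff du[OF that]) (auto intro!: derivative_eq_intros)
    also have "0 + ((t - t0) * ((?u t)\<^sup>2 / 2) + (1 - 0) * ?u t) = ?u t * v t / 2"
      by (simp add: v_def power2_eq_square algebra_simps add_divide_distrib diff_divide_distrib)
    finally show ?thesis by (simp add: v_def[abs_def])
  qed
  have "?u t / v t = ?u t0 / v t0" if "t \<in> ball t0 e" for t
  proof (rule zero_derivative_on_ball[of t0 e "\<lambda>t. ?u t / v t"])
    fix s assume s: "s \<in> ball t0 e"
    show "((\<lambda>t. ?u t / v t) has_field_derivative 0) (at s)"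
      using DERIV_divide[OF du[OF s] dv[OF s] e(5)[OF s]] by (simp add: power2_eq_square)
  qed (use e that in auto)
  then have u: "?u t = \<kappa> * v t" if "t \<in> ball t0 e" for t
    using e(5)[OF that] that by (simp add: v_def \<kappa>_def divide_simps)
  have u': "?u t * (1 - \<kappa> * (t - t0)) = 2 * \<kappa>" if "t \<in> ball t0 e" for t
    using u[OF that] by (simp add: v_def algebra_simps)
  have dd: "(deriv \<phi> has_field_derivative ?u t * deriv \<phi> t) (at t)" if "t \<in> ball t0 e" for t
  proof -
    have "deriv (deriv \<phi>) t = ?u t * deriv \<phi> t"
      using e(3)[OF that] by (simp add: pre_schwarzian_def)
    with analytic_has_deriv[OF analytic_deriv_at[OF e(2)[OF that]]] show ?thesis by (simp only:)
  qed
  \<comment> \<open>The functions \<phi>' and \<open>1/D^2\<close> have the same logarithmic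
    derivative \<open>2 \<kappa> / D\<close>; one more integration gives \<open>p0\<close>.\<close>
  have p1: "deriv \<phi> t * (1 - \<kappa> * (t - t0))\<^sup>2 = deriv \<phi> t0 * (1 - \<kappa> * (t0 - t0))\<^sup>2"
    if "t \<in> ball t0 e" for t
  proof (rule zero_derivative_on_ball[of t0 e "\<lambda>t. deriv \<phi> t * (1 - \<kappa> * (t - t0))\<^sup>2"])
    fix s assume s: "s \<in> ball t0 e"
    have "((\<lambda>t. deriv \<phi> t * (1 - \<kappa> * (t - t0))\<^sup>2) has_field_derivative
        (?u s * (1 - \<kappa> * (s - t0)) - 2 * \<kappa>) * deriv \<phi> s * (1 - \<kappa> * (s - t0))) (at s)"
      by (auto intro!: derivative_eq_intros dd[OF s]) (simp add: power2_eq_square algebra_simps)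
    then show "((\<lambda>t. deriv \<phi> t * (1 - \<kappa> * (t - t0))\<^sup>2) has_field_derivative 0) (at s)"
      using u'[OF s] by simp
  qed (use e that in auto)
  have p0: "\<phi> t - deriv \<phi> t0 * (t - t0) / (1 - \<kappa> * (t - t0)) =
      \<phi> t0 - deriv \<phi> t0 * (t0 - t0) / (1 - \<kappa> * (t0 - t0))" if "t \<in> ball t0 e" for t
  proof (rule zero_derivative_on_ball[of t0 e "\<lambda>t. \<phi> t - deriv \<phi> t0 * (t - t0) / (1 - \<kappa> * (t - t0))"])
    fix s assume s: "s \<in> ball t0 e"
    have "((\<lambda>t. \<phi> t - deriv \<phi> t0 * (t - t0) / (1 - \<kappa> * (t - t0))) has_field_derivative
        deriv \<phi> s - deriv \<phi> t0 / (1 - \<kappa> * (s - t0))\<^sup>2) (at s)"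
    proof -
      define D where "D = 1 - \<kappa> * (s - t0)"
      have D: "D \<noteq> 0" "(s - t0) * \<kappa> = 1 - D" using e(6)[OF s] by (auto simp: D_def)
      have "((\<lambda>t. \<phi> t - deriv \<phi> t0 * (t - t0) / (1 - \<kappa> * (t - t0))) has_field_derivative
          deriv \<phi> s - (deriv \<phi> t0 * D - deriv \<phi> t0 * (s - t0) * (- \<kappa>)) / (D * D)) (at s)"
        unfolding D_def
        by (intro DERIV_diff DERIV_divide analytic_has_deriv e(2) s e(6))
          (auto intro!: derivative_eq_intros)
      also have "deriv \<phi> t0 * D - deriv \<phi> t0 * (s - t0) * (- \<kappa>) = deriv \<phi> t0 * (D + (s - t0) * \<kappa>)"
        by (simp add: algebra_simps)
      finally show ?thesis by (simp add: D power2_eq_square D_def[symmetric])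
    qed
    moreover have "deriv \<phi> s = deriv \<phi> t0 / (1 - \<kappa> * (s - t0))\<^sup>2"
      using p1[OF s] e(6)[OF s] by (simp add: divide_simps)
    ultimately show "((\<lambda>t. \<phi> t - deriv \<phi> t0 * (t - t0) / (1 - \<kappa> * (t - t0)))
        has_field_derivative 0) (at s)" by simp
  qed (use e that in auto)
  \<comment> \<open>These are the coefficients of
    \<open>\<phi> t0 + deriv \<phi> t0 * (t - t0) / D\<close> over the common denominator
    \<open>D = c * t + d\<close>. Their determinant is \<open>deriv \<phi> t0\<close>.\<close>
  define c where "c = - \<kappa>"
  define d where "d = 1 + \<kappa> * t0"
  define a where "a = deriv \<phi> t0 - \<kappa> * \<phi> t0"
  define b where "b = \<phi> t0 * (1 + \<kappa> * t0) - deriv \<phi> t0 * t0"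
  have "a * d - b * c \<noteq> 0"
    using nz by (simp add: a_def b_def c_def d_def algebra_simps)
  moreover have "\<phi> t * (c * t + d) = a * t + b" if "t \<in> ball t0 e" for t
  proof -
    define D where "D = 1 - \<kappa> * (t - t0)"
    have D: "D \<noteq> 0" "D = c * t + d"
      using e(6)[OF that] by (auto simp: D_def c_def d_def algebra_simps)
    have "\<phi> t = \<phi> t0 + deriv \<phi> t0 * (t - t0) / D"
      using p0[OF that] unfolding D_def[symmetric] by (simp add: diff_eq_eq)
    then have "\<phi> t * D = \<phi> t0 * D + deriv \<phi> t0 * (t - t0)" using D(1) by (simp add: field_simps)
    also have "\<dots> = a * t + b" by (simp add: D_def a_def b_def algebra_simps)
    finally show ?thesis by (simp add: D(2))
  qed
  ultimately show ?thesis
    unfolding eventually_nhds_ball using e(1) by blast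
qed

text \<open>Take \<open>f\<close> as coordinate: for a local inverse \<open>k\<close> of
  \<open>f\<close>, the chain rule gives \<open>g o k\<close> the same Schwarzian as
  \<open>f o k\<close>, which is the identity. The case of vanishing Schwarzian then applies to
  \<open>g o k\<close>.\<close>

lemma schwarzian_eq_imp_moebius_related:
  assumes f: "f analytic_on {z}" "deriv f z \<noteq> 0" and g: "g analytic_on {z}" "deriv g z \<noteq> 0"
    and S: "eventually (\<lambda>w. schwarzian g w = schwarzian f w) (nhds z)"
  shows "\<exists>a b c d. a * d - b * c \<noteq> 0 \<and>
    eventually (\<lambda>w. g w * (c * f w + d) = a * f w + b) (nhds z)"
proof -
  obtain k where k: "k analytic_on {f z}" "deriv k (f z) \<noteq> 0" "k (f z) = z"
    "eventually (\<lambda>w. k (f w) = w) (nhds z)" "eventually (\<lambda>t. f (k t) = t) (nhds (f z))"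
    using analytic_local_inverse[OF f] by blast
  have ct: "isCont k (f z)" by (rule analytic_at_imp_isCont[OF k(1)])
  let ?\<phi> = "\<lambda>t. g (k t)"
  have ph: "?\<phi> analytic_on {f z}" using analytic_compose_at[OF k(1)] g(1) k(3) by simp
  have "deriv ?\<phi> (f z) \<noteq> 0"
    using deriv_compose_analytic[OF k(1)] g k(2,3) by simp
  moreover have "eventually (\<lambda>t. schwarzian ?\<phi> t = 0) (nhds (f z))"
  proof -
    have "eventually (\<lambda>w. (f analytic_on {w} \<and> deriv f w \<noteq> 0) \<and> (g analytic_on {w} \<and> deriv g w \<noteq> 0) \<and>
        schwarzian g w = schwarzian f w) (nhds (k (f z)))"
      unfolding k(3) by (intro eventually_conj eventually_analytic_at eventually_deriv_nz f g S)
    then have 1: "eventually (\<lambda>t. (f analytic_on {k t} \<and> deriv f (k t) \<noteq> 0) \<and>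
        (g analytic_on {k t} \<and> deriv g (k t) \<noteq> 0) \<and>
        schwarzian g (k t) = schwarzian f (k t)) (nhds (f z))"
      by (rule eventually_nhds_compose[OF ct])
    have 2: "eventually (\<lambda>t. eventually (\<lambda>t. f (k t) = t + 0) (nhds t)) (nhds (f z))"
      using k(5) by (simp add: eventually_eventually)
    show ?thesis
      using 1 2 eventually_analytic_at[OF k(1)] eventually_deriv_nz[OF k(1,2)]
    proof eventually_elim
      case (elim t)
      have "schwarzian ?\<phi> t = schwarzian g (k t) * (deriv k t)\<^sup>2 + schwarzian k t"
        using elim by (intro schwarzian_compose) auto
      also have "\<dots> = schwarzian (\<lambda>t. f (k t)) t"
        using elim by (subst schwarzian_compose) auto
      \<comment> \<open>The identity is written as a translation so that
        \<open>schwarzian_affine\<close> covers it.\<close>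
      also have "\<dots> = schwarzian (\<lambda>t. t + 0) t"
        by (rule schwarzian_cong) (rule elim(2))
      finally show ?case using schwarzian_affine[of 0 t] by simp
    qed
  qed
  ultimately obtain a b c d where *: "a * d - b * c \<noteq> 0"
      "eventually (\<lambda>t. ?\<phi> t * (c * t + d) = a * t + b) (nhds (f z))"
    using schwarzian_zero_imp_moebius[OF ph] by blast
  have "eventually (\<lambda>w. g (k (f w)) * (c * f w + d) = a * f w + b) (nhds z)"
    using eventually_nhds_compose[OF analytic_at_imp_isCont[OF f(1)] *(2)] .
  then have "eventually (\<lambda>w. g w * (c * f w + d) = a * f w + b) (nhds z)"
    using k(4) by eventually_elim simp
  with *(1) show ?thesis by blast
qed

section \<open>Riemann surfaces\<close>

lemma DERIV_transfer_ev:
  fixes f :: "complex \<Rightarrow> complex"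
  assumes "(f has_field_derivative D) (at z)" "eventually (\<lambda>w. f w = g w) (nhds z)"
  shows "(g has_field_derivative D) (at z)"
  using assms DERIV_cong_ev[OF refl assms(2) refl] by blast

lemma open_eventuallyI:
  assumes "\<And>p. p \<in> S \<Longrightarrow> eventually (\<lambda>q. q \<in> S) (nhds p)"
  shows "open S"
proof (subst open_subopen, intro ballI)
  fix p assume "p \<in> S"
  from assms[OF this] show "\<exists>T. open T \<and> p \<in> T \<and> T \<subseteq> S"
    unfolding eventually_nhds by blast
qed

lemma analytic_atI:
  assumes "eventually (\<lambda>w. f field_differentiable at w) (nhds z)"
  shows "f analytic_on {z}"
proof -
  obtain S where "open S" "z \<in> S" "\<And>w. w \<in> S \<Longrightarrow> f field_differentiable at w"
    using assms unfolding eventually_nhds by blast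
  then have "f holomorphic_on S"
    by (auto simp: holomorphic_on_def intro: field_differentiable_at_within)
  then show ?thesis using \<open>open S\<close> \<open>z \<in> S\<close> analytic_at by blast
qed

lemma cholomorphic_on_complexD:
  fixes f :: "complex \<Rightarrow> complex"
  assumes "f cholomorphic_on S" "z \<in> S"
  shows "f field_differentiable at z"
proof -
  obtain D where D: "(f has_derivative D) (at z)" "\<And>a v. D (a *\<^sub>C v) = a *\<^sub>C D v"
    using assms unfolding cholomorphic_on_def by blast
  have "D v = D 1 * v" for v
    using D(2)[of v 1] by (simp add: scaleC_complex_def mult.commute)
  then have "D = (*) (D 1)" by (rule ext)
  with D(1) have "(f has_field_derivative D 1) (at z)"
    by (simp add: has_field_derivative_def)
  then show ?thesis by (auto simp: field_differentiable_def)
qed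

section \<open>Charts and transition maps\<close>

context
  fixes A :: "('m::t2_space, 'e::complex_euclidean) chart set" and c
  assumes A: "complex_atlas A" and c: "c \<in> A"
begin

lemma chart_homeomorphism: "homeomorphism (fst c) (snd c ` fst c) (snd c) (chart_inv c)"
  and open_chart: "open (fst c)"
  and open_chart_image: "open (snd c ` fst c)"
  using A c unfolding complex_atlas_def by blast+

lemma chart_inv_left: "p \<in> fst c \<Longrightarrow> chart_inv c (snd c p) = p"
  using chart_homeomorphism unfolding homeomorphism_def by blast

lemma chart_inv_right: "z \<in> snd c ` fst c \<Longrightarrow> snd c (chart_inv c z) = z"
  and chart_inv_in: "z \<in> snd c ` fst c \<Longrightarrow> chart_inv c z \<in> fst c"
  using chart_inv_left by auto

lemma isCont_chart: "p \<in> fst c \<Longrightarrow> isCont (snd c) p"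
  using chart_homeomorphism open_chart continuous_on_eq_continuous_at
  unfolding homeomorphism_def by blast

lemma isCont_chart_inv: "p \<in> fst c \<Longrightarrow> isCont (chart_inv c) (snd c p)"
  using chart_homeomorphism open_chart_image continuous_on_eq_continuous_at
  unfolding homeomorphism_def by blast

lemma eventually_in_chart: "p \<in> fst c \<Longrightarrow> eventually (\<lambda>q. q \<in> fst c) (nhds p)"
  using open_chart eventually_nhds by blast

lemma eventually_in_chart_image: "p \<in> fst c \<Longrightarrow> eventually (\<lambda>z. z \<in> snd c ` fst c) (nhds (snd c p))"
  using open_chart_image eventually_nhds by blast

lemma eventually_nhds_chart:
  assumes p: "p \<in> fst c"
  shows "eventually P (nhds p) \<longleftrightarrow> eventually (\<lambda>z. P (chart_inv c z)) (nhds (snd c p))"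
proof
  assume "eventually P (nhds p)"
  then show "eventually (\<lambda>z. P (chart_inv c z)) (nhds (snd c p))"
    using eventually_nhds_compose[OF isCont_chart_inv[OF p], of P] chart_inv_left[OF p] by simp
next
  assume "eventually (\<lambda>z. P (chart_inv c z)) (nhds (snd c p))"
  from eventually_nhds_compose[OF isCont_chart[OF p] this] eventually_in_chart[OF p]
  show "eventually P (nhds p)"
    by eventually_elim (simp add: chart_inv_left)
qed

end

lemma transition_analytic:
  fixes A :: "('m::t2_space, complex) chart set"
  assumes A: "complex_atlas A" and c: "c \<in> A" "p \<in> fst c" and c': "c' \<in> A" "p \<in> fst c'"
  shows "(\<lambda>z. snd c' (chart_inv c z)) analytic_on {snd c p}"
proof (rule analytic_atI)
  have ch: "(snd c' \<circ> chart_inv c) cholomorphic_on (snd c ` (fst c \<inter> fst c'))"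
    using A c c' unfolding complex_atlas_def by blast
  have "eventually (\<lambda>q. q \<in> fst c') (nhds p)"
    by (rule eventually_in_chart[OF A c'(1) c'(2)])
  then have "eventually (\<lambda>z. chart_inv c z \<in> fst c') (nhds (snd c p))"
    by (rule eventually_nhds_chart[OF A c(1,2), THEN iffD1])
  with eventually_in_chart_image[OF A c]
  show "eventually (\<lambda>z. (\<lambda>z. snd c' (chart_inv c z)) field_differentiable at z) (nhds (snd c p))"
  proof eventually_elim
    case (elim z)
    have "z \<in> snd c ` (fst c \<inter> fst c')"
      using elim chart_inv_in[OF A c(1)] chart_inv_right[OF A c(1)] by (metis IntI image_eqI)
    from cholomorphic_on_complexD[OF ch this] show ?case by (simp add: o_def)
  qed
qed

text \<open>The opposite transition map is a local inverse, so the two derivatives multiply to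
  1.\<close>

lemma transition_deriv_nz:
  fixes A :: "('m::t2_space, complex) chart set"
  assumes A: "complex_atlas A" and c: "c \<in> A" "p \<in> fst c" and c': "c' \<in> A" "p \<in> fst c'"
  shows "deriv (\<lambda>z. snd c' (chart_inv c z)) (snd c p) \<noteq> 0"
proof
  let ?\<tau> = "\<lambda>z. snd c' (chart_inv c z)" and ?\<sigma> = "\<lambda>z. snd c (chart_inv c' z)"
  assume z: "deriv ?\<tau> (snd c p) = 0"
  have \<tau>p: "?\<tau> (snd c p) = snd c' p" by (simp add: chart_inv_left[OF A c])
  have "eventually (\<lambda>q. q \<in> fst c') (nhds p)"
    by (rule eventually_in_chart[OF A c'(1) c'(2)])
  then have "eventually (\<lambda>z. chart_inv c z \<in> fst c') (nhds (snd c p))"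
    by (rule eventually_nhds_chart[OF A c(1,2), THEN iffD1])
  with eventually_in_chart_image[OF A c]
  have "eventually (\<lambda>z. ?\<sigma> (?\<tau> z) = z) (nhds (snd c p))"
    by eventually_elim (simp add: chart_inv_left[OF A c'(1)] chart_inv_right[OF A c(1)])
  then have "deriv (\<lambda>z. ?\<sigma> (?\<tau> z)) (snd c p) = deriv (\<lambda>z. z) (snd c p)"
    by (rule deriv_cong_ev) simp
  also have "deriv (\<lambda>z. ?\<sigma> (?\<tau> z)) (snd c p) = deriv ?\<sigma> (?\<tau> (snd c p)) * deriv ?\<tau> (snd c p)"
    by (rule deriv_compose_analytic[OF transition_analytic[OF A c c']])
      (unfold \<tau>p, rule transition_analytic[OF A c' c])
  finally show False using z by simp
qed

section \<open>One-forms and their local primitives\<close>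

lemma compatible_coefficientsD:
  assumes "compatible_coefficients A \<omega>" "c \<in> A" "c' \<in> A" "p \<in> fst c" "p \<in> fst c'"
  shows "\<omega> c (snd c p) = \<omega> c' (snd c' p) * deriv (\<lambda>z. snd c' (chart_inv c z)) (snd c p)"
  using assms unfolding compatible_coefficients_def o_def by blast

text \<open>A condition on the germ of \<open>u\<close> at \<open>p\<close> only: periods rule out
  global primitives, for instance of a nonzero holomorphic form on a compact surface.\<close>

definition is_primitive ::
    "('m::topological_space, complex) chart set \<Rightarrow> 'm one_form \<Rightarrow> ('m \<Rightarrow> complex) \<Rightarrow> 'm \<Rightarrow> bool" where
  "is_primitive A \<omega> u p \<longleftrightarrow> (\<forall>c\<in>A. p \<in> fst c \<longrightarrow>
     eventually (\<lambda>z. ((\<lambda>z. u (chart_inv c z)) has_field_derivative \<omega> c z) (at z)) (nhds (snd c p)))"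

lemma is_primitiveD:
  assumes "is_primitive A \<omega> u p" "c \<in> A" "p \<in> fst c"
  shows "eventually (\<lambda>z. ((\<lambda>z. u (chart_inv c z)) has_field_derivative \<omega> c z) (at z)) (nhds (snd c p))"
  using assms unfolding is_primitive_def by blast

context
  fixes A :: "('m::t2_space, complex) chart set" and \<omega> :: "'m one_form"
  assumes A: "complex_atlas A" and comp: "compatible_coefficients A \<omega>"
begin

text \<open>One chart suffices because the transformation law of the coefficients is exactly the
  chain rule along the transition map.\<close>

lemma is_primitiveI:
  assumes c: "c \<in> A" "p \<in> fst c"
    and u: "eventually (\<lambda>z. ((\<lambda>z. u (chart_inv c z)) has_field_derivative \<omega> c z) (at z)) (nhds (snd c p))"
  shows "is_primitive A \<omega> u p"
  unfolding is_primitive_def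
proof (intro ballI impI)
  fix c' assume c': "c' \<in> A" "p \<in> fst c'"
  let ?\<tau> = "\<lambda>z. snd c (chart_inv c' z)"
  have \<tau>a: "?\<tau> analytic_on {snd c' p}" by (rule transition_analytic[OF A c' c])
  have \<tau>p: "?\<tau> (snd c' p) = snd c p" by (simp add: chart_inv_left[OF A c'])
  have "eventually (\<lambda>z. ((\<lambda>z. u (chart_inv c z)) has_field_derivative \<omega> c (?\<tau> z)) (at (?\<tau> z)))
      (nhds (snd c' p))"
    using eventually_nhds_compose[OF analytic_at_imp_isCont[OF \<tau>a]] u unfolding \<tau>p .
  moreover have ev: "eventually (\<lambda>z. chart_inv c' z \<in> fst c) (nhds (snd c' p))"
    by (rule eventually_nhds_chart[OF A c', THEN iffD1, OF eventually_in_chart[OF A c]])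
  moreover have "eventually (\<lambda>z. eventually (\<lambda>z. chart_inv c' z \<in> fst c) (nhds z)) (nhds (snd c' p))"
    using ev by (simp add: eventually_eventually)
  ultimately show "eventually (\<lambda>z. ((\<lambda>z. u (chart_inv c' z)) has_field_derivative \<omega> c' z) (at z))
      (nhds (snd c' p))"
    using eventually_analytic_at[OF \<tau>a] eventually_in_chart_image[OF A c']
  proof eventually_elim
    case (elim z)
    have z: "snd c' (chart_inv c' z) = z" "chart_inv c' z \<in> fst c'"
      using elim chart_inv_right[OF A c'(1)] chart_inv_in[OF A c'(1)] by auto
    have d1: "((\<lambda>z. u (chart_inv c (?\<tau> z))) has_field_derivative \<omega> c (?\<tau> z) * deriv ?\<tau> z) (at z)"
      by (rule DERIV_chain2[OF elim(1) analytic_has_deriv[OF elim(4)]])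
    have d2: "\<omega> c (?\<tau> z) * deriv ?\<tau> z = \<omega> c' z"
      using compatible_coefficientsD[OF comp c'(1) c(1) z(2) elim(2)] z(1) by simp
    have d3: "eventually (\<lambda>z. u (chart_inv c (?\<tau> z)) = u (chart_inv c' z)) (nhds z)"
      using elim(3) by eventually_elim (simp add: chart_inv_left[OF A c(1)])
    show ?case using DERIV_transfer_ev[OF d1 d3] unfolding d2 .
  qed
qed

lemma eventually_is_primitive:
  assumes u: "is_primitive A \<omega> u p" and c: "c \<in> A" "p \<in> fst c"
  shows "eventually (is_primitive A \<omega> u) (nhds p)"
proof -
  have "eventually (\<lambda>z. eventually (\<lambda>z. ((\<lambda>z. u (chart_inv c z)) has_field_derivative \<omega> c z) (at z)) (nhds z))
      (nhds (snd c p))"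
    using is_primitiveD[OF u c] by (simp add: eventually_eventually)
  from this eventually_in_chart_image[OF A c]
  have "eventually (\<lambda>z. is_primitive A \<omega> u (chart_inv c z)) (nhds (snd c p))"
  proof eventually_elim
    case (elim z)
    then show ?case
      using chart_inv_right[OF A c(1)] chart_inv_in[OF A c(1)] by (intro is_primitiveI[OF c(1)]) auto
  qed
  show ?thesis by (rule eventually_nhds_chart[OF A c, THEN iffD2]) fact
qed

lemma exists_primitive:
  assumes c: "c \<in> A" "p \<in> fst c" and an: "\<omega> c analytic_on {snd c p}"
  shows "\<exists>u. is_primitive A \<omega> u p"
proof -
  obtain e where e: "e > 0" "\<omega> c holomorphic_on ball (snd c p) e"
    using an unfolding analytic_on_def by blast
  obtain g where g: "\<And>x. x \<in> ball (snd c p) e \<Longrightarrow>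
      (g has_field_derivative \<omega> c x) (at x within ball (snd c p) e)"
    using holomorphic_convex_primitive'[OF convex_ball open_ball e(2)] by blast
  have in_ball: "eventually (\<lambda>z. z \<in> ball (snd c p) e) (nhds (snd c p))"
    using e(1) eventually_nhds by (metis centre_in_ball open_ball)
  have "eventually (\<lambda>z. eventually (\<lambda>z. z \<in> snd c ` fst c) (nhds z)) (nhds (snd c p))"
    using eventually_in_chart_image[OF A c] by (simp add: eventually_eventually)
  then have "eventually (\<lambda>z. ((\<lambda>z. g (snd c (chart_inv c z))) has_field_derivative \<omega> c z) (at z))
      (nhds (snd c p))"
    using in_ball
  proof eventually_elim
    case (elim z)
    have d1: "(g has_field_derivative \<omega> c z) (at z)"
      using g[OF elim(2)] elim(2) by (simp add: at_within_open[OF _ open_ball])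
    have d2: "eventually (\<lambda>z. g z = g (snd c (chart_inv c z))) (nhds z)"
      using elim(1) by eventually_elim (simp add: chart_inv_right[OF A c(1)])
    show ?case by (rule DERIV_transfer_ev[OF d1 d2])
  qed
  then have "is_primitive A \<omega> (\<lambda>q. g (snd c q)) p" by (intro is_primitiveI[OF c])
  then show ?thesis by blast
qed

text \<open>The ambiguity of a primitive is a translation, under which Schwarzians do not change.
  This is what later makes the Schwarzian in \<open>\<integral>\<omega> + \<integral>\<beta>\<close>
  well defined.\<close>

lemma primitive_unique:
  assumes u: "is_primitive A \<omega> u p" and u': "is_primitive A \<omega> u' p" and c: "c \<in> A" "p \<in> fst c"
  shows "\<exists>k. eventually (\<lambda>q. u' q = u q + k) (nhds p)"
proof -
  let ?d = "\<lambda>z. u' (chart_inv c z) - u (chart_inv c z)"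
  have "eventually (\<lambda>z. (?d has_field_derivative 0) (at z)) (nhds (snd c p))"
    using is_primitiveD[OF u c] is_primitiveD[OF u' c]
  proof eventually_elim
    case (elim z)
    show ?case using DERIV_diff[OF elim(2,1)] by simp
  qed
  then obtain e where e: "e > 0" "\<And>z. z \<in> ball (snd c p) e \<Longrightarrow> (?d has_field_derivative 0) (at z)"
    unfolding eventually_nhds_ball by blast
  define k where "k = ?d (snd c p)"
  have "u' (chart_inv c z) = u (chart_inv c z) + k" if "z \<in> ball (snd c p) e" for z
  proof -
    have "?d z = k"
      unfolding k_def by (rule zero_derivative_on_ball[of "snd c p" e ?d]) (use e that in auto)
    then show ?thesis by (simp add: diff_eq_eq)
  qed
  then have "eventually (\<lambda>z. u' (chart_inv c z) = u (chart_inv c z) + k) (nhds (snd c p))"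
    unfolding eventually_nhds_ball using e(1) by blast
  have "eventually (\<lambda>q. u' q = u q + k) (nhds p)"
    by (rule eventually_nhds_chart[OF A c, THEN iffD2]) fact
  then show ?thesis by blast
qed

lemma primitive_analytic:
  assumes u: "is_primitive A \<omega> u p" and c: "c \<in> A" "p \<in> fst c"
  shows "(\<lambda>z. u (chart_inv c z)) analytic_on {snd c p}"
    and "deriv (\<lambda>z. u (chart_inv c z)) (snd c p) = \<omega> c (snd c p)"
    and "isCont u p"
proof -
  note ev = is_primitiveD[OF u c]
  show an: "(\<lambda>z. u (chart_inv c z)) analytic_on {snd c p}"
    using ev by (intro analytic_atI) (auto elim!: eventually_mono simp: field_differentiable_def)
  show "deriv (\<lambda>z. u (chart_inv c z)) (snd c p) = \<omega> c (snd c p)"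
    by (rule DERIV_imp_deriv[OF eventually_nhds_x_imp_x[OF ev]])
  have "isCont (\<lambda>q. u (chart_inv c (snd c q))) p"
    by (rule isCont_o2[OF isCont_chart[OF A c] analytic_at_imp_isCont[OF an]])
  moreover have "eventually (\<lambda>q. u (chart_inv c (snd c q)) = u q) (nhds p)"
    using eventually_in_chart[OF A c] by eventually_elim (simp add: chart_inv_left[OF A c(1)])
  ultimately show "isCont u p" using isCont_cong by fastforce
qed

end

text \<open>Analyticity is asked only where \<open>Q\<close> is nonzero, so \<open>Q\<close> may be
  set to 0 at exceptional points provided that it stays continuous; no removal of singularities is
  required. If the maximum of \<open>norm Q\<close> is positive, the set where \<open>Q\<close>
  takes the maximizing value is closed, and it is open by the local maximum principle.\<close>

lemma maximum_principle_compact: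
  fixes Q :: "'m::t2_space \<Rightarrow> complex"
  assumes A: "complex_atlas A" and comp: "compact (UNIV :: 'm set)" "connected (UNIV :: 'm set)"
    and Q: "\<And>p. isCont Q p"
    and hol: "\<And>p. Q p \<noteq> 0 \<Longrightarrow> \<exists>c\<in>A. p \<in> fst c \<and> (\<lambda>z. Q (chart_inv c z)) analytic_on {snd c p}"
  shows "\<exists>k. \<forall>p. Q p = k"
proof -
  have cQ: "continuous_on UNIV Q" using Q continuous_at_imp_continuous_on by blast
  then have "continuous_on UNIV (\<lambda>p. norm (Q p))" by (intro continuous_intros)
  then obtain p0 where p0: "\<And>p. norm (Q p) \<le> norm (Q p0)"
    using continuous_attains_sup[OF comp(1), of "\<lambda>p. norm (Q p)"] by auto
  show ?thesis
  proof (cases "Q p0 = 0")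
    case True
    then show ?thesis using p0 by auto
  next
    case False
    define S where "S = {p. Q p = Q p0}"
    have "closed S" unfolding S_def
      using continuous_closed_preimage_constant[OF cQ, of "Q p0"] by simp
    moreover have "open S"
    proof (rule open_eventuallyI)
      fix p assume "p \<in> S"
      then have Qp: "Q p = Q p0" by (simp add: S_def)
      then obtain c where c: "c \<in> A" "p \<in> fst c" "(\<lambda>z. Q (chart_inv c z)) analytic_on {snd c p}"
        using hol[of p] False by auto
      obtain e where e: "e > 0" "(\<lambda>z. Q (chart_inv c z)) holomorphic_on ball (snd c p) e"
        using c(3) unfolding analytic_on_def by blast
      have "(\<lambda>z. Q (chart_inv c z)) constant_on ball (snd c p) e"
        by (rule maximum_modulus_principle[OF e(2) open_ball _ open_ball order_refl, of "snd c p"])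
          (use e(1) p0 Qp in \<open>auto simp: chart_inv_left[OF A c(1,2)]\<close>)
      then have "\<And>z. z \<in> ball (snd c p) e \<Longrightarrow> Q (chart_inv c z) = Q (chart_inv c (snd c p))"
        using e(1) unfolding constant_on_def by (metis centre_in_ball)
      then have "eventually (\<lambda>z. Q (chart_inv c z) = Q p0) (nhds (snd c p))"
        unfolding eventually_nhds_ball using e(1) Qp chart_inv_left[OF A c(1,2)] by auto
      then show "eventually (\<lambda>q. q \<in> S) (nhds p)"
        unfolding S_def using eventually_nhds_chart[OF A c(1,2), of "\<lambda>q. Q q = Q p0"] by simp
    qed
    ultimately have "S = UNIV"
      using comp(2) unfolding connected_clopen by (auto simp: S_def)
    then show ?thesis unfolding S_def by blast
  qed
qed

section \<open>The projective line\<close>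

lemma abs_cp1_eq_iff:
  assumes "v \<noteq> 0" "w \<noteq> 0"
  shows "abs_cp1 v = abs_cp1 w \<longleftrightarrow> fst v * snd w = snd v * fst w"
proof -
  let ?R = "\<lambda>v w :: complex \<times> complex. v \<noteq> 0 \<and> w \<noteq> 0 \<and> (\<exists>a. a \<noteq> 0 \<and> w = a *\<^sub>C v)"
  have refl: "?R u u" if "u \<noteq> 0" for u
    using that by (intro conjI exI[of _ 1]) (auto simp: scaleC_prod_def scaleC_complex_def)
  have "abs_cp1 v = abs_cp1 w \<longleftrightarrow> ?R v w"
    using Quotient_rel[OF Quotient_cp1, of v w] refl assms by blast
  also have "\<dots> \<longleftrightarrow> fst v * snd w = snd v * fst w"
  proof
    assume "?R v w"
    then show "fst v * snd w = snd v * fst w"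
      by (auto simp: scaleC_prod_def scaleC_complex_def)
  next
    assume eq: "fst v * snd w = snd v * fst w"
    obtain v1 v2 w1 w2 where vw: "v = (v1, v2)" "w = (w1, w2)" by (cases v, cases w)
    have "\<exists>a. a \<noteq> 0 \<and> w1 = a * v1 \<and> w2 = a * v2"
    proof (cases "v1 = 0")
      case True
      then have "v2 \<noteq> 0" "w1 = 0" using assms eq vw by (auto simp: zero_prod_def)
      then show ?thesis using True assms vw
        by (intro exI[of _ "w2 / v2"]) (auto simp: zero_prod_def)
    next
      case False
      moreover have "w1 \<noteq> 0" using False assms eq vw by (auto simp: zero_prod_def)
      ultimately show ?thesis using eq vw
        by (intro exI[of _ "w1 / v1"]) (auto simp: field_simps)
    qed
    then show "?R v w" using assms vw by (auto simp: scaleC_prod_def scaleC_complex_def)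
  qed
  finally show ?thesis .
qed

lemma cp1_cases:
  obtains v where "v \<noteq> 0" "y = abs_cp1 v"
  using that[of "rep_cp1 y"] Quotient_abs_rep[OF Quotient_cp1, of y]
    Quotient_rep_reflp[OF Quotient_cp1, of y] by auto

lemma cp1_ratio_abs:
  assumes "(a, b) \<noteq> 0"
  shows "cp1_fst_ratio (abs_cp1 (a, b)) = a / b" "cp1_snd_ratio (abs_cp1 (a, b)) = b / a"
proof -
  have R: "(a, b) \<noteq> 0 \<and> (a, b) \<noteq> 0 \<and> (\<exists>k. k \<noteq> 0 \<and> (a, b) = k *\<^sub>C (a, b))"
    using assms by (intro conjI exI[of _ 1]) (auto simp: scaleC_prod_def scaleC_complex_def)
  show "cp1_fst_ratio (abs_cp1 (a, b)) = a / b" "cp1_snd_ratio (abs_cp1 (a, b)) = b / a"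
    using cp1_fst_ratio.abs_eq[of "(a, b)"] cp1_snd_ratio.abs_eq[of "(a, b)"] R by auto
qed

definition cp1_chart_fst :: "(cp1, complex) chart" where
  "cp1_chart_fst = ({abs_cp1 (a, b) | a b. b \<noteq> 0}, cp1_fst_ratio)"

definition cp1_chart_snd :: "(cp1, complex) chart" where
  "cp1_chart_snd = ({abs_cp1 (a, b) | a b. a \<noteq> 0}, cp1_snd_ratio)"

lemma cp1_atlas_eq: "cp1_atlas = {cp1_chart_fst, cp1_chart_snd}"
  by (simp add: cp1_atlas_def cp1_chart_fst_def cp1_chart_snd_def)

lemma in_cp1_chart_fst:
  assumes "y \<in> fst cp1_chart_fst"
  shows "y = abs_cp1 (snd cp1_chart_fst y, 1)"
proof -
  obtain a b where y: "y = abs_cp1 (a, b)" "b \<noteq> 0"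
    using assms by (auto simp: cp1_chart_fst_def)
  then have "(a, b) \<noteq> 0" by (simp add: zero_prod_def)
  then show ?thesis
    using y by (simp add: cp1_chart_fst_def cp1_ratio_abs abs_cp1_eq_iff zero_prod_def)
qed

lemma in_cp1_chart_snd:
  assumes "y \<in> fst cp1_chart_snd"
  shows "y = abs_cp1 (1, snd cp1_chart_snd y)"
proof -
  obtain a b where y: "y = abs_cp1 (a, b)" "a \<noteq> 0"
    using assms by (auto simp: cp1_chart_snd_def)
  then have "(a, b) \<noteq> 0" by (simp add: zero_prod_def)
  then show ?thesis
    using y by (simp add: cp1_chart_snd_def cp1_ratio_abs abs_cp1_eq_iff zero_prod_def)
qed

lemma cp1_atlas_cover: "\<exists>r\<in>cp1_atlas. y \<in> fst r"
proof (cases y rule: cp1_cases)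
  case (1 v)
  obtain a b where "v = (a, b)" by (cases v)
  with 1 have "b \<noteq> 0 \<or> a \<noteq> 0" "y = abs_cp1 (a, b)" by (auto simp: zero_prod_def)
  then show ?thesis by (auto simp: cp1_atlas_eq cp1_chart_fst_def cp1_chart_snd_def)
qed

lemma abs_cp1_in_chart:
  assumes nz: "v \<noteq> 0"
  shows "abs_cp1 v \<in> fst cp1_chart_fst \<longleftrightarrow> snd v \<noteq> 0"
    and "abs_cp1 v \<in> fst cp1_chart_snd \<longleftrightarrow> fst v \<noteq> 0"
proof -
  obtain a b where v: "v = (a, b)" by (cases v)
  show "abs_cp1 v \<in> fst cp1_chart_fst \<longleftrightarrow> snd v \<noteq> 0"
  proof
    assume "abs_cp1 v \<in> fst cp1_chart_fst"
    then have "abs_cp1 v = abs_cp1 (snd cp1_chart_fst (abs_cp1 v), 1)" by (rule in_cp1_chart_fst)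
    then show "snd v \<noteq> 0" using nz v by (subst (asm) abs_cp1_eq_iff) (auto simp: zero_prod_def)
  qed (use v in \<open>auto simp: cp1_chart_fst_def\<close>)
  show "abs_cp1 v \<in> fst cp1_chart_snd \<longleftrightarrow> fst v \<noteq> 0"
  proof
    assume "abs_cp1 v \<in> fst cp1_chart_snd"
    then have "abs_cp1 v = abs_cp1 (1, snd cp1_chart_snd (abs_cp1 v))" by (rule in_cp1_chart_snd)
    then show "fst v \<noteq> 0" using nz v by (subst (asm) abs_cp1_eq_iff) (auto simp: zero_prod_def)
  qed (use v in \<open>auto simp: cp1_chart_snd_def\<close>)
qed

lemma open_cp1_chart:
  assumes "r \<in> cp1_atlas"
  shows "open (fst r)"
proof -
  have "{v. v \<noteq> 0 \<and> abs_cp1 v \<in> fst cp1_chart_fst} = {v. snd v \<noteq> 0}"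
    "{v. v \<noteq> 0 \<and> abs_cp1 v \<in> fst cp1_chart_snd} = {v. fst v \<noteq> 0}"
    by (auto simp: abs_cp1_in_chart) (auto simp: cp1_chart_fst_def cp1_chart_snd_def)
  moreover have "open {v :: complex \<times> complex. snd v \<noteq> 0}" "open {v :: complex \<times> complex. fst v \<noteq> 0}"
    by (intro open_Collect_neq continuous_intros)+
  ultimately have "open (fst cp1_chart_fst)" "open (fst cp1_chart_snd)"
    unfolding open_cp1_def by simp_all
  then show ?thesis using assms unfolding cp1_atlas_eq by blast
qed

section \<open>Moebius maps in affine coordinates\<close>

lemma linear_map_nonzero:
  fixes a b c d z w :: complex
  assumes "a * d - b * c \<noteq> 0" "(z, w) \<noteq> 0"
  shows "(a * z + b * w, c * z + d * w) \<noteq> 0"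
proof
  assume "(a * z + b * w, c * z + d * w) = 0"
  then have e: "a * z + b * w = 0" "c * z + d * w = 0" by (auto simp: zero_prod_def)
  have "(a * d - b * c) * z = d * (a * z + b * w) - b * (c * z + d * w)"
    "(a * d - b * c) * w = a * (c * z + d * w) - c * (a * z + b * w)" by (simp_all add: algebra_simps)
  with e assms show False by (simp add: zero_prod_def)
qed

lemma exists_moebius:
  fixes a b c d :: complex
  assumes det: "a * d - b * c \<noteq> 0"
  obtains T where "moebius T"
    "\<And>z w. (z, w) \<noteq> 0 \<Longrightarrow> T (abs_cp1 (z, w)) = abs_cp1 (a * z + b * w, c * z + d * w)"
proof -
  define T where "T y = (let v = rep_cp1 y in abs_cp1 (a * fst v + b * snd v, c * fst v + d * snd v))" for y
  have T: "T (abs_cp1 (z, w)) = abs_cp1 (a * z + b * w, c * z + d * w)" if nz: "(z, w) \<noteq> 0" for z w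
  proof -
    define u v where "u = fst (rep_cp1 (abs_cp1 (z, w)))" and "v = snd (rep_cp1 (abs_cp1 (z, w)))"
    have uv: "(u, v) = rep_cp1 (abs_cp1 (z, w))" by (simp add: u_def v_def)
    have nz': "(u, v) \<noteq> 0"
      using Quotient_rep_reflp[OF Quotient_cp1, of "abs_cp1 (z, w)"] uv by auto
    have "abs_cp1 (u, v) = abs_cp1 (z, w)"
      using Quotient_abs_rep[OF Quotient_cp1] uv by simp
    then have uvzw: "u * w = v * z" using abs_cp1_eq_iff[OF nz' nz] by simp
    \<comment> \<open>The cross product of two images is the determinant times the cross product of
      the arguments, so the choice of representative in \<open>T\<close> is immaterial.\<close>
    have "(a * u + b * v) * (c * z + d * w) - (c * u + d * v) * (a * z + b * w)
        = (a * d - b * c) * (u * w - v * z)" by (simp add: algebra_simps)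
    then have "abs_cp1 (a * u + b * v, c * u + d * v) = abs_cp1 (a * z + b * w, c * z + d * w)"
      using abs_cp1_eq_iff[OF linear_map_nonzero[OF det nz'] linear_map_nonzero[OF det nz]] uvzw
      by simp
    then show ?thesis by (simp add: T_def Let_def u_def v_def)
  qed
  have "moebius T" unfolding moebius_def using det T by blast
  with T show ?thesis using that by blast
qed

text \<open>Changing the affine chart at the target exchanges the rows of the matrix, changing it at
  the source exchanges the columns.\<close>

lemma moebius_action_in_charts:
  fixes a b c d :: complex
  assumes r: "r \<in> cp1_atlas" "r' \<in> cp1_atlas" and det: "a * d - b * c \<noteq> 0"
    and T: "\<And>z w. (z, w) \<noteq> 0 \<Longrightarrow> T (abs_cp1 (z, w)) = abs_cp1 (a * z + b * w, c * z + d * w)"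
    and y: "y \<in> fst r" "y' \<in> fst r'"
  shows "r = cp1_chart_fst \<Longrightarrow> r' = cp1_chart_fst \<Longrightarrow>
      y' = T y \<longleftrightarrow> snd r' y' * (c * snd r y + d) = a * snd r y + b"
    "r = cp1_chart_fst \<Longrightarrow> r' = cp1_chart_snd \<Longrightarrow>
      y' = T y \<longleftrightarrow> snd r' y' * (a * snd r y + b) = c * snd r y + d"
    "r = cp1_chart_snd \<Longrightarrow> r' = cp1_chart_fst \<Longrightarrow>
      y' = T y \<longleftrightarrow> snd r' y' * (d * snd r y + c) = b * snd r y + a"
    "r = cp1_chart_snd \<Longrightarrow> r' = cp1_chart_snd \<Longrightarrow>
      y' = T y \<longleftrightarrow> snd r' y' * (b * snd r y + a) = d * snd r y + c"
proof -
  have T1: "T (abs_cp1 (s, 1)) = abs_cp1 (a * s + b, c * s + d)" "(a * s + b, c * s + d) \<noteq> 0" for s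
    using T[of s 1] linear_map_nonzero[OF det, of s 1] by (auto simp: zero_prod_def)
  have T2: "T (abs_cp1 (1, s)) = abs_cp1 (b * s + a, d * s + c)" "(b * s + a, d * s + c) \<noteq> 0" for s
    using T[of 1 s] linear_map_nonzero[OF det, of 1 s] by (auto simp: zero_prod_def add.commute)
  have n: "(s, 1 :: complex) \<noteq> 0" "(1 :: complex, s) \<noteq> 0" for s :: complex by (auto simp: zero_prod_def)
  { assume "r = cp1_chart_fst" "r' = cp1_chart_fst"
    with y have e: "y = abs_cp1 (snd r y, 1)" "y' = abs_cp1 (snd r' y', 1)"
      by (auto intro: in_cp1_chart_fst in_cp1_chart_snd)
    show "y' = T y \<longleftrightarrow> snd r' y' * (c * snd r y + d) = a * snd r y + b"
      by (subst e(2), subst e(1), subst T1(1), subst abs_cp1_eq_iff[OF n(1) T1(2)]) simp }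
  { assume "r = cp1_chart_fst" "r' = cp1_chart_snd"
    with y have e: "y = abs_cp1 (snd r y, 1)" "y' = abs_cp1 (1, snd r' y')"
      by (auto intro: in_cp1_chart_fst in_cp1_chart_snd)
    show "y' = T y \<longleftrightarrow> snd r' y' * (a * snd r y + b) = c * snd r y + d"
      by (subst e(2), subst e(1), subst T1(1), subst abs_cp1_eq_iff[OF n(2) T1(2)]) auto }
  { assume "r = cp1_chart_snd" "r' = cp1_chart_fst"
    with y have e: "y = abs_cp1 (1, snd r y)" "y' = abs_cp1 (snd r' y', 1)"
      by (auto intro: in_cp1_chart_fst in_cp1_chart_snd)
    show "y' = T y \<longleftrightarrow> snd r' y' * (d * snd r y + c) = b * snd r y + a"
      by (subst e(2), subst e(1), subst T2(1), subst abs_cp1_eq_iff[OF n(1) T2(2)]) simp }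
  { assume "r = cp1_chart_snd" "r' = cp1_chart_snd"
    with y have e: "y = abs_cp1 (1, snd r y)" "y' = abs_cp1 (1, snd r' y')"
      by (auto intro: in_cp1_chart_fst in_cp1_chart_snd)
    show "y' = T y \<longleftrightarrow> snd r' y' * (b * snd r y + a) = d * snd r y + c"
      by (subst e(2), subst e(1), subst T2(1), subst abs_cp1_eq_iff[OF n(2) T2(2)]) auto }
qed

text \<open>Hides the four cases: exchanging rows or columns affects the determinant at most by a
  sign, so one division-free shape serves all pairs of charts and no point of a chart has to be
  excluded as a pole of the map.\<close>

lemma moebius_in_charts:
  assumes r: "r \<in> cp1_atlas" "r' \<in> cp1_atlas" and "moebius T"
  shows "\<exists>a b c d. a * d - b * c \<noteq> 0 \<and> (\<forall>y\<in>fst r. \<forall>y'\<in>fst r'.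
    y' = T y \<longleftrightarrow> snd r' y' * (c * snd r y + d) = a * snd r y + b)"
proof -
  obtain a b c d where T: "a * d - b * c \<noteq> 0"
    "\<And>z w. (z, w) \<noteq> 0 \<Longrightarrow> T (abs_cp1 (z, w)) = abs_cp1 (a * z + b * w, c * z + d * w)"
    using \<open>moebius T\<close> unfolding moebius_def by blast
  note * = moebius_action_in_charts[OF r T]
  have det: "c * b - d * a \<noteq> 0" "b * c - a * d \<noteq> 0" "d * a - c * b \<noteq> 0"
    using T(1) by (auto simp: algebra_simps)
  consider "r = cp1_chart_fst" "r' = cp1_chart_fst" | "r = cp1_chart_fst" "r' = cp1_chart_snd"
    | "r = cp1_chart_snd" "r' = cp1_chart_fst" | "r = cp1_chart_snd" "r' = cp1_chart_snd"
    using r unfolding cp1_atlas_eq by blast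
  then show ?thesis
  proof cases
    case 1
    show ?thesis by (rule exI[of _ a], rule exI[of _ b], rule exI[of _ c], rule exI[of _ d])
        (intro conjI ballI T(1) *(1) 1)
  next
    case 2
    show ?thesis by (rule exI[of _ c], rule exI[of _ d], rule exI[of _ a], rule exI[of _ b])
        (intro conjI ballI det *(2) 2)
  next
    case 3
    show ?thesis by (rule exI[of _ b], rule exI[of _ a], rule exI[of _ d], rule exI[of _ c])
        (intro conjI ballI det *(3) 3)
  next
    case 4
    show ?thesis by (rule exI[of _ d], rule exI[of _ c], rule exI[of _ b], rule exI[of _ a])
        (intro conjI ballI det *(4) 4)
  qed
qed

text \<open>The exchanges of rows and columns are undone to recover the homogeneous matrix from its
  form in the two charts.\<close>

lemma moebius_from_charts:
  fixes a b c d :: complex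
  assumes r: "r \<in> cp1_atlas" "r' \<in> cp1_atlas" and det: "a * d - b * c \<noteq> 0"
  shows "\<exists>T. moebius T \<and> (\<forall>y\<in>fst r. \<forall>y'\<in>fst r'.
    snd r' y' * (c * snd r y + d) = a * snd r y + b \<longrightarrow> y' = T y)"
proof -
  have dets: "c * b - d * a \<noteq> 0" "b * c - a * d \<noteq> 0" "d * a - c * b \<noteq> 0"
    using det by (auto simp: algebra_simps)
  consider "r = cp1_chart_fst" "r' = cp1_chart_fst" | "r = cp1_chart_fst" "r' = cp1_chart_snd"
    | "r = cp1_chart_snd" "r' = cp1_chart_fst" | "r = cp1_chart_snd" "r' = cp1_chart_snd"
    using r unfolding cp1_atlas_eq by blast
  then show ?thesis
  proof cases
    case 1
    obtain T where "moebius T"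
      and T: "\<And>z w. (z, w) \<noteq> 0 \<Longrightarrow> T (abs_cp1 (z, w)) = abs_cp1 (a * z + b * w, c * z + d * w)"
      using exists_moebius[OF det] by blast
    then show ?thesis using moebius_action_in_charts(1)[OF r det T _ _ 1] by blast
  next
    case 2
    obtain T where "moebius T"
      and T: "\<And>z w. (z, w) \<noteq> 0 \<Longrightarrow> T (abs_cp1 (z, w)) = abs_cp1 (c * z + d * w, a * z + b * w)"
      using exists_moebius[OF dets(1)] by blast
    then show ?thesis using moebius_action_in_charts(2)[OF r dets(1) T _ _ 2] by blast
  next
    case 3
    obtain T where "moebius T"
      and T: "\<And>z w. (z, w) \<noteq> 0 \<Longrightarrow> T (abs_cp1 (z, w)) = abs_cp1 (b * z + a * w, d * z + c * w)"
      using exists_moebius[OF dets(2)] by blast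
    then show ?thesis using moebius_action_in_charts(3)[OF r dets(2) T _ _ 3] by blast
  next
    case 4
    obtain T where "moebius T"
      and T: "\<And>z w. (z, w) \<noteq> 0 \<Longrightarrow> T (abs_cp1 (z, w)) = abs_cp1 (d * z + c * w, b * z + a * w)"
      using exists_moebius[OF dets(3)] by blast
    then show ?thesis using moebius_action_in_charts(4)[OF r dets(3) T _ _ 4] by blast
  qed
qed

section \<open>Rigidity and globalization of Moebius maps\<close>

lemma quadratic_infinite_zeros:
  fixes p q r :: complex
  assumes "infinite {z. p * z\<^sup>2 + q * z + r = 0}"
  shows "p = 0" "q = 0" "r = 0"
proof -
  have "[:r, q, p:] = 0"
  proof (rule ccontr)
    assume "[:r, q, p:] \<noteq> 0"
    from poly_roots_finite[OF this] have "finite {z. poly [:r, q, p:] z = 0}" .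
    moreover have "{z. poly [:r, q, p:] z = 0} = {z. p * z\<^sup>2 + q * z + r = 0}"
      by (auto simp: power2_eq_square algebra_simps)
    ultimately show False using assms by simp
  qed
  then show "p = 0" "q = 0" "r = 0" by auto
qed

text \<open>Two images coincide when their cross product vanishes, and this is a binary quadratic
  form in \<open>(z, w)\<close> with coefficients \<open>p\<close>, \<open>q\<close>,
  \<open>r\<close>. Unless it is identically zero it has at most two projective zeros.\<close>

lemma moebius_eqI:
  assumes "moebius T" "moebius T'" and inf: "infinite {y. T y = T' y}"
  shows "T = T'"
proof -
  obtain a b c d where det: "a * d - b * c \<noteq> 0"
    and T: "\<And>z w. (z, w) \<noteq> 0 \<Longrightarrow> T (abs_cp1 (z, w)) = abs_cp1 (a * z + b * w, c * z + d * w)"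
    using \<open>moebius T\<close> unfolding moebius_def by blast
  obtain a' b' c' d' where det': "a' * d' - b' * c' \<noteq> 0"
    and T': "\<And>z w. (z, w) \<noteq> 0 \<Longrightarrow> T' (abs_cp1 (z, w)) = abs_cp1 (a' * z + b' * w, c' * z + d' * w)"
    using \<open>moebius T'\<close> unfolding moebius_def by blast
  define p q r where "p = a * c' - c * a'" and "q = a * d' + b * c' - c * b' - d * a'"
    and "r = b * d' - d * b'"
  have eq: "T (abs_cp1 (z, w)) = T' (abs_cp1 (z, w)) \<longleftrightarrow> p * z\<^sup>2 + q * (z * w) + r * w\<^sup>2 = 0"
    if nz: "(z, w) \<noteq> 0" for z w
  proof -
    have "T (abs_cp1 (z, w)) = T' (abs_cp1 (z, w)) \<longleftrightarrow>
        (a * z + b * w) * (c' * z + d' * w) - (c * z + d * w) * (a' * z + b' * w) = 0"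
      using abs_cp1_eq_iff[OF linear_map_nonzero[OF det nz] linear_map_nonzero[OF det' nz]]
      by (simp add: T[OF nz] T'[OF nz])
    also have "(a * z + b * w) * (c' * z + d' * w) - (c * z + d * w) * (a' * z + b' * w)
        = p * z\<^sup>2 + q * (z * w) + r * w\<^sup>2"
      by (simp add: p_def q_def r_def power2_eq_square algebra_simps)
    finally show ?thesis .
  qed
  \<comment> \<open>Every point except \<open>(1 : 0)\<close> has a representative
    \<open>(z, 1)\<close>, so setting that point aside turns the form into a polynomial in
    \<open>z\<close>.\<close>
  have "{y. T y = T' y} \<subseteq> insert (abs_cp1 (1, 0)) ((\<lambda>z. abs_cp1 (z, 1)) ` {z. p * z\<^sup>2 + q * z + r = 0})"
  proof
    fix y assume y: "y \<in> {y. T y = T' y}"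
    obtain v where v: "v \<noteq> 0" "y = abs_cp1 v" by (rule cp1_cases)
    obtain z w where zw: "v = (z, w)" by (cases v)
    show "y \<in> insert (abs_cp1 (1, 0)) ((\<lambda>z. abs_cp1 (z, 1)) ` {z. p * z\<^sup>2 + q * z + r = 0})"
    proof (cases "w = 0")
      case True
      then have "y = abs_cp1 (1, 0)" using v zw by (simp add: abs_cp1_eq_iff zero_prod_def)
      then show ?thesis by simp
    next
      case False
      then have "y = abs_cp1 (z / w, 1)" using v zw by (simp add: abs_cp1_eq_iff zero_prod_def)
      moreover have "(z / w, 1 :: complex) \<noteq> 0" by (simp add: zero_prod_def)
      ultimately show ?thesis using y eq[of "z / w" 1] by auto
    qed
  qed
  then have "infinite ((\<lambda>z. abs_cp1 (z, 1)) ` {z. p * z\<^sup>2 + q * z + r = 0})"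
    using inf by (meson finite_insert infinite_super)
  then have "infinite {z. p * z\<^sup>2 + q * z + r = 0}" by blast
  note pqr = quadratic_infinite_zeros[OF this]
  show ?thesis
  proof
    fix y
    obtain v where v: "v \<noteq> 0" "y = abs_cp1 v" by (rule cp1_cases)
    obtain z w where zw: "v = (z, w)" by (cases v)
    show "T y = T' y" using eq[of z w] v zw pqr by simp
  qed
qed

text \<open>Since \<open>f\<close> takes infinitely many values near each point, the local Moebius
  map there is unique. It is therefore locally constant along \<open>W\<close>, hence constant by
  connectedness.\<close>

lemma moebius_globalize:
  fixes f f' :: "'m::topological_space \<Rightarrow> cp1"
  assumes conn: "connected W"
    and loc: "\<And>p. p \<in> W \<Longrightarrow> \<exists>T. moebius T \<and> eventually (\<lambda>q. f' q = T (f q)) (nhds p)"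
    and inf: "\<And>p N. p \<in> W \<Longrightarrow> open N \<Longrightarrow> p \<in> N \<Longrightarrow> infinite (f ` N)"
  shows "\<exists>T. moebius T \<and> (\<forall>p\<in>W. f' p = T (f p))"
proof (cases "W = {}")
  case True
  have "moebius id"
    unfolding moebius_def by (rule exI[of _ 1], rule exI[of _ 0], rule exI[of _ 0], rule exI[of _ 1]) simp
  with True show ?thesis by blast
next
  case False
  then obtain p0 where p0: "p0 \<in> W" by blast
  obtain T where T: "\<And>p. p \<in> W \<Longrightarrow> moebius (T p) \<and> eventually (\<lambda>q. f' q = T p (f q)) (nhds p)"
    using loc by metis
  have "T p = T p0" if p: "p \<in> W" for p
  proof (rule connected_local_const[OF conn p p0], intro ballI)
    fix a assume a: "a \<in> W"
    have "eventually (\<lambda>b. eventually (\<lambda>q. f' q = T a (f q)) (nhds b)) (nhds a)"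
      using T[OF a] by (simp add: eventually_eventually)
    then have "eventually (\<lambda>b. b \<in> W \<longrightarrow> T a = T b) (nhds a)"
    proof eventually_elim
      case (elim b)
      show ?case
      proof
        assume b: "b \<in> W"
        have "eventually (\<lambda>q. f' q = T a (f q) \<and> f' q = T b (f q)) (nhds b)"
          using elim T[OF b] by (simp add: eventually_conj)
        then obtain N where N: "open N" "b \<in> N" "\<And>q. q \<in> N \<Longrightarrow> f' q = T a (f q) \<and> f' q = T b (f q)"
          unfolding eventually_nhds by blast
        have "f ` N \<subseteq> {y. T a y = T b y}" using N(3) by force
        then have "infinite {y. T a y = T b y}" using inf[OF b N(1,2)] infinite_super by blast
        then show "T a = T b" using T[OF a] T[OF b] moebius_eqI by blast
      qed
    qed
    then show "eventually (\<lambda>b. T a = T b) (at a within W)"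
      unfolding eventually_at_filter by eventually_elim blast
  qed
  moreover have "f' p = T p (f p)" if p: "p \<in> W" for p
    using eventually_nhds_x_imp_x[OF T[OF p, THEN conjunct2]] .
  ultimately have "\<forall>p\<in>W. f' p = T p0 (f p)" by auto
  then show ?thesis using T[OF p0] by blast
qed

section \<open>The foliation on the product\<close>

lemma fst_product_chart [simp]: "fst (product_chart a b) = fst a \<times> fst b"
  and snd_product_chart [simp]: "snd (product_chart a b) = map_prod (snd a) (snd b)"
  by (simp_all add: product_chart_def)

lemma product_chart_in_atlas: "a \<in> A \<Longrightarrow> b \<in> B \<Longrightarrow> product_chart a b \<in> product_atlas A B"
  unfolding product_atlas_def by blast

lemma has_derivative_pair_complex:
  assumes "(f has_field_derivative d) (at t)" "(g has_field_derivative e) (at t)"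
  shows "((\<lambda>t. (f t, g t)) has_derivative (\<lambda>h. (d * h, e * h))) (at t)"
  using has_derivative_Pair[OF assms[unfolded has_field_derivative_def]] .

text \<open>The divisor data enter as local properties: \<open>P\<close> carries the poles of
  \<omega>, and off \<open>P\<close> and \<open>Y\<close> its coefficients are analytic and nonzero.
  The point \<open>w\<^sub>0\<close> fixes the slice on which \<omega> + \<beta> is nonzero at every
  point off \<open>P\<close>.\<close>

locale foliated_product =
  fixes C :: "('a::t2_space, complex) chart set"
    and X :: "('b::t2_space, complex) chart set"
    and P Y :: "'a set" and \<omega> :: "'a one_form" and \<beta> :: "'b one_form"
    and b\<^sub>0 :: "('b, complex) chart" and w\<^sub>0 :: 'b
  assumes atlas_C: "complex_atlas C" and atlas_X: "complex_atlas X"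
    and compact_C: "compact (UNIV :: 'a set)" and connected_C: "connected (UNIV :: 'a set)"
    and compact_X: "compact (UNIV :: 'b set)" and connected_X: "connected (UNIV :: 'b set)"
    and finite_P: "finite P" and P_nonempty: "P \<noteq> {}" and finite_Y: "finite Y"
    and comp_\<omega>: "compatible_coefficients C \<omega>" and comp_\<beta>: "compatible_coefficients X \<beta>"
    and \<omega>_analytic: "\<And>a c. a \<in> C \<Longrightarrow> c \<in> fst a \<Longrightarrow> c \<notin> P \<Longrightarrow> \<omega> a analytic_on {snd a c}"
    and \<omega>_nonzero: "\<And>a c. a \<in> C \<Longrightarrow> c \<in> fst a \<Longrightarrow> c \<notin> P \<Longrightarrow> c \<notin> Y \<Longrightarrow> \<omega> a (snd a c) \<noteq> 0"
    and \<omega>_pole: "\<And>a c. a \<in> C \<Longrightarrow> c \<in> fst a \<Longrightarrow> c \<in> P \<Longrightarrow> is_pole (\<omega> a) (snd a c)"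
    and \<beta>_analytic: "\<And>b w. b \<in> X \<Longrightarrow> w \<in> fst b \<Longrightarrow> \<beta> b analytic_on {snd b w}"
    and b\<^sub>0: "b\<^sub>0 \<in> X" "w\<^sub>0 \<in> fst b\<^sub>0" and \<beta>_nonzero: "\<beta> b\<^sub>0 (snd b\<^sub>0 w\<^sub>0) \<noteq> 0"
begin

abbreviation "CX \<equiv> product_atlas C X"
abbreviation "\<F> \<equiv> product_foliation C X P \<omega> \<beta>"

lemma eventually_notin_P: "eventually (\<lambda>q. q \<notin> P - {c}) (nhds c)"
proof -
  have "open (- (P - {c}))" using finite_P by (intro open_Compl finite_imp_closed) auto
  then have "eventually (\<lambda>q. q \<in> - (P - {c})) (nhds c)"
    by (rule eventually_nhds_in_open) simp
  then show ?thesis by (simp only: Compl_iff)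
qed

lemma eventually_notin_P': "c \<notin> P \<Longrightarrow> eventually (\<lambda>q. q \<notin> P) (nhds c)"
  using eventually_notin_P[of c] by simp

lemma product_chart_inv:
  assumes "a \<in> C" "b \<in> X" "c \<in> fst a" "w \<in> fst b"
  shows "chart_inv (product_chart a b) (snd a c, snd b w) = (c, w)"
proof -
  have "inj_on (snd a) (fst a)" "inj_on (snd b) (fst b)"
    using chart_inv_left[OF atlas_C assms(1)] chart_inv_left[OF atlas_X assms(2)]
    by (metis inj_on_inverseI)+
  then have "inj_on (map_prod (snd a) (snd b)) (fst a \<times> fst b)" by (rule map_prod_inj_on)
  from inv_into_f_f[OF this, of "(c, w)"] assms(3,4) show ?thesis
    by (simp add: chart_inv_def)
qed

lemma eventually_product_chart_inv:
  assumes ab: "a \<in> C" "b \<in> X" and cw: "c \<in> fst a" "w \<in> fst b"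
  shows "eventually (\<lambda>v. chart_inv (product_chart a b) v = (chart_inv a (fst v), chart_inv b (snd v)))
    (nhds (snd a c, snd b w))"
proof -
  have "open ((snd a ` fst a) \<times> (snd b ` fst b))"
    by (intro open_Times open_chart_image[OF atlas_C ab(1)] open_chart_image[OF atlas_X ab(2)])
  then have "eventually (\<lambda>v. v \<in> (snd a ` fst a) \<times> (snd b ` fst b)) (nhds (snd a c, snd b w))"
    using cw by (intro eventually_nhds_in_open) auto
  then show ?thesis
  proof eventually_elim
    case (elim v)
    then obtain c' w' where v: "v = (snd a c', snd b w')" "c' \<in> fst a" "w' \<in> fst b" by auto
    then show ?case
      using product_chart_inv[OF ab v(2,3)] chart_inv_left[OF atlas_C ab(1) v(2)]
        chart_inv_left[OF atlas_X ab(2) v(3)] by simp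
  qed
qed

text \<open>The \<open>dw\<close>-coefficient of a conormal section is \<open>s\<close> times that
  of \<beta>; as \<open>s\<close> vanishes over a pole and \<beta> is finite, only the
  \<open>dz\<close>-part survives there. Vertical vectors are thus annihilated, and the fibres over
  poles are tangent to the foliation.\<close>

lemma foliation_vertical_coefficient:
  assumes ab: "a \<in> C" "b \<in> X" and cw: "c \<in> fst a" "w \<in> fst b" and c: "c \<in> P"
    and N: "(c, w) \<in> N" "conormal_section C X P \<omega> \<beta> a b N s \<alpha>"
  shows "snd (\<alpha> (c, w)) = 0"
proof -
  have oN: "open N" and s0: "s (c, w) = 0"
    and cont: "continuous_on N s" "continuous_on N \<alpha>"
    and \<alpha>: "\<And>q. q \<in> N \<Longrightarrow> fst q \<notin> P \<Longrightarrow> snd (\<alpha> q) = s q * \<beta> b (snd b (snd q))"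
    using N c unfolding conormal_section_def holomorphic_map_on_def by auto
  let ?k = "\<lambda>z. (chart_inv a z, w)"
  \<comment> \<open>Along the horizontal slice through \<open>(c, w)\<close> this is continuous and
    vanishes away from the pole, hence also at it.\<close>
  define \<phi> where "\<phi> z = snd (\<alpha> (?k z)) - s (?k z) * \<beta> b (snd b w)" for z
  have k: "isCont ?k (snd a c)"
    by (intro continuous_intros isCont_chart_inv[OF atlas_C ab(1) cw(1)])
  have kc: "?k (snd a c) = (c, w)" by (simp add: chart_inv_left[OF atlas_C ab(1) cw(1)])
  have "isCont s (?k (snd a c))" "isCont \<alpha> (?k (snd a c))"
    unfolding kc using cont oN N(1) continuous_on_eq_continuous_at by blast+
  then have "isCont \<phi> (snd a c)"
    unfolding \<phi>_def by (intro continuous_intros isCont_o2[OF k])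
  then have lim: "(\<phi> \<longlongrightarrow> \<phi> (snd a c)) (at (snd a c))" by (simp add: isCont_def)
  have "eventually (\<lambda>q. q \<in> N) (nhds (?k (snd a c)))"
    unfolding kc using oN N(1) by (rule eventually_nhds_in_open)
  from eventually_nhds_compose[OF k this]
  have "eventually (\<lambda>z. ?k z \<in> N) (nhds (snd a c))" .
  moreover have "eventually (\<lambda>z. chart_inv a z \<notin> P - {c}) (nhds (snd a c))"
    by (rule eventually_nhds_chart[OF atlas_C ab(1) cw(1), THEN iffD1]) (rule eventually_notin_P)
  ultimately have "eventually (\<lambda>z. z \<noteq> snd a c \<longrightarrow> \<phi> z = 0) (nhds (snd a c))"
    using eventually_in_chart_image[OF atlas_C ab(1) cw(1)]
  proof eventually_elim
    case (elim z)
    show ?case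
    proof
      assume "z \<noteq> snd a c"
      then have "chart_inv a z \<noteq> c" using chart_inv_right[OF atlas_C ab(1) elim(3)] by auto
      with elim have "chart_inv a z \<notin> P" by blast
      then show "\<phi> z = 0" using \<alpha>[OF elim(1)] by (simp add: \<phi>_def)
    qed
  qed
  then have "eventually (\<lambda>z. \<phi> z = 0) (at (snd a c))" by (simp add: eventually_at_filter)
  then have "(\<phi> \<longlongrightarrow> 0) (at (snd a c))" by (rule tendsto_eventually)
  then have "\<phi> (snd a c) = 0" using lim tendsto_unique trivial_limit_at by blast
  then show ?thesis unfolding \<phi>_def kc by (simp add: s0)
qed

text \<open>Foliated charts will be tested on explicit discs, so the direction of use is to produce
  tangent vectors from the equation of the foliation.\<close>

lemma foliationI:
  assumes ab: "a \<in> C" "b \<in> X" and cw: "c \<in> fst a" "w \<in> fst b"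
    and v: "c \<notin> P \<and> \<omega> a (snd a c) * v1 + \<beta> b (snd b w) * v2 = 0 \<or> c \<in> P \<and> v1 = 0"
  shows "(product_chart a b, (c, w), (v1, v2)) \<in> \<F>"
proof -
  have "fst (\<alpha> (c, w)) * v1 + snd (\<alpha> (c, w)) * v2 = 0"
    if N: "(c, w) \<in> N" "conormal_section C X P \<omega> \<beta> a b N s \<alpha>" for N s \<alpha>
  proof (cases "c \<in> P")
    case True
    then show ?thesis using v foliation_vertical_coefficient[OF ab cw True N] by simp
  next
    case False
    then have "\<alpha> (c, w) = (s (c, w) * \<omega> a (snd a c), s (c, w) * \<beta> b (snd b w))"
      using N unfolding conormal_section_def by auto
    then have "fst (\<alpha> (c, w)) * v1 + snd (\<alpha> (c, w)) * v2 =
        s (c, w) * (\<omega> a (snd a c) * v1 + \<beta> b (snd b w) * v2)" by (simp add: algebra_simps)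
    then show ?thesis using v False by simp
  qed
  then show ?thesis
    unfolding product_foliation_def mem_Collect_eq using ab cw
    by (intro exI[of _ a] exI[of _ b] exI[of _ "(c, w)"] exI[of _ "(v1, v2)"]) auto
qed

text \<open>Tangency verified in one pair of charts holds in all of them: the derivative of a
  transition map multiplies the velocity and divides the coefficient of the form, so each product is
  unchanged.\<close>

lemma integral_discI:
  assumes ab: "a \<in> C" "b \<in> X"
    and d1: "\<And>t. t \<in> ball 0 1 \<Longrightarrow> (g1 has_field_derivative d1 t) (at t)"
    and d2: "\<And>t. t \<in> ball 0 1 \<Longrightarrow> (g2 has_field_derivative d2 t) (at t)"
    and g: "\<And>t. t \<in> ball 0 1 \<Longrightarrow> g1 t \<in> snd a ` fst a" "\<And>t. t \<in> ball 0 1 \<Longrightarrow> g2 t \<in> snd b ` fst b"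
    and U: "\<And>t. t \<in> ball 0 1 \<Longrightarrow> (chart_inv a (g1 t), chart_inv b (g2 t)) \<in> U"
    and nz: "\<And>t. t \<in> ball 0 1 \<Longrightarrow> d1 t \<noteq> 0 \<or> d2 t \<noteq> 0"
    and F: "\<And>t. t \<in> ball 0 1 \<Longrightarrow>
      chart_inv a (g1 t) \<notin> P \<and> \<omega> a (g1 t) * d1 t + \<beta> b (g2 t) * d2 t = 0 \<or>
      chart_inv a (g1 t) \<in> P \<and> d1 t = 0"
  shows "integral_disc CX \<F> U (\<lambda>t. (chart_inv a (g1 t), chart_inv b (g2 t)))"
proof -
  let ?k = "\<lambda>t. (chart_inv a (g1 t), chart_inv b (g2 t))"
  have std: "chart_inv ((UNIV :: complex set), \<lambda>z. z) = (\<lambda>z. z)"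
    by (rule ext) (simp add: chart_inv_def inv_into_f_eq)
  have key: "\<exists>e1 e2. ((map_prod (snd a') (snd b') \<circ> ?k) has_derivative (\<lambda>h. (e1 * h, e2 * h))) (at t) \<and>
      (e1, e2) \<noteq> 0 \<and> (product_chart a' b', ?k t, (e1, e2)) \<in> \<F>"
    if t: "t \<in> ball 0 1" and ab': "a' \<in> C" "b' \<in> X" and kt: "?k t \<in> fst a' \<times> fst b'" for t a' b'
  proof -
    define c w where "c = chart_inv a (g1 t)" and "w = chart_inv b (g2 t)"
    have c: "c \<in> fst a" "snd a c = g1 t" "c \<in> fst a'" and w: "w \<in> fst b" "snd b w = g2 t" "w \<in> fst b'"
      using chart_inv_in[OF atlas_C ab(1) g(1)[OF t]] chart_inv_in[OF atlas_X ab(2) g(2)[OF t]]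
        chart_inv_right[OF atlas_C ab(1) g(1)[OF t]] chart_inv_right[OF atlas_X ab(2) g(2)[OF t]] kt
      by (auto simp: c_def w_def)
    let ?\<tau> = "\<lambda>z. snd a' (chart_inv a z)" and ?\<sigma> = "\<lambda>z. snd b' (chart_inv b z)"
    have D1: "((\<lambda>t. ?\<tau> (g1 t)) has_field_derivative deriv ?\<tau> (g1 t) * d1 t) (at t)"
      using transition_analytic[OF atlas_C ab(1) c(1) ab'(1) c(3)] unfolding c(2)
      by (intro DERIV_chain2[OF analytic_has_deriv d1[OF t]])
    have D2: "((\<lambda>t. ?\<sigma> (g2 t)) has_field_derivative deriv ?\<sigma> (g2 t) * d2 t) (at t)"
      using transition_analytic[OF atlas_X ab(2) w(1) ab'(2) w(3)] unfolding w(2)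
      by (intro DERIV_chain2[OF analytic_has_deriv d2[OF t]])
    have tn: "deriv ?\<tau> (g1 t) \<noteq> 0" "deriv ?\<sigma> (g2 t) \<noteq> 0"
      using transition_deriv_nz[OF atlas_C ab(1) c(1) ab'(1) c(3)]
        transition_deriv_nz[OF atlas_X ab(2) w(1) ab'(2) w(3)] by (simp_all add: c(2) w(2))
    have co: "\<omega> a (g1 t) = \<omega> a' (snd a' c) * deriv ?\<tau> (g1 t)" "\<beta> b (g2 t) = \<beta> b' (snd b' w) * deriv ?\<sigma> (g2 t)"
      using compatible_coefficientsD[OF comp_\<omega> ab(1) ab'(1) c(1,3)]
        compatible_coefficientsD[OF comp_\<beta> ab(2) ab'(2) w(1,3)] by (simp_all only: c(2) w(2))
    have "((\<lambda>t. (?\<tau> (g1 t), ?\<sigma> (g2 t))) has_derivative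
        (\<lambda>h. (deriv ?\<tau> (g1 t) * d1 t * h, deriv ?\<sigma> (g2 t) * d2 t * h))) (at t)"
      by (rule has_derivative_pair_complex[OF D1 D2])
    moreover have "(deriv ?\<tau> (g1 t) * d1 t, deriv ?\<sigma> (g2 t) * d2 t) \<noteq> 0"
      using tn nz[OF t] by (auto simp: zero_prod_def)
    moreover have "(product_chart a' b', (c, w), (deriv ?\<tau> (g1 t) * d1 t, deriv ?\<sigma> (g2 t) * d2 t)) \<in> \<F>"
    proof (rule foliationI[OF ab' c(3) w(3)])
      have e: "\<omega> a (g1 t) * d1 t = \<omega> a' (snd a' c) * (deriv ?\<tau> (g1 t) * d1 t)"
        "\<beta> b (g2 t) * d2 t = \<beta> b' (snd b' w) * (deriv ?\<sigma> (g2 t) * d2 t)"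
        unfolding co by (simp_all only: mult.assoc)
      then show "c \<notin> P \<and> \<omega> a' (snd a' c) * (deriv ?\<tau> (g1 t) * d1 t) +
          \<beta> b' (snd b' w) * (deriv ?\<sigma> (g2 t) * d2 t) = 0 \<or> c \<in> P \<and> deriv ?\<tau> (g1 t) * d1 t = 0"
        using F[OF t] unfolding c_def[symmetric] e by (elim disjE conjE) simp_all
    qed
    ultimately show ?thesis unfolding c_def w_def o_def map_prod_simp by blast
  qed
  have cont: "continuous_on (ball 0 1) ?k"
  proof (intro continuous_at_imp_continuous_on ballI)
    fix t :: complex assume t: "t \<in> ball 0 1"
    have "isCont (chart_inv a) (g1 t)" "isCont (chart_inv b) (g2 t)"
      using isCont_chart_inv[OF atlas_C ab(1) chart_inv_in[OF atlas_C ab(1) g(1)[OF t]]]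
        isCont_chart_inv[OF atlas_X ab(2) chart_inv_in[OF atlas_X ab(2) g(2)[OF t]]]
      by (simp_all add: chart_inv_right[OF atlas_C ab(1) g(1)[OF t]] chart_inv_right[OF atlas_X ab(2) g(2)[OF t]])
    then show "isCont ?k t"
      by (intro continuous_intros isCont_o2[OF DERIV_isCont[OF d1[OF t]]] isCont_o2[OF DERIV_isCont[OF d2[OF t]]])
  qed
  have "holomorphic_map_on standard_atlas CX (ball 0 1) ?k"
    unfolding holomorphic_map_on_def
  proof (intro conjI cont ballI)
    fix s pc assume "s \<in> (standard_atlas :: (complex, complex) chart set)" "pc \<in> CX"
    then obtain a' b' where s: "s = (UNIV, \<lambda>z. z)" and pc: "pc = product_chart a' b'" "a' \<in> C" "b' \<in> X"
      unfolding standard_atlas_def product_atlas_def by blast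
    show "(snd pc \<circ> ?k \<circ> chart_inv s) cholomorphic_on snd s ` {p \<in> ball 0 1 \<inter> fst s. ?k p \<in> fst pc}"
      unfolding cholomorphic_on_def
    proof
      fix z assume "z \<in> snd s ` {p \<in> ball 0 1 \<inter> fst s. ?k p \<in> fst pc}"
      then have z: "z \<in> ball 0 1" "?k z \<in> fst a' \<times> fst b'" by (auto simp: s pc)
      obtain e1 e2 where "((map_prod (snd a') (snd b') \<circ> ?k) has_derivative (\<lambda>h. (e1 * h, e2 * h))) (at z)"
        using key[OF z(1) pc(2,3) z(2)] by blast
      moreover have "snd pc \<circ> ?k \<circ> chart_inv s = map_prod (snd a') (snd b') \<circ> ?k"
        by (rule ext) (simp add: s std pc)
      ultimately show "\<exists>D. ((snd pc \<circ> ?k \<circ> chart_inv s) has_derivative D) (at z) \<and>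
          (\<forall>a v. D (a *\<^sub>C v) = a *\<^sub>C D v)"
        by (intro exI[of _ "\<lambda>h. (e1 * h, e2 * h)"]) (auto simp: scaleC_prod_def scaleC_complex_def)
    qed
  qed
  moreover have "let v = frechet_derivative (snd pc \<circ> ?k) (at t) 1 in v \<noteq> 0 \<and> (pc, ?k t, v) \<in> \<F>"
    if t: "t \<in> ball 0 1" "pc \<in> CX" "?k t \<in> fst pc" for t pc
  proof -
    obtain a' b' where pc: "pc = product_chart a' b'" "a' \<in> C" "b' \<in> X"
      using t(2) unfolding product_atlas_def by blast
    obtain e1 e2 where e: "((map_prod (snd a') (snd b') \<circ> ?k) has_derivative (\<lambda>h. (e1 * h, e2 * h))) (at t)"
      "(e1, e2) \<noteq> 0" "(product_chart a' b', ?k t, (e1, e2)) \<in> \<F>"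
      using key[OF t(1) pc(2,3)] t(3) pc(1) by auto
    have "frechet_derivative (snd pc \<circ> ?k) (at t) = (\<lambda>h. (e1 * h, e2 * h))"
      using frechet_derivative_at[OF e(1)] by (simp add: pc(1))
    then have "frechet_derivative (snd pc \<circ> ?k) (at t) 1 = (e1, e2)" by simp
    with e show ?thesis unfolding pc(1) Let_def by simp
  qed
  ultimately show ?thesis unfolding integral_disc_def using U by auto
qed

text \<open>An integral disc is connected and lies in one leaf of \<open>U\<close>, hence in one
  component of that leaf.\<close>

lemma F_chart_const_on_disc:
  assumes F: "F_chart A F (U, f)" and g: "integral_disc A F U g" and st: "s \<in> ball 0 1" "t \<in> ball 0 1"
  shows "f (g s) = f (g t)"
proof -
  define R where "R = (\<lambda>r s. \<exists>g. integral_disc A F U g \<and> r \<in> g ` ball 0 1 \<and> s \<in> g ` ball 0 1)"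
  define L where "L = {q. R\<^sup>*\<^sup>* (g s) q}"
  have "g s \<in> U" using g st unfolding integral_disc_def by blast
  then have "L \<in> leaves A F U" unfolding leaves_def L_def R_def by blast
  have sub: "g ` ball 0 1 \<subseteq> L"
    unfolding L_def R_def using g st by blast
  have "connected (g ` ball 0 1)"
    using g unfolding integral_disc_def holomorphic_map_on_def
    by (intro connected_continuous_image) auto
  then have K: "g ` ball 0 1 \<subseteq> connected_component_set L (g s)"
    using sub st by (intro connected_component_maximal) auto
  have comp: "connected_component_set L (g s) \<in> components L"
    using sub st by (intro componentsI) auto
  have "\<And>L K. L \<in> leaves A F U \<Longrightarrow> K \<in> components L \<Longrightarrow> \<exists>y. \<forall>p\<in>K. f p = y"
    using F unfolding F_chart_def split_conv by blast
  from this[OF \<open>L \<in> leaves A F U\<close> comp]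
  obtain y where y: "\<forall>p\<in>connected_component_set L (g s). f p = y" ..
  have m: "g s \<in> connected_component_set L (g s)" "g t \<in> connected_component_set L (g s)"
    using K imageI[OF st(1), of g] imageI[OF st(2), of g] by (simp_all only: subset_iff)
  show ?thesis using bspec[OF y m(1)] bspec[OF y m(2)] by simp
qed

lemma eventually_F_chart:
  assumes F: "F_chart CX \<F> (U, f)" and p: "p \<in> U" "r \<in> cp1_atlas" "f p \<in> fst r"
  shows "eventually (\<lambda>q. q \<in> U \<and> f q \<in> fst r) (nhds p)"
proof -
  have "open U" "continuous_on U f"
    using F unfolding F_chart_def holomorphic_submersion_on_def holomorphic_map_on_def by auto
  then have "open (f -` fst r \<inter> U)"
    using open_cp1_chart[OF p(2)] continuous_on_open_vimage by blast
  then show ?thesis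
    using eventually_nhds_in_open[of "f -` fst r \<inter> U" p] p by (auto elim!: eventually_mono)
qed

text \<open>Complex linearity reduces the derivative to its values on the two basis vectors, and
  surjectivity prevents both from vanishing.\<close>

lemma F_chart_derivative:
  assumes F: "F_chart CX \<F> (U, f)" and ab: "a \<in> C" "b \<in> X" and cw: "c \<in> fst a" "w \<in> fst b"
    and U: "(c, w) \<in> U" and r: "r \<in> cp1_atlas" "f (c, w) \<in> fst r"
  obtains D1 D2 where "D1 \<noteq> 0 \<or> D2 \<noteq> 0"
    "((\<lambda>v. snd r (f (chart_inv a (fst v), chart_inv b (snd v)))) has_derivative
        (\<lambda>h. D1 * fst h + D2 * snd h)) (at (snd a c, snd b w))"
proof -
  let ?pc = "product_chart a b" and ?x = "(snd a c, snd b w)"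
  let ?\<phi> = "snd r \<circ> f \<circ> chart_inv ?pc"
  have pc: "?pc \<in> CX" by (rule product_chart_in_atlas[OF ab])
  have mem: "(c, w) \<in> U \<inter> fst ?pc" using U cw by simp
  have "?\<phi> cholomorphic_on (snd ?pc ` {p \<in> U \<inter> fst ?pc. f p \<in> fst r})"
    and sur: "surj (frechet_derivative ?\<phi> (at (snd ?pc (c, w))))"
    using F pc r mem
    unfolding F_chart_def holomorphic_submersion_on_def holomorphic_map_on_def split_conv by blast+
  moreover have "?x \<in> snd ?pc ` {p \<in> U \<inter> fst ?pc. f p \<in> fst r}"
    using mem r(2) by (intro image_eqI[of _ _ "(c, w)"]) auto
  ultimately obtain D where D: "(?\<phi> has_derivative D) (at ?x)" "\<And>k v. D (k *\<^sub>C v) = k *\<^sub>C D v"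
    unfolding cholomorphic_on_def by blast
  interpret D: bounded_linear D using D(1) by (rule has_derivative_bounded_linear)
  have Deq: "D h = D (1, 0) * fst h + D (0, 1) * snd h" for h
  proof -
    have "h = fst h *\<^sub>C (1, 0) + snd h *\<^sub>C (0, 1)"
      by (cases h) (simp add: scaleC_prod_def scaleC_complex_def)
    then have "D h = D (fst h *\<^sub>C (1, 0)) + D (snd h *\<^sub>C (0, 1))" by (metis D.add)
    then show ?thesis by (simp add: D(2) scaleC_complex_def mult.commute)
  qed
  have "surj D" using sur frechet_derivative_at[OF D(1)] by simp
  then obtain h where "D h = 1" by (metis surjD)
  then have "D (1, 0) \<noteq> 0 \<or> D (0, 1) \<noteq> 0" using Deq[of h] by auto
  moreover have "((\<lambda>v. snd r (f (chart_inv a (fst v), chart_inv b (snd v)))) has_derivative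
        (\<lambda>h. D (1, 0) * fst h + D (0, 1) * snd h)) (at ?x)"
  proof -
    have ev: "eventually (\<lambda>v. ?\<phi> v = snd r (f (chart_inv a (fst v), chart_inv b (snd v)))) (nhds ?x)"
      using eventually_product_chart_inv[OF ab cw] by eventually_elim simp
    have "D = (\<lambda>h. D (1, 0) * fst h + D (0, 1) * snd h)" using Deq by (rule ext)
    with D(1) have "(?\<phi> has_derivative (\<lambda>h. D (1, 0) * fst h + D (0, 1) * snd h)) (at ?x)" by simp
    then show ?thesis
      by (rule has_derivative_transform_eventually)
        (use ev eventually_nhds_x_imp_x[OF ev] in \<open>auto simp: eventually_at_filter elim: eventually_mono\<close>)
  qed
  ultimately show ?thesis using that by blast
qed

end

section \<open>Normal form of transverse charts\<close>

lemma eventually_nhds_prod: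
  "eventually Q (nhds (a, b)) \<longleftrightarrow>
    (\<exists>Pf Pg. eventually Pf (nhds a) \<and> eventually Pg (nhds b) \<and> (\<forall>x y. Pf x \<longrightarrow> Pg y \<longrightarrow> Q (x, y)))"
  unfolding nhds_prod eventually_prod_filter ..

lemma eventually_nhds_fst: "eventually Q (nhds a) \<Longrightarrow> eventually (\<lambda>v. Q (fst v)) (nhds (a, b))"
  unfolding eventually_nhds_prod by (rule exI[of _ Q], rule exI[of _ "\<lambda>_. True"]) simp

lemma eventually_nhds_snd: "eventually Q (nhds b) \<Longrightarrow> eventually (\<lambda>v. Q (snd v)) (nhds (a, b))"
  unfolding eventually_nhds_prod by (rule exI[of _ "\<lambda>_. True"], rule exI[of _ Q]) simp

lemma eventually_nhds_slices:
  assumes "eventually Q (nhds (a, b))"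
  shows "eventually (\<lambda>x. Q (x, b)) (nhds a)" "eventually (\<lambda>y. Q (a, y)) (nhds b)"
proof -
  obtain Pf Pg where *: "eventually Pf (nhds a)" "eventually Pg (nhds b)" "\<And>x y. Pf x \<Longrightarrow> Pg y \<Longrightarrow> Q (x, y)"
    using assms unfolding eventually_nhds_prod by blast
  note e = eventually_nhds_x_imp_x[OF *(1)] eventually_nhds_x_imp_x[OF *(2)]
  show "eventually (\<lambda>x. Q (x, b)) (nhds a)" using *(1) by eventually_elim (rule *(3)[OF _ e(2)])
  show "eventually (\<lambda>y. Q (a, y)) (nhds b)" using *(2) by eventually_elim (rule *(3)[OF e(1)])
qed

lemma eventually_nhds_swap:
  assumes "eventually (\<lambda>v. Q (snd v, fst v)) (nhds (b, a))"
  shows "eventually Q (nhds (a, b))"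
proof -
  obtain Pf Pg where *: "eventually Pf (nhds b)" "eventually Pg (nhds a)" "\<And>x y. Pf x \<Longrightarrow> Pg y \<Longrightarrow> Q (y, x)"
    using assms unfolding eventually_nhds_prod by auto
  then show ?thesis
    unfolding eventually_nhds_prod by (intro exI[of _ Pg] exI[of _ Pf]) auto
qed

text \<open>The disc \<open>t \<mapsto> (z\<^sub>0 + \<epsilon> t, B\<^sup>-\<^sup>1 (A z + B w - A (z\<^sub>0 + \<epsilon> t)))\<close> is tangent to
  \<open>\<alpha> dz + \<beta> dw = 0\<close> and joins the point \<open>(z, w)\<close> to the slice \<open>z = z\<^sub>0\<close>.\<close>

lemma first_integral_vertical:
  fixes H :: "complex \<Rightarrow> complex \<Rightarrow> complex"
  assumes N: "open N" "(z0, w0) \<in> N"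
    and A: "\<And>z w. (z, w) \<in> N \<Longrightarrow> (A has_field_derivative \<alpha> z) (at z)"
    and B: "\<And>z w. (z, w) \<in> N \<Longrightarrow> (B has_field_derivative \<beta> w) (at w)"
    and nz: "\<beta> w0 \<noteq> 0"
    and hol: "(\<lambda>w. H z0 w) analytic_on {w0}"
    and const: "\<And>g1 g2 d1 d2 s t.
      (\<And>t. t \<in> ball 0 1 \<Longrightarrow> (g1 has_field_derivative d1 t) (at t)) \<Longrightarrow>
      (\<And>t. t \<in> ball 0 1 \<Longrightarrow> (g2 has_field_derivative d2 t) (at t)) \<Longrightarrow>
      (\<And>t. t \<in> ball 0 1 \<Longrightarrow> (g1 t, g2 t) \<in> N) \<Longrightarrow>
      (\<And>t. t \<in> ball 0 1 \<Longrightarrow> d1 t \<noteq> 0 \<or> d2 t \<noteq> 0) \<Longrightarrow>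
      (\<And>t. t \<in> ball 0 1 \<Longrightarrow> \<alpha> (g1 t) * d1 t + \<beta> (g2 t) * d2 t = 0) \<Longrightarrow>
      s \<in> ball 0 1 \<Longrightarrow> t \<in> ball 0 1 \<Longrightarrow> H (g1 s) (g2 s) = H (g1 t) (g2 t)"
  shows "\<exists>G. G analytic_on {A z0 + B w0} \<and>
    eventually (\<lambda>v. H (fst v) (snd v) = G (A (fst v) + B (snd v))) (nhds (z0, w0))"
proof -
  have evN: "eventually (\<lambda>v. v \<in> N) (nhds (z0, w0))" using N by (rule eventually_nhds_in_open)
  have Ba: "B analytic_on {w0}"
    using eventually_nhds_slices(2)[OF evN]
    by (intro analytic_atI) (auto elim!: eventually_mono simp: field_differentiable_def intro: B)
  have dB: "deriv B w0 \<noteq> 0" using DERIV_imp_deriv[OF B[OF N(2)]] nz by simp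
  obtain k where k: "k analytic_on {B w0}" "deriv k (B w0) \<noteq> 0" "k (B w0) = w0"
    "eventually (\<lambda>w. k (B w) = w) (nhds w0)" "eventually (\<lambda>s. B (k s) = s) (nhds (B w0))"
    using analytic_local_inverse[OF Ba dB] by blast
  have cA: "isCont A z0" by (rule DERIV_isCont[OF A[OF N(2)]])
  have cB: "isCont B w0" by (rule DERIV_isCont[OF B[OF N(2)]])
  \<comment> \<open>The point \<open>(z0, k (s - A z0))\<close> is where the slice
    \<open>z = z0\<close> meets the level set \<open>A + B = s\<close>, so \<open>G\<close> reads
    \<open>H\<close> off that slice.\<close>
  define G where "G s = H z0 (k (s - A z0))" for s
  have "G analytic_on {A z0 + B w0}"
  proof -
    have "(\<lambda>s. k (s - A z0)) analytic_on {A z0 + B w0}"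
      by (rule analytic_compose_at) (use k(1) in \<open>auto intro!: analytic_intros\<close>)
    then show ?thesis
      unfolding G_def by (rule analytic_compose_at) (use hol k(3) in simp)
  qed
  moreover have "eventually (\<lambda>v. H (fst v) (snd v) = G (A (fst v) + B (snd v))) (nhds (z0, w0))"
  proof -
    have "isCont (\<lambda>v. k (snd v)) (z0, B w0)"
      by (rule isCont_o2[where f = snd and g = k])
        (simp_all add: continuous_snd analytic_at_imp_isCont[OF k(1)])
    then have "isCont (\<lambda>v. (fst v, k (snd v))) (z0, B w0)"
      by (intro continuous_Pair continuous_fst continuous_ident)
    moreover have "eventually (\<lambda>v. v \<in> N) (nhds (fst (z0, B w0), k (snd (z0, B w0))))"
      using evN k(3) by simp
    ultimately have "eventually (\<lambda>v. (fst v, k (snd v)) \<in> N) (nhds (z0, B w0))"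
      by (rule eventually_nhds_compose)
    then obtain Pf Pg where Pfg: "eventually Pf (nhds z0)" "eventually Pg (nhds (B w0))"
      "\<And>z s. Pf z \<Longrightarrow> Pg s \<Longrightarrow> (z, k s) \<in> N"
      unfolding eventually_nhds_prod by auto
    have "eventually (\<lambda>s. eventually (\<lambda>s. B (k s) = s) (nhds s)) (nhds (B w0))"
      using k(5) by (simp add: eventually_eventually)
    from eventually_conj[OF eventually_conj[OF this eventually_analytic_at[OF k(1)]] Pfg(2)]
    obtain \<delta> where \<delta>: "\<delta> > 0" "\<And>s. s \<in> ball (B w0) \<delta> \<Longrightarrow> eventually (\<lambda>s. B (k s) = s) (nhds s)"
      "\<And>s. s \<in> ball (B w0) \<delta> \<Longrightarrow> k analytic_on {s}" "\<And>s. s \<in> ball (B w0) \<delta> \<Longrightarrow> Pg s"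
      unfolding eventually_nhds_ball by blast
    \<comment> \<open>Thirds, because \<open>\<sigma> t - B w0\<close> is a combination of three
      increments, two of \<open>A\<close> and one of \<open>B\<close>.\<close>
    have "eventually (\<lambda>u. u \<in> ball (A z0) (\<delta>/3)) (nhds (A z0))"
      "eventually (\<lambda>u. u \<in> ball (B w0) (\<delta>/3)) (nhds (B w0))"
      using \<delta>(1) by (intro eventually_nhds_in_open; simp)+
    note near = eventually_nhds_compose[OF cA this(1)] eventually_nhds_compose[OF cB this(2)]
    obtain \<epsilon> where \<epsilon>: "\<epsilon> > 0" "\<And>z. z \<in> ball z0 \<epsilon> \<Longrightarrow> Pf z" "\<And>z. z \<in> ball z0 \<epsilon> \<Longrightarrow> A z \<in> ball (A z0) (\<delta>/3)"
      using eventually_conj[OF Pfg(1) near(1)] unfolding eventually_nhds_ball by blast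
    have w: "eventually (\<lambda>w. k (B w) = w \<and> B w \<in> ball (B w0) (\<delta>/3)) (nhds w0)"
      by (rule eventually_conj[OF k(4) near(2)])
    have z: "eventually (\<lambda>z. z \<in> ball z0 \<epsilon>) (nhds z0)"
      using \<epsilon>(1) by (intro eventually_nhds_in_open) auto
    have main: "H z w = G (A z + B w)"
      if z: "z \<in> ball z0 \<epsilon>" and w: "k (B w) = w" "B w \<in> ball (B w0) (\<delta>/3)" for z w
    proof -
      define \<zeta> where "\<zeta> t = z0 + of_real \<epsilon> * t" for t :: complex
      define \<sigma> where "\<sigma> t = A z + B w - A (\<zeta> t)" for t
      have \<zeta>: "\<zeta> t \<in> ball z0 \<epsilon>" if "t \<in> ball 0 1" for t
        using that \<epsilon>(1) by (auto simp: \<zeta>_def dist_norm norm_mult)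
      have \<sigma>: "\<sigma> t \<in> ball (B w0) \<delta>" if t: "t \<in> ball 0 1" for t
      proof -
        have n: "norm (A z - A z0) < \<delta>/3" "norm (A (\<zeta> t) - A z0) < \<delta>/3" "norm (B w - B w0) < \<delta>/3"
          using \<epsilon>(3)[OF z] \<epsilon>(3)[OF \<zeta>[OF t]] w(2) by (auto simp: dist_norm norm_minus_commute)
        have "\<sigma> t - B w0 = (A z - A z0) - (A (\<zeta> t) - A z0) + (B w - B w0)" by (simp add: \<sigma>_def)
        then have "norm (\<sigma> t - B w0) \<le> norm (A z - A z0) + norm (A (\<zeta> t) - A z0) + norm (B w - B w0)"
          using norm_triangle_ineq[of "(A z - A z0) - (A (\<zeta> t) - A z0)" "B w - B w0"]
            norm_triangle_ineq4[of "A z - A z0" "A (\<zeta> t) - A z0"] by (simp only:)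
        with n have "norm (\<sigma> t - B w0) < \<delta>" by linarith
        then show ?thesis by (simp add: dist_norm norm_minus_commute)
      qed
      have inN: "(\<zeta> t, k (\<sigma> t)) \<in> N" if "t \<in> ball 0 1" for t
        by (rule Pfg(3)[OF \<epsilon>(2)[OF \<zeta>[OF that]] \<delta>(4)[OF \<sigma>[OF that]]])
      have d\<zeta>: "(\<zeta> has_field_derivative of_real \<epsilon>) (at t)" for t
        unfolding \<zeta>_def by (auto intro!: derivative_eq_intros)
      have d\<sigma>: "(\<sigma> has_field_derivative 0 - \<alpha> (\<zeta> t) * of_real \<epsilon>) (at t)" if "t \<in> ball 0 1" for t
        unfolding \<sigma>_def by (intro DERIV_diff DERIV_const DERIV_chain2[OF A[OF inN[OF that]] d\<zeta>])
      have dk: "((\<lambda>t. k (\<sigma> t)) has_field_derivative deriv k (\<sigma> t) * (0 - \<alpha> (\<zeta> t) * of_real \<epsilon>)) (at t)"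
        if "t \<in> ball 0 1" for t
        by (rule DERIV_chain2[OF analytic_has_deriv[OF \<delta>(3)[OF \<sigma>[OF that]]] d\<sigma>[OF that]])
      \<comment> \<open>Differentiating \<open>B (k s) = s\<close> cancels \<beta> against the
        derivative of \<open>k\<close> in the velocity of the disc; this is the tangency
        equation.\<close>
      have inv: "\<beta> (k (\<sigma> t)) * deriv k (\<sigma> t) = 1" if t: "t \<in> ball 0 1" for t
      proof -
        have "((\<lambda>s. B (k s)) has_field_derivative \<beta> (k (\<sigma> t)) * deriv k (\<sigma> t)) (at (\<sigma> t))"
          by (rule DERIV_chain2[OF B[OF inN[OF t]] analytic_has_deriv[OF \<delta>(3)[OF \<sigma>[OF t]]]])
        from DERIV_transfer_ev[OF this \<delta>(2)[OF \<sigma>[OF t]]]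
        show ?thesis using DERIV_unique DERIV_ident by blast
      qed
      have tz: "(z - z0) / of_real \<epsilon> \<in> ball 0 1"
        using z \<epsilon>(1) by (simp add: dist_norm norm_divide norm_minus_commute)
      have \<zeta>0: "\<zeta> 0 = z0" "\<zeta> ((z - z0) / of_real \<epsilon>) = z" using \<epsilon>(1) by (auto simp: \<zeta>_def)
      have "H (\<zeta> 0) (k (\<sigma> 0)) = H (\<zeta> ((z - z0) / of_real \<epsilon>)) (k (\<sigma> ((z - z0) / of_real \<epsilon>)))"
      proof (rule const[where ?g1.0 = \<zeta> and ?g2.0 = "\<lambda>t. k (\<sigma> t)"])
        fix t :: complex assume t: "t \<in> ball 0 1"
        show "(\<zeta> has_field_derivative of_real \<epsilon>) (at t)" by (rule d\<zeta>)
        show "((\<lambda>t. k (\<sigma> t)) has_field_derivative deriv k (\<sigma> t) * (0 - \<alpha> (\<zeta> t) * of_real \<epsilon>)) (at t)"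
          by (rule dk[OF t])
        show "(\<zeta> t, k (\<sigma> t)) \<in> N" by (rule inN[OF t])
        show "of_real \<epsilon> \<noteq> (0::complex) \<or> deriv k (\<sigma> t) * (0 - \<alpha> (\<zeta> t) * of_real \<epsilon>) \<noteq> 0"
          using \<epsilon>(1) by simp
        have "\<beta> (k (\<sigma> t)) * (deriv k (\<sigma> t) * (0 - \<alpha> (\<zeta> t) * of_real \<epsilon>)) =
            (\<beta> (k (\<sigma> t)) * deriv k (\<sigma> t)) * (0 - \<alpha> (\<zeta> t) * of_real \<epsilon>)" by (simp only: mult.assoc)
        then show "\<alpha> (\<zeta> t) * of_real \<epsilon> + \<beta> (k (\<sigma> t)) * (deriv k (\<sigma> t) * (0 - \<alpha> (\<zeta> t) * of_real \<epsilon>)) = 0"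
          by (simp add: inv[OF t])
      qed (use tz in auto)
      then show ?thesis by (simp add: \<zeta>0 G_def \<sigma>_def w(1))
    qed
    show ?thesis
      using eventually_nhds_fst[OF z] eventually_nhds_snd[OF w] by eventually_elim (auto intro: main)
  qed
  ultimately show ?thesis by blast
qed

text \<open>If \<beta> vanishes at \<open>w0\<close> then \<alpha> does not vanish at
  \<open>z0\<close>, and the vertical case applies with the two factors interchanged.\<close>

lemma first_integral:
  fixes H :: "complex \<Rightarrow> complex \<Rightarrow> complex"
  assumes N: "open N" "(z0, w0) \<in> N"
    and A: "\<And>z w. (z, w) \<in> N \<Longrightarrow> (A has_field_derivative \<alpha> z) (at z)"
    and B: "\<And>z w. (z, w) \<in> N \<Longrightarrow> (B has_field_derivative \<beta> w) (at w)"
    and nz: "\<alpha> z0 \<noteq> 0 \<or> \<beta> w0 \<noteq> 0"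
    and hol: "(\<lambda>w. H z0 w) analytic_on {w0}" "(\<lambda>z. H z w0) analytic_on {z0}"
    and const: "\<And>g1 g2 d1 d2 s t.
      (\<And>t. t \<in> ball 0 1 \<Longrightarrow> (g1 has_field_derivative d1 t) (at t)) \<Longrightarrow>
      (\<And>t. t \<in> ball 0 1 \<Longrightarrow> (g2 has_field_derivative d2 t) (at t)) \<Longrightarrow>
      (\<And>t. t \<in> ball 0 1 \<Longrightarrow> (g1 t, g2 t) \<in> N) \<Longrightarrow>
      (\<And>t. t \<in> ball 0 1 \<Longrightarrow> d1 t \<noteq> 0 \<or> d2 t \<noteq> 0) \<Longrightarrow>
      (\<And>t. t \<in> ball 0 1 \<Longrightarrow> \<alpha> (g1 t) * d1 t + \<beta> (g2 t) * d2 t = 0) \<Longrightarrow>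
      s \<in> ball 0 1 \<Longrightarrow> t \<in> ball 0 1 \<Longrightarrow> H (g1 s) (g2 s) = H (g1 t) (g2 t)"
  shows "\<exists>G. G analytic_on {A z0 + B w0} \<and>
    eventually (\<lambda>v. H (fst v) (snd v) = G (A (fst v) + B (snd v))) (nhds (z0, w0))"
proof (cases "\<beta> w0 = 0")
  case False
  show ?thesis by (rule first_integral_vertical[where H = H and N = N and A = A and B = B and \<alpha> = \<alpha> and \<beta> = \<beta>,
          OF N A B False hol(1) const])
next
  case True
  then have nz': "\<alpha> z0 \<noteq> 0" using nz by simp
  have "\<exists>G. G analytic_on {B w0 + A z0} \<and>
    eventually (\<lambda>v. H (snd v) (fst v) = G (B (fst v) + A (snd v))) (nhds (w0, z0))"
  proof (rule first_integral_vertical[where N = "(\<lambda>v. (snd v, fst v)) -` N" and H = "\<lambda>w z. H z w"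
        and A = B and B = A and \<alpha> = \<beta> and \<beta> = \<alpha>])
    show "open ((\<lambda>v. (snd v, fst v)) -` N)"
      by (intro open_vimage N(1) continuous_intros)
    fix g1 g2 d1 d2 :: "complex \<Rightarrow> complex" and s t :: complex
    assume 1: "\<And>t. t \<in> ball 0 1 \<Longrightarrow> (g1 has_field_derivative d1 t) (at t)"
      and 2: "\<And>t. t \<in> ball 0 1 \<Longrightarrow> (g2 has_field_derivative d2 t) (at t)"
      and 3: "\<And>t. t \<in> ball 0 1 \<Longrightarrow> (g1 t, g2 t) \<in> (\<lambda>v. (snd v, fst v)) -` N"
      and 4: "\<And>t. t \<in> ball 0 1 \<Longrightarrow> d1 t \<noteq> 0 \<or> d2 t \<noteq> 0"
      and 5: "\<And>t. t \<in> ball 0 1 \<Longrightarrow> \<beta> (g1 t) * d1 t + \<alpha> (g2 t) * d2 t = 0"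
      and st: "s \<in> ball 0 1" "t \<in> ball 0 1"
    show "H (g2 s) (g1 s) = H (g2 t) (g1 t)"
    proof (rule const[OF 2 1 _ _ _ st])
      fix t :: complex assume t: "t \<in> ball 0 1"
      show "(g2 t, g1 t) \<in> N" using 3[OF t] by simp
      show "d2 t \<noteq> 0 \<or> d1 t \<noteq> 0" using 4[OF t] by blast
      show "\<alpha> (g2 t) * d2 t + \<beta> (g1 t) * d1 t = 0" using 5[OF t] by (simp only: add.commute)
    qed
  qed (use N(2) nz' hol(2) in \<open>auto intro: A B\<close>)
  then obtain G where G: "G analytic_on {A z0 + B w0}"
    "eventually (\<lambda>v. H (snd v) (fst v) = G (A (snd v) + B (fst v))) (nhds (w0, z0))"
    by (auto simp: add.commute)
  have "eventually (\<lambda>v. H (fst v) (snd v) = G (A (fst v) + B (snd v))) (nhds (z0, w0))"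
    by (rule eventually_nhds_swap) (use G(2) in simp)
  with G(1) show ?thesis by blast
qed

section \<open>Slices and connected neighbourhoods\<close>

lemma has_derivative_slices:
  fixes h :: "complex \<times> complex \<Rightarrow> complex"
  assumes "(h has_derivative (\<lambda>k. D1 * fst k + D2 * snd k)) (at (z0, w0))"
  shows "((\<lambda>z. h (z, w0)) has_field_derivative D1) (at z0)"
    and "((\<lambda>w. h (z0, w)) has_field_derivative D2) (at w0)"
proof -
  have 1: "((\<lambda>z. (z, w0)) has_derivative (\<lambda>k. (k, 0))) (at z0)"
    and 2: "((\<lambda>w. (z0, w)) has_derivative (\<lambda>k. (0, k))) (at w0)"
    by (auto intro!: derivative_eq_intros)
  show "((\<lambda>z. h (z, w0)) has_field_derivative D1) (at z0)"
    using has_derivative_compose[OF 1 assms] unfolding has_field_derivative_def by simp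
  show "((\<lambda>w. h (z0, w)) has_field_derivative D2) (at w0)"
    using has_derivative_compose[OF 2 assms] unfolding has_field_derivative_def by simp
qed

text \<open>The image of a coordinate disc. That it stays connected without its centre serves to
  carry Moebius relations across the fibres over poles and zeros.\<close>

lemma riemann_surface_connected_nhd:
  fixes A :: "('m::t2_space, complex) chart set"
  assumes A: "complex_atlas A" and c: "c \<in> A" "p \<in> fst c" and Q: "eventually Q (nhds p)"
  shows "\<exists>N. connected N \<and> connected (N - {p}) \<and> p \<in> N \<and> (\<forall>q\<in>N. Q q) \<and> eventually (\<lambda>q. q \<in> N) (nhds p)"
proof -
  have "eventually (\<lambda>z. Q (chart_inv c z)) (nhds (snd c p))"
    by (rule eventually_nhds_chart[OF A c, THEN iffD1]) (rule Q)
  with eventually_in_chart_image[OF A c]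
  have "eventually (\<lambda>z. z \<in> snd c ` fst c \<and> Q (chart_inv c z)) (nhds (snd c p))"
    by (rule eventually_conj)
  then obtain e where e: "e > 0" "\<And>z. z \<in> ball (snd c p) e \<Longrightarrow> z \<in> snd c ` fst c"
    "\<And>z. z \<in> ball (snd c p) e \<Longrightarrow> Q (chart_inv c z)"
    unfolding eventually_nhds_ball by blast
  define N where "N = chart_inv c ` ball (snd c p) e"
  have cont: "continuous_on (ball (snd c p) e) (chart_inv c)"
  proof (intro continuous_at_imp_continuous_on ballI)
    fix z assume "z \<in> ball (snd c p) e"
    from e(2)[OF this] show "isCont (chart_inv c) z"
      using isCont_chart_inv[OF A c(1)] by blast
  qed
  have "connected N"
    unfolding N_def by (intro connected_continuous_image cont connected_ball)
  moreover have "N - {p} = chart_inv c ` (ball (snd c p) e - {snd c p})"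
  proof -
    have "chart_inv c z = p \<longleftrightarrow> z = snd c p" if "z \<in> ball (snd c p) e" for z
      using chart_inv_right[OF A c(1) e(2)[OF that]] chart_inv_left[OF A c] by auto
    then show ?thesis unfolding N_def by blast
  qed
  then have "connected (N - {p})"
    by (simp only:) (intro connected_continuous_image continuous_on_subset[OF cont]
        connected_open_delete connected_ball open_ball; simp)
  moreover have "p \<in> N"
    unfolding N_def using e(1) chart_inv_left[OF A c] by (intro image_eqI[of _ _ "snd c p"]) auto
  moreover have "\<forall>q\<in>N. Q q" unfolding N_def using e(3) by blast
  moreover have "eventually (\<lambda>q. q \<in> N) (nhds p)"
    by (rule eventually_nhds_chart[OF A c, THEN iffD2])
      (unfold eventually_nhds_ball N_def, use e(1) in blast)
  ultimately show ?thesis by blast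
qed

lemma isCont_fst_compose: "isCont f (fst p) \<Longrightarrow> isCont (\<lambda>q. f (fst q)) p"
  for f :: "'a::t2_space \<Rightarrow> 'c::topological_space" and p :: "'a \<times> 'b::t2_space"
  by (rule isCont_o2[where f = fst and g = f]) (simp_all add: continuous_fst)

lemma isCont_snd_compose: "isCont f (snd p) \<Longrightarrow> isCont (\<lambda>q. f (snd q)) p"
  for f :: "'b::t2_space \<Rightarrow> 'c::topological_space" and p :: "'a::t2_space \<times> 'b"
  by (rule isCont_o2[where f = snd and g = f]) (simp_all add: continuous_snd)

text \<open>For primitives \<open>A\<close> of \<omega> and \<open>B\<close> of \<beta> this is the
  local function \<open>u = \<integral>\<omega> + \<integral>\<beta>\<close>, whose level sets are
  tangent to the foliation.\<close>

definition separated :: "('a \<Rightarrow> complex) \<Rightarrow> ('b \<Rightarrow> complex) \<Rightarrow> 'a \<times> 'b \<Rightarrow> complex" where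
  "separated A B q = A (fst q) + B (snd q)"

text \<open>\<open>G\<close> expresses the foliated chart, in the affine coordinate
  \<open>r\<close>, as a function of \<open>u\<close> alone. The nonzero derivative is what allows
  its Schwarzian to be formed.\<close>

definition transverse_coordinate ::
    "('a::t2_space \<times> 'b::t2_space) set \<Rightarrow> ('a \<times> 'b \<Rightarrow> cp1) \<Rightarrow> (cp1, complex) chart \<Rightarrow>
     ('a \<times> 'b \<Rightarrow> complex) \<Rightarrow> (complex \<Rightarrow> complex) \<Rightarrow> 'a \<times> 'b \<Rightarrow> bool" where
  "transverse_coordinate U f r u G p \<longleftrightarrow> G analytic_on {u p} \<and> deriv G (u p) \<noteq> 0 \<and>
     eventually (\<lambda>q. q \<in> U \<and> f q \<in> fst r \<and> snd r (f q) = G (u q)) (nhds p)"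

lemma transverse_coordinateD:
  assumes "transverse_coordinate U f r u G p"
  shows "G analytic_on {u p}" "deriv G (u p) \<noteq> 0"
    "eventually (\<lambda>q. q \<in> U \<and> f q \<in> fst r \<and> snd r (f q) = G (u q)) (nhds p)"
  using assms unfolding transverse_coordinate_def by blast+

lemma eventually_transverse_coordinate:
  assumes t: "transverse_coordinate U f r u G p" and u: "isCont u p"
  shows "eventually (transverse_coordinate U f r u G) (nhds p)"
proof -
  note tD = transverse_coordinateD[OF t]
  have "eventually (\<lambda>q. eventually (\<lambda>q. q \<in> U \<and> f q \<in> fst r \<and> snd r (f q) = G (u q)) (nhds q)) (nhds p)"
    using tD(3) by (simp only: eventually_eventually)
  then show ?thesis
    using eventually_nhds_compose[OF u eventually_analytic_at[OF tD(1)]]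
      eventually_nhds_compose[OF u eventually_deriv_nz[OF tD(1,2)]]
    unfolding transverse_coordinate_def by eventually_elim blast
qed

section \<open>Regular points and factorization through \<open>u\<close>\<close>

context foliated_product
begin

definition primitives :: "('a \<Rightarrow> complex) \<Rightarrow> ('b \<Rightarrow> complex) \<Rightarrow> 'a \<times> 'b \<Rightarrow> bool" where
  "primitives A B p \<longleftrightarrow> is_primitive C \<omega> A (fst p) \<and> is_primitive X \<beta> B (snd p)"

text \<open>The points off the poles at which
  \<open>u = \<integral>\<omega> + \<integral>\<beta>\<close> has nonzero differential. The
  coefficients change by nonzero factors between charts, so the choice of \<open>a\<close> and
  \<open>b\<close> does not matter.\<close>

definition regular :: "'a \<times> 'b \<Rightarrow> bool" where
  "regular p \<longleftrightarrow> (\<exists>a\<in>C. \<exists>b\<in>X. fst p \<in> fst a \<and> snd p \<in> fst b \<and> fst p \<notin> P \<and>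
     (\<omega> a (snd a (fst p)) \<noteq> 0 \<or> \<beta> b (snd b (snd p)) \<noteq> 0))"

lemma chart_C: "\<exists>a\<in>C. c \<in> fst a" and chart_X: "\<exists>b\<in>X. w \<in> fst b"
  using atlas_C atlas_X unfolding complex_atlas_def by blast+

lemma regular_off_zeros: "c \<notin> P \<Longrightarrow> c \<notin> Y \<Longrightarrow> regular (c, w)"
  using chart_C[of c] chart_X[of w] \<omega>_nonzero[of _ c] unfolding regular_def fst_conv snd_conv by blast

lemma regular_base: "c \<notin> P \<Longrightarrow> regular (c, w\<^sub>0)"
  using chart_C[of c] b\<^sub>0 \<beta>_nonzero unfolding regular_def fst_conv snd_conv by blast

lemma exists_primitives:
  assumes "fst p \<notin> P"
  shows "\<exists>A B. primitives A B p"
proof -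
  obtain a b where a: "a \<in> C" "fst p \<in> fst a" and b: "b \<in> X" "snd p \<in> fst b"
    using chart_C chart_X by metis
  show ?thesis
    using exists_primitive[OF atlas_C comp_\<omega> a \<omega>_analytic[OF a assms]]
      exists_primitive[OF atlas_X comp_\<beta> b \<beta>_analytic[OF b]]
    unfolding primitives_def by blast
qed

lemma isCont_separated:
  assumes "primitives A B p"
  shows "isCont (separated A B) p"
proof -
  obtain a b where a: "a \<in> C" "fst p \<in> fst a" and b: "b \<in> X" "snd p \<in> fst b"
    using chart_C chart_X by metis
  have "isCont A (fst p)" "isCont B (snd p)"
    using assms primitive_analytic(3)[OF atlas_C comp_\<omega> _ a] primitive_analytic(3)[OF atlas_X comp_\<beta> _ b]
    unfolding primitives_def by blast+
  then show ?thesis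
    unfolding separated_def[abs_def] by (intro continuous_add isCont_fst_compose isCont_snd_compose)
qed

lemma eventually_primitives:
  assumes "primitives A B p"
  shows "eventually (primitives A B) (nhds p)"
proof -
  obtain a b where a: "a \<in> C" "fst p \<in> fst a" and b: "b \<in> X" "snd p \<in> fst b"
    using chart_C chart_X by metis
  have "eventually (is_primitive C \<omega> A) (nhds (fst p))" "eventually (is_primitive X \<beta> B) (nhds (snd p))"
    using assms eventually_is_primitive[OF atlas_C comp_\<omega> _ a] eventually_is_primitive[OF atlas_X comp_\<beta> _ b]
    unfolding primitives_def by blast+
  from eventually_nhds_fst[OF this(1), of "snd p"] eventually_nhds_snd[OF this(2), of "fst p"]
  show ?thesis unfolding primitives_def prod.collapse by eventually_elim blast
qed

text \<open>At a regular point \<open>u\<close> has a continuous local section: freeze one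
  coordinate and invert the primitive in the other. Hence an identity in \<open>u q\<close> for
  \<open>q\<close> near \<open>p\<close> is an identity in a free complex variable, which can be
  differentiated.\<close>

lemma eventually_separated_open:
  assumes reg: "regular p" and pr: "primitives A B p"
    and Q: "eventually (\<lambda>q. Q (separated A B q)) (nhds p)"
  shows "eventually Q (nhds (separated A B p))"
proof -
  obtain a b where a: "a \<in> C" "fst p \<in> fst a" and b: "b \<in> X" "snd p \<in> fst b"
    and nz: "\<omega> a (snd a (fst p)) \<noteq> 0 \<or> \<beta> b (snd b (snd p)) \<noteq> 0"
    using reg unfolding regular_def by blast
  have A: "is_primitive C \<omega> A (fst p)" and B: "is_primitive X \<beta> B (snd p)"
    using pr unfolding primitives_def by auto
  note aA = primitive_analytic[OF atlas_C comp_\<omega> A a] and aB = primitive_analytic[OF atlas_X comp_\<beta> B b]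
  have *: "eventually Q (nhds (separated A B p))"
    if m: "isCont m (separated A B p)" "m (separated A B p) = p"
      "eventually (\<lambda>s. separated A B (m s) = s) (nhds (separated A B p))" for m
  proof -
    have "eventually (\<lambda>s. Q (separated A B (m s))) (nhds (separated A B p))"
      by (rule eventually_nhds_compose[OF m(1)]) (use Q m(2) in simp)
    with m(3) show ?thesis by eventually_elim simp
  qed
  show ?thesis
  proof (cases "\<omega> a (snd a (fst p)) = 0")
    case False
    then obtain k where k: "k analytic_on {A (fst p)}" "k (A (fst p)) = snd a (fst p)"
      "eventually (\<lambda>t. A (chart_inv a (k t)) = t) (nhds (A (fst p)))"
      using analytic_local_inverse[OF aA(1)] aA(2) chart_inv_left[OF atlas_C a] by auto
    let ?l = "\<lambda>s. s - B (snd p)"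
    have l: "isCont ?l (separated A B p)" "?l (separated A B p) = A (fst p)"
      by (auto simp: separated_def intro!: continuous_intros)
    show ?thesis
    proof (rule *)
      have "isCont (\<lambda>s. k (?l s)) (separated A B p)"
        by (rule isCont_o2[OF l(1)]) (use l(2) analytic_at_imp_isCont[OF k(1)] in simp)
      then have "isCont (\<lambda>s. chart_inv a (k (?l s))) (separated A B p)"
        by (rule isCont_o2) (use l(2) k(2) isCont_chart_inv[OF atlas_C a] in simp)
      then show "isCont (\<lambda>s. (chart_inv a (k (?l s)), snd p)) (separated A B p)"
        by (intro continuous_Pair continuous_const)
      show "(chart_inv a (k (?l (separated A B p))), snd p) = p"
        using l(2) k(2) chart_inv_left[OF atlas_C a] by simp
      have "eventually (\<lambda>s. A (chart_inv a (k (?l s))) = ?l s) (nhds (separated A B p))"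
        by (rule eventually_nhds_compose[OF l(1)]) (use l(2) k(3) in simp)
      then show "eventually (\<lambda>s. separated A B (chart_inv a (k (?l s)), snd p) = s) (nhds (separated A B p))"
        by eventually_elim (simp add: separated_def)
    qed
  next
    case True
    with nz have "deriv (\<lambda>z. B (chart_inv b z)) (snd b (snd p)) \<noteq> 0" using aB(2) by simp
    then obtain k where k: "k analytic_on {B (snd p)}" "k (B (snd p)) = snd b (snd p)"
      "eventually (\<lambda>t. B (chart_inv b (k t)) = t) (nhds (B (snd p)))"
      using analytic_local_inverse[OF aB(1)] chart_inv_left[OF atlas_X b] by auto
    let ?l = "\<lambda>s. s - A (fst p)"
    have l: "isCont ?l (separated A B p)" "?l (separated A B p) = B (snd p)"
      by (auto simp: separated_def intro!: continuous_intros)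
    show ?thesis
    proof (rule *)
      have "isCont (\<lambda>s. k (?l s)) (separated A B p)"
        by (rule isCont_o2[OF l(1)]) (use l(2) analytic_at_imp_isCont[OF k(1)] in simp)
      then have "isCont (\<lambda>s. chart_inv b (k (?l s))) (separated A B p)"
        by (rule isCont_o2) (use l(2) k(2) isCont_chart_inv[OF atlas_X b] in simp)
      then show "isCont (\<lambda>s. (fst p, chart_inv b (k (?l s)))) (separated A B p)"
        by (intro continuous_Pair continuous_const)
      show "(fst p, chart_inv b (k (?l (separated A B p)))) = p"
        using l(2) k(2) chart_inv_left[OF atlas_X b] by simp
      have "eventually (\<lambda>s. B (chart_inv b (k (?l s))) = ?l s) (nhds (separated A B p))"
        by (rule eventually_nhds_compose[OF l(1)]) (use l(2) k(3) in simp)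
      then show "eventually (\<lambda>s. separated A B (fst p, chart_inv b (k (?l s))) = s) (nhds (separated A B p))"
        by eventually_elim (simp add: separated_def)
    qed
  qed
qed

lemma F_chart_partials:
  assumes F: "F_chart CX \<F> (U, f)" and ab: "a \<in> C" "b \<in> X" and r: "r \<in> cp1_atlas"
    and v: "z \<in> snd a ` fst a" "w \<in> snd b ` fst b" "(chart_inv a z, chart_inv b w) \<in> U"
      "f (chart_inv a z, chart_inv b w) \<in> fst r"
  obtains D1 D2 where "D1 \<noteq> 0 \<or> D2 \<noteq> 0"
    "((\<lambda>z. snd r (f (chart_inv a z, chart_inv b w))) has_field_derivative D1) (at z)"
    "((\<lambda>w. snd r (f (chart_inv a z, chart_inv b w))) has_field_derivative D2) (at w)"
proof -
  note inv = chart_inv_in[OF atlas_C ab(1) v(1)] chart_inv_in[OF atlas_X ab(2) v(2)]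
    chart_inv_right[OF atlas_C ab(1) v(1)] chart_inv_right[OF atlas_X ab(2) v(2)]
  obtain D1 D2 where D: "D1 \<noteq> 0 \<or> D2 \<noteq> 0"
    "((\<lambda>v. snd r (f (chart_inv a (fst v), chart_inv b (snd v)))) has_derivative
        (\<lambda>h. D1 * fst h + D2 * snd h)) (at (z, w))"
    using F_chart_derivative[OF F ab inv(1,2) v(3) r v(4)] unfolding inv(3,4) by blast
  show ?thesis
    using that[OF D(1)] has_derivative_slices[OF D(2)] by simp
qed

text \<open>The chart is constant on the discs of \<open>first_integral\<close>, so it factors
  through \<open>u\<close>. If the derivative of \<open>G\<close> vanished, both partial derivatives
  of the chart would vanish, against its being a submersion.\<close>

lemma exists_transverse_coordinate:
  assumes F: "F_chart CX \<F> (U, f)" and p: "p \<in> U" "r \<in> cp1_atlas" "f p \<in> fst r"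
    and reg: "regular p" and pr: "primitives A B p"
  shows "\<exists>G. transverse_coordinate U f r (separated A B) G p"
proof -
  obtain a b where a: "a \<in> C" "fst p \<in> fst a" and b: "b \<in> X" "snd p \<in> fst b" and notP: "fst p \<notin> P"
    and nz: "\<omega> a (snd a (fst p)) \<noteq> 0 \<or> \<beta> b (snd b (snd p)) \<noteq> 0"
    using reg unfolding regular_def by blast
  have A: "is_primitive C \<omega> A (fst p)" and B: "is_primitive X \<beta> B (snd p)"
    using pr unfolding primitives_def by auto
  define z0 w0 where "z0 = snd a (fst p)" and "w0 = snd b (snd p)"
  define K where "K v = (chart_inv a (fst v), chart_inv b (snd v))" for v
  define H where "H z w = snd r (f (chart_inv a z, chart_inv b w))" for z w
  have K0: "K (z0, w0) = p"
    by (simp add: K_def z0_def w0_def chart_inv_left[OF atlas_C a] chart_inv_left[OF atlas_X b])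
  have cK: "isCont K (z0, w0)"
    unfolding K_def z0_def w0_def
    by (intro continuous_Pair isCont_fst_compose isCont_snd_compose)
      (simp_all add: isCont_chart_inv[OF atlas_C a] isCont_chart_inv[OF atlas_X b])
  have e1: "eventually (\<lambda>v. K v \<in> U \<and> f (K v) \<in> fst r) (nhds (z0, w0))"
    by (rule eventually_nhds_compose[OF cK]) (use eventually_F_chart[OF F p] K0 in simp)
  have "eventually (\<lambda>z. chart_inv a z \<notin> P) (nhds z0)"
    unfolding z0_def by (rule eventually_nhds_chart[OF atlas_C a, THEN iffD1]) (rule eventually_notin_P'[OF notP])
  note e2 = eventually_nhds_fst[OF this, of w0]
  note e3 = eventually_nhds_fst[OF eventually_in_chart_image[OF atlas_C a], folded z0_def, of w0]
  note e4 = eventually_nhds_snd[OF eventually_in_chart_image[OF atlas_X b], folded w0_def, of z0]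
  note e5 = eventually_nhds_fst[OF is_primitiveD[OF A a], folded z0_def, of w0]
  note e6 = eventually_nhds_snd[OF is_primitiveD[OF B b], folded w0_def, of z0]
  have "eventually (\<lambda>v. (K v \<in> U \<and> f (K v) \<in> fst r) \<and> chart_inv a (fst v) \<notin> P \<and>
      fst v \<in> snd a ` fst a \<and> snd v \<in> snd b ` fst b \<and>
      ((\<lambda>z. A (chart_inv a z)) has_field_derivative \<omega> a (fst v)) (at (fst v)) \<and>
      ((\<lambda>z. B (chart_inv b z)) has_field_derivative \<beta> b (snd v)) (at (snd v))) (nhds (z0, w0))"
    by (rule eventually_conj[OF e1 eventually_conj[OF e2 eventually_conj[OF e3 eventually_conj[OF e4
          eventually_conj[OF e5 e6]]]]])
  then obtain N where N: "open N" "(z0, w0) \<in> N"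
    and NK: "\<And>v. v \<in> N \<Longrightarrow> K v \<in> U \<and> f (K v) \<in> fst r"
    and NP: "\<And>v. v \<in> N \<Longrightarrow> chart_inv a (fst v) \<notin> P"
    and Na: "\<And>v. v \<in> N \<Longrightarrow> fst v \<in> snd a ` fst a" and Nb: "\<And>v. v \<in> N \<Longrightarrow> snd v \<in> snd b ` fst b"
    and NA: "\<And>v. v \<in> N \<Longrightarrow> ((\<lambda>z. A (chart_inv a z)) has_field_derivative \<omega> a (fst v)) (at (fst v))"
    and NB: "\<And>v. v \<in> N \<Longrightarrow> ((\<lambda>z. B (chart_inv b z)) has_field_derivative \<beta> b (snd v)) (at (snd v))"
    unfolding eventually_nhds by blast
  have part: "\<exists>D1 D2. (D1 \<noteq> 0 \<or> D2 \<noteq> 0) \<and> ((\<lambda>z. H z w) has_field_derivative D1) (at z) \<and>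
      ((\<lambda>w. H z w) has_field_derivative D2) (at w)" if v: "(z, w) \<in> N" for z w
  proof -
    have "z \<in> snd a ` fst a" "w \<in> snd b ` fst b" "(chart_inv a z, chart_inv b w) \<in> U"
      "f (chart_inv a z, chart_inv b w) \<in> fst r"
      using Na[OF v] Nb[OF v] NK[OF v] by (simp_all add: K_def)
    from F_chart_partials[OF F a(1) b(1) p(2) this] show ?thesis unfolding H_def by blast
  qed
  have evN: "eventually (\<lambda>v. v \<in> N) (nhds (z0, w0))" using N by (rule eventually_nhds_in_open)
  have hol1: "(\<lambda>w. H z0 w) analytic_on {w0}"
    by (rule analytic_atI, rule eventually_mono[OF eventually_nhds_slices(2)[OF evN]])
      (use part in \<open>auto simp: field_differentiable_def\<close>)
  have hol2: "(\<lambda>z. H z w0) analytic_on {z0}"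
    by (rule analytic_atI, rule eventually_mono[OF eventually_nhds_slices(1)[OF evN]])
      (use part in \<open>auto simp: field_differentiable_def\<close>)
  have "\<exists>G. G analytic_on {A (chart_inv a z0) + B (chart_inv b w0)} \<and>
    eventually (\<lambda>v. H (fst v) (snd v) = G (A (chart_inv a (fst v)) + B (chart_inv b (snd v)))) (nhds (z0, w0))"
  proof (rule first_integral[where N = N and H = H and A = "\<lambda>z. A (chart_inv a z)"
        and B = "\<lambda>z. B (chart_inv b z)" and \<alpha> = "\<omega> a" and \<beta> = "\<beta> b"])
    show "open N" "(z0, w0) \<in> N" by (fact N)+
    show "((\<lambda>z. A (chart_inv a z)) has_field_derivative \<omega> a z) (at z)" if "(z, w) \<in> N" for z w
      using NA[OF that] by simp
    show "((\<lambda>z. B (chart_inv b z)) has_field_derivative \<beta> b w) (at w)" if "(z, w) \<in> N" for z w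
      using NB[OF that] by simp
    show "\<omega> a z0 \<noteq> 0 \<or> \<beta> b w0 \<noteq> 0" using nz by (simp add: z0_def w0_def)
    show "(\<lambda>w. H z0 w) analytic_on {w0}" by (rule hol1)
    show "(\<lambda>z. H z w0) analytic_on {z0}" by (rule hol2)
    fix g1 g2 d1 d2 :: "complex \<Rightarrow> complex" and s t :: complex
    assume g: "\<And>t. t \<in> ball 0 1 \<Longrightarrow> (g1 has_field_derivative d1 t) (at t)"
      "\<And>t. t \<in> ball 0 1 \<Longrightarrow> (g2 has_field_derivative d2 t) (at t)"
      and gN: "\<And>t. t \<in> ball 0 1 \<Longrightarrow> (g1 t, g2 t) \<in> N"
      and gnz: "\<And>t. t \<in> ball 0 1 \<Longrightarrow> d1 t \<noteq> 0 \<or> d2 t \<noteq> 0"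
      and g0: "\<And>t. t \<in> ball 0 1 \<Longrightarrow> \<omega> a (g1 t) * d1 t + \<beta> b (g2 t) * d2 t = 0"
      and st: "s \<in> ball 0 1" "t \<in> ball 0 1"
    have "integral_disc CX \<F> U (\<lambda>t. (chart_inv a (g1 t), chart_inv b (g2 t)))"
    proof (rule integral_discI[OF a(1) b(1) g])
      fix t :: complex assume t: "t \<in> ball 0 1"
      show "g1 t \<in> snd a ` fst a" "g2 t \<in> snd b ` fst b"
        using Na[OF gN[OF t]] Nb[OF gN[OF t]] by simp_all
      show "(chart_inv a (g1 t), chart_inv b (g2 t)) \<in> U"
        using NK[OF gN[OF t]] by (simp add: K_def)
      show "d1 t \<noteq> 0 \<or> d2 t \<noteq> 0" by (rule gnz[OF t])
      show "chart_inv a (g1 t) \<notin> P \<and> \<omega> a (g1 t) * d1 t + \<beta> b (g2 t) * d2 t = 0 \<or>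
          chart_inv a (g1 t) \<in> P \<and> d1 t = 0"
        using NP[OF gN[OF t]] g0[OF t] by simp
    qed
    from F_chart_const_on_disc[OF F this st] show "H (g1 s) (g2 s) = H (g1 t) (g2 t)"
      by (simp add: H_def)
  qed
  then obtain G where Ga: "G analytic_on {separated A B p}"
    and G: "eventually (\<lambda>v. H (fst v) (snd v) = G (A (chart_inv a (fst v)) + B (chart_inv b (snd v)))) (nhds (z0, w0))"
    using K0 by (auto simp: K_def separated_def)
  have dG: "deriv G (separated A B p) \<noteq> 0"
  proof
    assume 0: "deriv G (separated A B p) = 0"
    obtain D1 D2 where D: "D1 \<noteq> 0 \<or> D2 \<noteq> 0" "((\<lambda>z. H z w0) has_field_derivative D1) (at z0)"
      "((\<lambda>w. H z0 w) has_field_derivative D2) (at w0)"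
      using part[OF N(2)] by blast
    have sp: "separated A B p = A (chart_inv a z0) + B (chart_inv b w0)"
      using K0 by (auto simp: K_def separated_def)
    have G0: "(G has_field_derivative 0) (at (A (chart_inv a z0) + B (chart_inv b w0)))"
      using analytic_has_deriv[OF Ga] 0 sp by simp
    have NA0: "((\<lambda>z. A (chart_inv a z)) has_field_derivative \<omega> a z0) (at z0)"
      and NB0: "((\<lambda>w. B (chart_inv b w)) has_field_derivative \<beta> b w0) (at w0)"
      using NA[OF N(2)] NB[OF N(2)] by simp_all
    have 1: "((\<lambda>z. G (A (chart_inv a z) + B (chart_inv b w0))) has_field_derivative 0 * (\<omega> a z0 + 0)) (at z0)"
      by (rule DERIV_chain2[OF G0 DERIV_add[OF NA0 DERIV_const]])
    have 2: "((\<lambda>w. G (A (chart_inv a z0) + B (chart_inv b w))) has_field_derivative 0 * (0 + \<beta> b w0)) (at w0)"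
      by (rule DERIV_chain2[OF G0 DERIV_add[OF DERIV_const NB0]])
    have "D1 = 0 * (\<omega> a z0 + 0)"
      by (rule DERIV_unique[OF DERIV_transfer_ev[OF D(2)] 1]) (use eventually_nhds_slices(1)[OF G] in simp)
    moreover have "D2 = 0 * (0 + \<beta> b w0)"
      by (rule DERIV_unique[OF DERIV_transfer_ev[OF D(3)] 2]) (use eventually_nhds_slices(2)[OF G] in simp)
    ultimately show False using D(1) by simp
  qed
  have "eventually (\<lambda>q. q \<in> U \<and> f q \<in> fst r \<and> snd r (f q) = G (separated A B q)) (nhds p)"
  proof -
    let ?J = "\<lambda>q. (snd a (fst q), snd b (snd q))"
    have J: "isCont ?J p"
      by (intro continuous_Pair isCont_fst_compose isCont_snd_compose isCont_chart[OF atlas_C a] isCont_chart[OF atlas_X b])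
    have "eventually (\<lambda>q. H (fst (?J q)) (snd (?J q)) =
        G (A (chart_inv a (fst (?J q))) + B (chart_inv b (snd (?J q))))) (nhds p)"
      by (rule eventually_nhds_compose[OF J]) (use G in \<open>simp add: z0_def w0_def\<close>)
    moreover have "eventually (\<lambda>q. q \<in> U \<and> f q \<in> fst r) (nhds p)"
      by (rule eventually_F_chart[OF F p])
    moreover have "eventually (\<lambda>q. fst q \<in> fst a) (nhds p)" "eventually (\<lambda>q. snd q \<in> fst b) (nhds p)"
      using eventually_nhds_fst[OF eventually_in_chart[OF atlas_C a], of "snd p"]
        eventually_nhds_snd[OF eventually_in_chart[OF atlas_X b], of "fst p"] by simp_all
    ultimately show ?thesis
      by eventually_elim
        (simp add: H_def separated_def chart_inv_left[OF atlas_C a(1)] chart_inv_left[OF atlas_X b(1)])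
  qed
  with Ga dG show ?thesis unfolding transverse_coordinate_def by blast
qed

end

lemma isCont_from_chart:
  fixes Q :: "'m::t2_space \<Rightarrow> complex"
  assumes A: "complex_atlas A" and c: "c \<in> A" "p \<in> fst c"
    and Q: "isCont (\<lambda>z. Q (chart_inv c z)) (snd c p)"
  shows "isCont Q p"
proof -
  have cont: "isCont (\<lambda>q. Q (chart_inv c (snd c q))) p"
    by (rule isCont_o2[OF isCont_chart[OF A c] Q])
  have ev: "eventually (\<lambda>q. Q (chart_inv c (snd c q)) = Q q) (nhds p)"
    using eventually_in_chart[OF A c] by eventually_elim (simp add: chart_inv_left[OF A c(1)])
  show ?thesis using cont isCont_cong[OF ev] by simp
qed

text \<open>The finitely many possible values are isolated, so by continuity \<open>h\<close> is
  locally constant. A submersive chart therefore cannot take finitely many values near a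
  point.\<close>

lemma finite_values_deriv_zero:
  fixes h :: "complex \<Rightarrow> complex"
  assumes h: "(h has_field_derivative D) (at z)" and S: "finite S" "eventually (\<lambda>w. h w \<in> S) (nhds z)"
  shows "D = 0"
proof -
  have "open (- (S - {h z}))" using S(1) by (intro open_Compl finite_imp_closed) auto
  then have "eventually (\<lambda>u. u \<in> - (S - {h z})) (nhds (h z))"
    by (rule eventually_nhds_in_open) simp
  from eventually_nhds_compose[OF DERIV_isCont[OF h] this] S(2)
  have "eventually (\<lambda>w. h w = h z) (nhds z)"
    by eventually_elim blast
  from DERIV_transfer_ev[OF h this] show ?thesis
    using DERIV_unique DERIV_const by blast
qed

lemma projective_F_atlasD:
  assumes "projective_F_atlas A F \<U>"
  shows "(U, f) \<in> \<U> \<Longrightarrow> F_chart A F (U, f)" and "\<exists>U f. (U, f) \<in> \<U> \<and> p \<in> U"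
    and "(U, f) \<in> \<U> \<Longrightarrow> (U', f') \<in> \<U> \<Longrightarrow> V \<in> components (U \<inter> U') \<Longrightarrow>
      \<exists>T. moebius T \<and> (\<forall>p\<in>V. f' p = T (f p))"
proof -
  have F: "F_atlas A F \<U>"
    and T: "\<forall>(U, f)\<in>\<U>. \<forall>(U', f')\<in>\<U>. \<forall>V\<in>components (U \<inter> U'). \<exists>T. moebius T \<and> (\<forall>p\<in>V. f' p = T (f p))"
    using assms unfolding projective_F_atlas_def by blast+
  show "(U, f) \<in> \<U> \<Longrightarrow> F_chart A F (U, f)" using F unfolding F_atlas_def by blast
  have "p \<in> (\<Union>u\<in>\<U>. fst u)" using F unfolding F_atlas_def by blast
  then obtain u where "u \<in> \<U>" "p \<in> fst u" by blast
  then show "\<exists>U f. (U, f) \<in> \<U> \<and> p \<in> U"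
    by (intro exI[of _ "fst u"] exI[of _ "snd u"]) simp
  assume U: "(U, f) \<in> \<U>" "(U', f') \<in> \<U>" "V \<in> components (U \<inter> U')"
  from bspec[OF bspec[OF bspec[OF T U(1), unfolded split_conv] U(2), unfolded split_conv] U(3)]
  show "\<exists>T. moebius T \<and> (\<forall>p\<in>V. f' p = T (f p))" .
qed

section \<open>The transverse Schwarzian\<close>

context foliated_product
begin

lemma product_connected_nhd:
  fixes p :: "'a \<times> 'b"
  assumes Q: "eventually Q (nhds p)"
  shows "\<exists>N. connected N \<and> p \<in> N \<and> (\<forall>q\<in>N. Q q) \<and> eventually (\<lambda>q. q \<in> N) (nhds p)"
proof -
  obtain a b where a: "a \<in> C" "fst p \<in> fst a" and b: "b \<in> X" "snd p \<in> fst b"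
    using chart_C chart_X by metis
  obtain Pf Pg where Pfg: "eventually Pf (nhds (fst p))" "eventually Pg (nhds (snd p))"
    "\<And>x y. Pf x \<Longrightarrow> Pg y \<Longrightarrow> Q (x, y)"
    using Q eventually_nhds_prod[of Q "fst p" "snd p"] by auto
  obtain N1 where N1: "connected N1" "fst p \<in> N1" "\<forall>q\<in>N1. Pf q"
    "eventually (\<lambda>q. q \<in> N1) (nhds (fst p))"
    using riemann_surface_connected_nhd[OF atlas_C a Pfg(1)] by blast
  obtain N2 where N2: "connected N2" "snd p \<in> N2" "\<forall>q\<in>N2. Pg q"
    "eventually (\<lambda>q. q \<in> N2) (nhds (snd p))"
    using riemann_surface_connected_nhd[OF atlas_X b Pfg(2)] by blast
  have "connected (N1 \<times> N2)" using N1(1) N2(1) by (rule connected_Times)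
  moreover have "p \<in> N1 \<times> N2" using N1(2) N2(2) by (simp add: mem_Times_iff)
  moreover have "\<forall>q\<in>N1 \<times> N2. Q q" using N1(3) N2(3) Pfg(3) by auto
  moreover have "eventually (\<lambda>q. q \<in> N1 \<times> N2) (nhds p)"
    using eventually_conj[OF eventually_nhds_fst[OF N1(4), of "snd p"] eventually_nhds_snd[OF N2(4), of "fst p"]]
    by (simp add: mem_Times_iff)
  ultimately show ?thesis by blast
qed

text \<open>The atlas provides one map for each component of the overlap, and a connected
  neighbourhood of \<open>p\<close> lies in a single component.\<close>

lemma projective_atlas_local_moebius:
  assumes \<U>: "projective_F_atlas CX \<F> \<U>" and U: "(U, f) \<in> \<U>" "(U', f') \<in> \<U>"
    and p: "p \<in> U" "p \<in> U'"
  shows "\<exists>T. moebius T \<and> eventually (\<lambda>q. f' q = T (f q)) (nhds p)"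
proof -
  have "open U" "open U'"
    using projective_F_atlasD(1)[OF \<U> U(1)] projective_F_atlasD(1)[OF \<U> U(2)]
    unfolding F_chart_def by auto
  then have ev: "eventually (\<lambda>q. q \<in> U \<inter> U') (nhds p)"
    using p by (intro eventually_nhds_in_open open_Int) auto
  obtain N where N: "connected N" "p \<in> N" "\<forall>q\<in>N. q \<in> U \<inter> U'" "eventually (\<lambda>q. q \<in> N) (nhds p)"
    using product_connected_nhd[OF ev] by blast
  define V where "V = connected_component_set (U \<inter> U') p"
  have V: "V \<in> components (U \<inter> U')" unfolding V_def using p by (intro componentsI) auto
  obtain T where T: "moebius T" "\<forall>p\<in>V. f' p = T (f p)"
    using projective_F_atlasD(3)[OF \<U> U V] by blast
  have "N \<subseteq> V"
    unfolding V_def using N(1-3) by (intro connected_component_maximal) auto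
  with N(4) have "eventually (\<lambda>q. q \<in> V) (nhds p)" by (auto elim!: eventually_mono)
  then have "eventually (\<lambda>q. f' q = T (f q)) (nhds p)"
    by eventually_elim (rule bspec[OF T(2)])
  with T(1) show ?thesis by blast
qed

text \<open>The chart, the affine coordinate and the primitives are all left free; the Schwarzian of
  \<open>G\<close> will not see these choices.\<close>

definition atlas_coordinate ::
    "(('a \<times> 'b) set \<times> ('a \<times> 'b \<Rightarrow> cp1)) set \<Rightarrow> ('a \<Rightarrow> complex) \<Rightarrow> ('b \<Rightarrow> complex) \<Rightarrow>
     (complex \<Rightarrow> complex) \<Rightarrow> 'a \<times> 'b \<Rightarrow> bool" where
  "atlas_coordinate \<U> A B G p \<longleftrightarrow> primitives A B p \<and>
     (\<exists>U f r. (U, f) \<in> \<U> \<and> r \<in> cp1_atlas \<and> transverse_coordinate U f r (separated A B) G p)"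

lemma eventually_atlas_coordinate:
  assumes "atlas_coordinate \<U> A B G p"
  shows "eventually (atlas_coordinate \<U> A B G) (nhds p)"
proof -
  obtain U f r where t: "primitives A B p" "(U, f) \<in> \<U>" "r \<in> cp1_atlas"
    "transverse_coordinate U f r (separated A B) G p"
    using assms unfolding atlas_coordinate_def by blast
  from eventually_primitives[OF t(1)] eventually_transverse_coordinate[OF t(4) isCont_separated[OF t(1)]]
  show ?thesis unfolding atlas_coordinate_def by eventually_elim (use t in blast)
qed

lemma exists_atlas_coordinate:
  assumes \<U>: "projective_F_atlas CX \<F> \<U>" and reg: "regular p" and pr: "primitives A B p"
  shows "\<exists>G. atlas_coordinate \<U> A B G p"
proof -
  obtain U f where U: "(U, f) \<in> \<U>" "p \<in> U" using projective_F_atlasD(2)[OF \<U>] by blast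
  obtain r where r: "r \<in> cp1_atlas" "f p \<in> fst r" using cp1_atlas_cover by blast
  show ?thesis
    using exists_transverse_coordinate[OF projective_F_atlasD(1)[OF \<U> U(1)] U(2) r reg pr] U r pr
    unfolding atlas_coordinate_def by blast
qed

lemma atlas_coordinate_analytic:
  assumes "atlas_coordinate \<U> A B G p"
  shows "schwarzian G analytic_on {separated A B p}"
proof -
  obtain U f r where "transverse_coordinate U f r (separated A B) G p"
    using assms unfolding atlas_coordinate_def by blast
  note t = transverse_coordinateD[OF this]
  show ?thesis by (rule analytic_schwarzian[OF t(1,2)])
qed

text \<open>Another chart of the atlas or another affine coordinate changes \<open>G\<close> by a
  Moebius map on the left, and other primitives translate its argument. Both leave the Schwarzian
  unchanged; openness of \<open>u\<close> turns the relation between charts into one in the variable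
  of \<open>G\<close>.\<close>

lemma atlas_coordinate_unique:
  assumes \<U>: "projective_F_atlas CX \<F> \<U>" and reg: "regular p"
    and G: "atlas_coordinate \<U> A B G p" and G': "atlas_coordinate \<U> A' B' G' p"
  shows "schwarzian G (separated A B p) = schwarzian G' (separated A' B' p)"
proof -
  let ?u = "separated A B" and ?u' = "separated A' B'"
  obtain U f r where pr: "primitives A B p" and U: "(U, f) \<in> \<U>" and r: "r \<in> cp1_atlas"
    and t: "transverse_coordinate U f r ?u G p"
    using G unfolding atlas_coordinate_def by blast
  obtain U' f' r' where pr': "primitives A' B' p" and U': "(U', f') \<in> \<U>" and r': "r' \<in> cp1_atlas"
    and t': "transverse_coordinate U' f' r' ?u' G' p"
    using G' unfolding atlas_coordinate_def by blast
  note tD = transverse_coordinateD[OF t] and tD' = transverse_coordinateD[OF t']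
  obtain a b where a: "a \<in> C" "fst p \<in> fst a" and b: "b \<in> X" "snd p \<in> fst b"
    using chart_C chart_X by metis
  obtain k1 where k1: "eventually (\<lambda>q. A' q = A q + k1) (nhds (fst p))"
    using primitive_unique[OF atlas_C comp_\<omega> _ _ a] pr pr' unfolding primitives_def by blast
  obtain k2 where k2: "eventually (\<lambda>q. B' q = B q + k2) (nhds (snd p))"
    using primitive_unique[OF atlas_X comp_\<beta> _ _ b] pr pr' unfolding primitives_def by blast
  define k where "k = k1 + k2"
  have u': "eventually (\<lambda>q. ?u' q = ?u q + k) (nhds p)"
    using eventually_nhds_fst[OF k1, of "snd p"] eventually_nhds_snd[OF k2, of "fst p"]
    unfolding prod.collapse by eventually_elim (simp add: separated_def k_def)
  note up = eventually_nhds_x_imp_x[OF u']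
  have "p \<in> U" "p \<in> U'"
    using eventually_nhds_x_imp_x[OF tD(3)] eventually_nhds_x_imp_x[OF tD'(3)] by auto
  then obtain T where T: "moebius T" "eventually (\<lambda>q. f' q = T (f q)) (nhds p)"
    using projective_atlas_local_moebius[OF \<U> U U'] by blast
  obtain m1 m2 m3 m4 where det: "m1 * m4 - m2 * m3 \<noteq> 0"
    and m: "\<forall>y\<in>fst r. \<forall>y'\<in>fst r'. y' = T y \<longleftrightarrow> snd r' y' * (m3 * snd r y + m4) = m1 * snd r y + m2"
    using moebius_in_charts[OF r r' T(1)] by blast
  have "eventually (\<lambda>q. G' (?u q + k) * (m3 * G (?u q) + m4) = m1 * G (?u q) + m2) (nhds p)"
    using tD(3) tD'(3) T(2) u'
  proof eventually_elim
    case (elim q)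
    have "snd r' (f' q) * (m3 * snd r (f q) + m4) = m1 * snd r (f q) + m2"
      using bspec[OF bspec[OF m, of "f q"], of "f' q"] elim by blast
    then show ?case using elim by simp
  qed
  then have "eventually (\<lambda>s. G' (s + k) * (m3 * G s + m4) = m1 * G s + m2) (nhds (?u p))"
    by (rule eventually_separated_open[OF reg pr])
  from schwarzian_moebius_related[OF tD(1,2) det this]
  have "schwarzian G (?u p) = schwarzian (\<lambda>s. G' (s + k)) (?u p)" by simp
  also have "\<dots> = schwarzian G' (?u p + k) * (deriv (\<lambda>s. s + k) (?u p))\<^sup>2 + schwarzian (\<lambda>s. s + k) (?u p)"
  proof (rule schwarzian_compose)
    have "deriv (\<lambda>s. s + k) (?u p) = 1" by (rule DERIV_imp_deriv) (auto intro!: derivative_eq_intros)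
    then show "deriv (\<lambda>s. s + k) (?u p) \<noteq> 0" by simp
  qed (use tD'(1,2) up in \<open>auto intro!: analytic_intros\<close>)
  also have "deriv (\<lambda>s. s + k) (?u p) = 1" by (rule DERIV_imp_deriv) (auto intro!: derivative_eq_intros)
  finally show ?thesis using up by (simp add: schwarzian_affine)
qed

text \<open>Primitives of \<open>\<omega>\<close> and \<open>\<beta>\<close> are unique up to constants, so the Schwarzian in the coordinate
  \<open>\<integral>\<omega> + \<integral>\<beta>\<close> is a function on the product, not merely a quadratic differential.\<close>

definition transverse_schwarzian ::
    "(('a \<times> 'b) set \<times> ('a \<times> 'b \<Rightarrow> cp1)) set \<Rightarrow> 'a \<times> 'b \<Rightarrow> complex" where
  "transverse_schwarzian \<U> p =
     (SOME v. \<exists>A B G. atlas_coordinate \<U> A B G p \<and> v = schwarzian G (separated A B p))"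

lemma transverse_schwarzian_eq:
  assumes \<U>: "projective_F_atlas CX \<F> \<U>" and reg: "regular p" and G: "atlas_coordinate \<U> A B G p"
  shows "transverse_schwarzian \<U> p = schwarzian G (separated A B p)"
  unfolding transverse_schwarzian_def
proof (rule some_equality)
  show "\<exists>A' B' G'. atlas_coordinate \<U> A' B' G' p \<and>
      schwarzian G (separated A B p) = schwarzian G' (separated A' B' p)"
    using G by blast
  fix v assume "\<exists>A B G. atlas_coordinate \<U> A B G p \<and> v = schwarzian G (separated A B p)"
  then obtain A' B' G' where "atlas_coordinate \<U> A' B' G' p" "v = schwarzian G' (separated A' B' p)"
    by blast
  then show "v = schwarzian G (separated A B p)"
    using atlas_coordinate_unique[OF \<U> reg G] by simp
qed

text \<open>The same \<open>G\<close> serves all nearby points, so the function chosen pointwise by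
  \<open>SOME\<close> is locally the analytic function \<open>schwarzian G\<close> of
  \<open>u\<close>.\<close>

lemma eventually_transverse_schwarzian_eq:
  assumes \<U>: "projective_F_atlas CX \<F> \<U>" and G: "atlas_coordinate \<U> A B G p"
  shows "eventually (\<lambda>q. regular q \<longrightarrow> transverse_schwarzian \<U> q = schwarzian G (separated A B q)) (nhds p)"
  using eventually_atlas_coordinate[OF G]
  by eventually_elim (blast intro: transverse_schwarzian_eq[OF \<U>])

text \<open>Since \<omega> is nonzero at \<open>c\<close>, the whole fibre over \<open>c\<close> is
  regular, including any point where \<beta> vanishes.\<close>

lemma transverse_schwarzian_analytic_snd:
  assumes \<U>: "projective_F_atlas CX \<F> \<U>" and c: "c \<notin> P" "c \<notin> Y" and b: "b \<in> X" "w \<in> fst b"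
  shows "(\<lambda>z. transverse_schwarzian \<U> (c, chart_inv b z)) analytic_on {snd b w}"
proof -
  let ?p = "(c, w)"
  obtain A B where pr: "primitives A B ?p" using exists_primitives[of ?p] c by auto
  obtain G where G: "atlas_coordinate \<U> A B G ?p"
    using exists_atlas_coordinate[OF \<U> regular_off_zeros[OF c] pr] by blast
  have "eventually (\<lambda>w'. transverse_schwarzian \<U> (c, w') = schwarzian G (A c + B w')) (nhds w)"
    using eventually_nhds_slices(2)[OF eventually_transverse_schwarzian_eq[OF \<U> G]]
    by eventually_elim (simp add: regular_off_zeros[OF c] separated_def)
  then have ev: "eventually (\<lambda>z. transverse_schwarzian \<U> (c, chart_inv b z) =
      schwarzian G (A c + B (chart_inv b z))) (nhds (snd b w))"
    by (rule eventually_nhds_chart[OF atlas_X b, THEN iffD1])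
  have "(\<lambda>z. B (chart_inv b z)) analytic_on {snd b w}"
    using primitive_analytic(1)[OF atlas_X comp_\<beta> _ b] pr unfolding primitives_def by simp
  then have "(\<lambda>z. A c + B (chart_inv b z)) analytic_on {snd b w}" by (intro analytic_intros)
  then have "(\<lambda>z. schwarzian G (A c + B (chart_inv b z))) analytic_on {snd b w}"
    by (rule analytic_compose_at)
      (use atlas_coordinate_analytic[OF G] in \<open>simp add: separated_def chart_inv_left[OF atlas_X b]\<close>)
  then show ?thesis using analytic_at_cong[OF ev refl] by simp
qed

text \<open>Since \<beta> is nonzero at \<open>w\<^sub>0\<close>, the slice is regular at every
  point off \<open>P\<close>, the zeros of \<omega> included.\<close>

lemma transverse_schwarzian_analytic_fst:
  assumes \<U>: "projective_F_atlas CX \<F> \<U>" and c: "c \<notin> P" and a: "a \<in> C" "c \<in> fst a"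
  shows "(\<lambda>z. transverse_schwarzian \<U> (chart_inv a z, w\<^sub>0)) analytic_on {snd a c}"
proof -
  let ?p = "(c, w\<^sub>0)"
  obtain A B where pr: "primitives A B ?p" using exists_primitives[of ?p] c by auto
  obtain G where G: "atlas_coordinate \<U> A B G ?p"
    using exists_atlas_coordinate[OF \<U> regular_base[OF c] pr] by blast
  have "eventually (\<lambda>c'. transverse_schwarzian \<U> (c', w\<^sub>0) = schwarzian G (A c' + B w\<^sub>0)) (nhds c)"
    using eventually_nhds_slices(1)[OF eventually_transverse_schwarzian_eq[OF \<U> G]] eventually_notin_P'[OF c]
    by eventually_elim (simp add: regular_base separated_def)
  then have ev: "eventually (\<lambda>z. transverse_schwarzian \<U> (chart_inv a z, w\<^sub>0) =
      schwarzian G (A (chart_inv a z) + B w\<^sub>0)) (nhds (snd a c))"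
    by (rule eventually_nhds_chart[OF atlas_C a, THEN iffD1])
  have "(\<lambda>z. A (chart_inv a z)) analytic_on {snd a c}"
    using primitive_analytic(1)[OF atlas_C comp_\<omega> _ a] pr unfolding primitives_def by simp
  then have "(\<lambda>z. A (chart_inv a z) + B w\<^sub>0) analytic_on {snd a c}" by (intro analytic_intros)
  then have "(\<lambda>z. schwarzian G (A (chart_inv a z) + B w\<^sub>0)) analytic_on {snd a c}"
    by (rule analytic_compose_at)
      (use atlas_coordinate_analytic[OF G] in \<open>simp add: separated_def chart_inv_left[OF atlas_C a]\<close>)
  then show ?thesis using analytic_at_cong[OF ev refl] by simp
qed

lemma transverse_schwarzian_constant_snd:
  assumes \<U>: "projective_F_atlas CX \<F> \<U>" and c: "c \<notin> P" "c \<notin> Y"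
  shows "transverse_schwarzian \<U> (c, w) = transverse_schwarzian \<U> (c, w\<^sub>0)"
proof -
  have an: "\<exists>b\<in>X. w \<in> fst b \<and> (\<lambda>z. transverse_schwarzian \<U> (c, chart_inv b z)) analytic_on {snd b w}" for w
    using chart_X[of w] transverse_schwarzian_analytic_snd[OF \<U> c] by blast
  have "\<exists>k. \<forall>w. transverse_schwarzian \<U> (c, w) = k"
  proof (rule maximum_principle_compact[OF atlas_X compact_X connected_X])
    fix w
    obtain b where b: "b \<in> X" "w \<in> fst b"
      "(\<lambda>z. transverse_schwarzian \<U> (c, chart_inv b z)) analytic_on {snd b w}"
      using an by blast
    show "isCont (\<lambda>w. transverse_schwarzian \<U> (c, w)) w"
      by (rule isCont_from_chart[OF atlas_X b(1,2) analytic_at_imp_isCont[OF b(3)]])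
  qed (rule an)
  then obtain k where "\<forall>w. transverse_schwarzian \<U> (c, w) = k" ..
  then show ?thesis by simp
qed

text \<open>At a pole the vertical fibre is a leaf, so the slice \<open>w = w\<^sub>0\<close> is transverse to the foliation
  there and its Schwarzian stays bounded.\<close>

lemma pole_slice:
  assumes \<U>: "projective_F_atlas CX \<F> \<U>" and x: "x \<in> P" and a: "a \<in> C" "x \<in> fst a"
  obtains h where "h analytic_on {snd a x}" "deriv h (snd a x) \<noteq> 0"
    "eventually (\<lambda>z. z \<noteq> snd a x \<longrightarrow> (\<forall>A B. primitives A B (chart_inv a z, w\<^sub>0) \<longrightarrow>
       schwarzian h z = transverse_schwarzian \<U> (chart_inv a z, w\<^sub>0) * (\<omega> a z)\<^sup>2 +
         schwarzian (\<lambda>z. A (chart_inv a z) + B w\<^sub>0) z)) (nhds (snd a x))"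
proof -
  obtain U f where U: "(U, f) \<in> \<U>" "(x, w\<^sub>0) \<in> U" using projective_F_atlasD(2)[OF \<U>] by blast
  note F = projective_F_atlasD(1)[OF \<U> U(1)]
  obtain r where r: "r \<in> cp1_atlas" "f (x, w\<^sub>0) \<in> fst r" using cp1_atlas_cover by blast
  define h where "h z = snd r (f (chart_inv a z, w\<^sub>0))" for z
  have invx: "chart_inv a (snd a x) = x" by (rule chart_inv_left[OF atlas_C a])
  have invw: "chart_inv b\<^sub>0 (snd b\<^sub>0 w\<^sub>0) = w\<^sub>0" by (rule chart_inv_left[OF atlas_X b\<^sub>0])
  have bw: "snd b\<^sub>0 w\<^sub>0 \<in> snd b\<^sub>0 ` fst b\<^sub>0" using b\<^sub>0(2) by blast
  have ax: "snd a x \<in> snd a ` fst a" using a(2) by blast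
  have ev: "eventually (\<lambda>q. q \<in> U \<and> f q \<in> fst r) (nhds (x, w\<^sub>0))"
    by (rule eventually_F_chart[OF F U(2) r])
  have evz: "eventually (\<lambda>z. (chart_inv a z, w\<^sub>0) \<in> U \<and> f (chart_inv a z, w\<^sub>0) \<in> fst r) (nhds (snd a x))"
    by (rule eventually_nhds_chart[OF atlas_C a, THEN iffD1]) (rule eventually_nhds_slices(1)[OF ev])
  have evw: "eventually (\<lambda>w. (x, chart_inv b\<^sub>0 w) \<in> U \<and> f (x, chart_inv b\<^sub>0 w) \<in> fst r) (nhds (snd b\<^sub>0 w\<^sub>0))"
    by (rule eventually_nhds_chart[OF atlas_X b\<^sub>0, THEN iffD1]) (rule eventually_nhds_slices(2)[OF ev])
  have han: "h analytic_on {snd a x}"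
  proof (rule analytic_atI)
    show "eventually (\<lambda>z. h field_differentiable at z) (nhds (snd a x))"
      using evz eventually_in_chart_image[OF atlas_C a]
    proof eventually_elim
      case (elim z)
      obtain D1 D2 where "((\<lambda>z. snd r (f (chart_inv a z, chart_inv b\<^sub>0 (snd b\<^sub>0 w\<^sub>0)))) has_field_derivative D1) (at z)"
        using F_chart_partials[OF F a(1) b\<^sub>0(1) r(1) elim(2) bw] elim(1) unfolding invw by blast
      then show ?case unfolding invw h_def[symmetric] field_differentiable_def by blast
    qed
  qed
  have dh: "deriv h (snd a x) \<noteq> 0"
  proof -
    obtain D1 D2 where D: "D1 \<noteq> 0 \<or> D2 \<noteq> 0"
      "((\<lambda>z. snd r (f (chart_inv a z, chart_inv b\<^sub>0 (snd b\<^sub>0 w\<^sub>0)))) has_field_derivative D1) (at (snd a x))"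
      "((\<lambda>w. snd r (f (chart_inv a (snd a x), chart_inv b\<^sub>0 w))) has_field_derivative D2) (at (snd b\<^sub>0 w\<^sub>0))"
      using F_chart_partials[OF F a(1) b\<^sub>0(1) r(1) ax bw] U(2) r(2) unfolding invx invw by blast
    obtain e where e: "e > 0" "\<And>w. w \<in> ball (snd b\<^sub>0 w\<^sub>0) e \<Longrightarrow> (x, chart_inv b\<^sub>0 w) \<in> U"
      "\<And>w. w \<in> ball (snd b\<^sub>0 w\<^sub>0) e \<Longrightarrow> w \<in> snd b\<^sub>0 ` fst b\<^sub>0"
      using eventually_conj[OF evw eventually_in_chart_image[OF atlas_X b\<^sub>0]]
      unfolding eventually_nhds_ball by blast
    \<comment> \<open>This parametrizes a disc inside the fibre over the pole \<open>x\<close>,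
      which is tangent to the foliation because vertical vectors over \<open>P\<close> belong to
      it.\<close>
    define g where "g t = snd b\<^sub>0 w\<^sub>0 + of_real e * t" for t :: complex
    have g: "g t \<in> ball (snd b\<^sub>0 w\<^sub>0) e" if "t \<in> ball 0 1" for t
      using that e(1) by (auto simp: g_def dist_norm norm_mult)
    have "integral_disc CX \<F> U (\<lambda>t. (chart_inv a (snd a x), chart_inv b\<^sub>0 (g t)))"
    proof (rule integral_discI[OF a(1) b\<^sub>0(1), where ?g1.0 = "\<lambda>_. snd a x" and ?d1.0 = "\<lambda>_. 0" and ?d2.0 = "\<lambda>_. of_real e"])
      fix t :: complex assume t: "t \<in> ball 0 1"
      show "((\<lambda>_. snd a x) has_field_derivative 0) (at t)" by simp
      show "(g has_field_derivative of_real e) (at t)"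
        unfolding g_def by (auto intro!: derivative_eq_intros)
      show "snd a x \<in> snd a ` fst a" by (rule ax)
      show "g t \<in> snd b\<^sub>0 ` fst b\<^sub>0" by (rule e(3)[OF g[OF t]])
      show "(chart_inv a (snd a x), chart_inv b\<^sub>0 (g t)) \<in> U" unfolding invx by (rule e(2)[OF g[OF t]])
      show "(0 :: complex) \<noteq> 0 \<or> complex_of_real e \<noteq> 0" using e(1) by simp
      show "chart_inv a (snd a x) \<notin> P \<and> \<omega> a (snd a x) * 0 + \<beta> b\<^sub>0 (g t) * complex_of_real e = 0 \<or>
          chart_inv a (snd a x) \<in> P \<and> (0 :: complex) = 0" using x invx by simp
    qed
    note disc = F_chart_const_on_disc[OF F this]
    have "f (x, chart_inv b\<^sub>0 w) = f (x, w\<^sub>0)" if w: "w \<in> ball (snd b\<^sub>0 w\<^sub>0) e" for w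
    proof -
      have "(w - snd b\<^sub>0 w\<^sub>0) / of_real e \<in> ball 0 1"
        using w e(1) by (simp add: dist_norm norm_divide norm_minus_commute)
      from disc[OF this, of 0] have "f (x, chart_inv b\<^sub>0 (g ((w - snd b\<^sub>0 w\<^sub>0) / of_real e))) = f (x, chart_inv b\<^sub>0 (g 0))"
        by (simp add: invx)
      then show ?thesis using e(1) by (simp add: g_def invw)
    qed
    then have "eventually (\<lambda>w. snd r (f (chart_inv a (snd a x), chart_inv b\<^sub>0 w)) \<in> {snd r (f (x, w\<^sub>0))}) (nhds (snd b\<^sub>0 w\<^sub>0))"
      unfolding eventually_nhds_ball invx using e(1) by (intro exI[of _ e]) auto
    \<comment> \<open>The chart does not vary along the fibre, so its submersivity must come from
      the \<open>z\<close>-direction.\<close>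
    then have "D2 = 0" by (rule finite_values_deriv_zero[OF D(3), rotated]) simp
    with D(1) have "D1 \<noteq> 0" by simp
    moreover have "deriv h (snd a x) = D1"
      using D(2) unfolding invw h_def[abs_def, symmetric] h_def[symmetric] by (rule DERIV_imp_deriv)
    ultimately show ?thesis by simp
  qed
  \<comment> \<open>All other poles and zeros are kept away, so that \<omega> is finite and nonzero
    near \<open>x\<close> except at \<open>x\<close>.\<close>
  have "finite ((P \<union> Y) - {x})" using finite_P finite_Y by blast
  then have "open (- ((P \<union> Y) - {x}))" by (intro open_Compl finite_imp_closed)
  then have "eventually (\<lambda>c. c \<in> - ((P \<union> Y) - {x})) (nhds x)" by (rule eventually_nhds_in_open) simp
  then have evPY: "eventually (\<lambda>z. chart_inv a z \<in> - ((P \<union> Y) - {x})) (nhds (snd a x))"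
    by (rule eventually_nhds_chart[OF atlas_C a, THEN iffD1])
  have "eventually (\<lambda>z. z \<noteq> snd a x \<longrightarrow> (\<forall>A B. primitives A B (chart_inv a z, w\<^sub>0) \<longrightarrow>
       schwarzian h z = transverse_schwarzian \<U> (chart_inv a z, w\<^sub>0) * (\<omega> a z)\<^sup>2 +
         schwarzian (\<lambda>z. A (chart_inv a z) + B w\<^sub>0) z)) (nhds (snd a x))"
    using evz eventually_in_chart_image[OF atlas_C a] evPY
  proof eventually_elim
    case (elim z)
    show ?case
    proof (intro impI allI)
      fix A B assume z: "z \<noteq> snd a x" and pr: "primitives A B (chart_inv a z, w\<^sub>0)"
      define c where "c = chart_inv a z"
      have c: "c \<in> fst a" "snd a c = z"
        using chart_inv_in[OF atlas_C a(1) elim(2)] chart_inv_right[OF atlas_C a(1) elim(2)] by (simp_all add: c_def)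
      have "c \<noteq> x" using z c(2) by auto
      with elim(3) have cPY: "c \<notin> P" "c \<notin> Y" unfolding c_def by auto
      have \<omega>z: "\<omega> a z \<noteq> 0" using \<omega>_nonzero[OF a(1) c(1) cPY] c(2) by simp
      note pr' = pr[folded c_def]
      have reg: "regular (c, w\<^sub>0)" by (rule regular_base[OF cPY(1)])
      obtain G where G: "transverse_coordinate U f r (separated A B) G (c, w\<^sub>0)"
        using exists_transverse_coordinate[OF F _ r(1) _ reg pr'] elim(1) unfolding c_def by blast
      note GD = transverse_coordinateD[OF G]
      have "atlas_coordinate \<U> A B G (c, w\<^sub>0)"
        unfolding atlas_coordinate_def using pr' U(1) r(1) G by blast
      note TS = transverse_schwarzian_eq[OF \<U> reg this]
      \<comment> \<open>This is \<open>u\<close> along the slice, with derivative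
        \<open>\<omega> a z\<close>; locally \<open>h\<close> is \<open>G\<close> of it, and the
        chain rule yields the formula.\<close>
      let ?g = "\<lambda>z. A (chart_inv a z) + B w\<^sub>0"
      have Ac: "is_primitive C \<omega> A c" using pr' unfolding primitives_def by simp
      note pA = primitive_analytic[OF atlas_C comp_\<omega> Ac a(1) c(1), unfolded c(2)]
      have ga: "?g analytic_on {z}" using pA(1) by (intro analytic_intros)
      have "deriv ?g z = deriv (\<lambda>z. A (chart_inv a z)) z + 0"
        by (rule DERIV_imp_deriv) (rule DERIV_add[OF analytic_has_deriv[OF pA(1)] DERIV_const])
      then have dg: "deriv ?g z = \<omega> a z" by (simp add: pA(2))
      have gz: "?g z = separated A B (c, w\<^sub>0)" by (simp add: separated_def c_def)
      have "eventually (\<lambda>c'. snd r (f (c', w\<^sub>0)) = G (A c' + B w\<^sub>0)) (nhds c)"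
        using eventually_nhds_slices(1)[OF GD(3)] by eventually_elim (simp add: separated_def)
      then have "eventually (\<lambda>z. h z = G (?g z)) (nhds z)"
        unfolding h_def using eventually_nhds_chart[OF atlas_C a(1) c(1), unfolded c(2),
          of "\<lambda>c'. snd r (f (c', w\<^sub>0)) = G (A c' + B w\<^sub>0)"] by simp
      then have "schwarzian h z = schwarzian (\<lambda>z. G (?g z)) z" by (rule schwarzian_cong)
      also have "\<dots> = schwarzian G (?g z) * (deriv ?g z)\<^sup>2 + schwarzian ?g z"
        by (rule schwarzian_compose[OF ga]) (use GD(1,2) gz dg \<omega>z in simp_all)
      finally show "schwarzian h z = transverse_schwarzian \<U> (chart_inv a z, w\<^sub>0) * (\<omega> a z)\<^sup>2 +
         schwarzian (\<lambda>z. A (chart_inv a z) + B w\<^sub>0) z"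
        unfolding dg gz TS[symmetric] unfolding c_def .
    qed
  qed
  with han dh show ?thesis using that by blast
qed

text \<open>The Schwarzian of \<open>u\<close> along the slice depends on the primitives but not on
  the atlas, so with common primitives it cancels. What remains is
  \<open>(schwarzian k z - schwarzian h z) / (\<omega> a z)^2\<close>, with bounded numerator and
  \<omega> tending to infinity.\<close>

lemma transverse_schwarzian_difference_at_pole:
  assumes \<U>: "projective_F_atlas CX \<F> \<U>" and \<V>: "projective_F_atlas CX \<F> \<V>"
    and x: "x \<in> P" and a: "a \<in> C" "x \<in> fst a"
  shows "((\<lambda>z. transverse_schwarzian \<V> (chart_inv a z, w\<^sub>0) - transverse_schwarzian \<U> (chart_inv a z, w\<^sub>0))
    \<longlongrightarrow> 0) (at (snd a x))"
proof -
  let ?E = "\<lambda>\<W> h z. z \<noteq> snd a x \<longrightarrow> (\<forall>A B. primitives A B (chart_inv a z, w\<^sub>0) \<longrightarrow>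
       schwarzian h z = transverse_schwarzian \<W> (chart_inv a z, w\<^sub>0) * (\<omega> a z)\<^sup>2 +
         schwarzian (\<lambda>z. A (chart_inv a z) + B w\<^sub>0) z)"
  obtain h where h: "h analytic_on {snd a x}" "deriv h (snd a x) \<noteq> 0" "eventually (?E \<U> h) (nhds (snd a x))"
    by (rule pole_slice[OF \<U> x a])
  obtain k where k: "k analytic_on {snd a x}" "deriv k (snd a x) \<noteq> 0" "eventually (?E \<V> k) (nhds (snd a x))"
    by (rule pole_slice[OF \<V> x a])
  have lim0: "((\<lambda>z. inverse (\<omega> a z)) \<longlongrightarrow> 0) (at (snd a x))"
    using filterlim_compose[OF tendsto_inverse_0, of "\<omega> a" "at (snd a x)"] \<omega>_pole[OF a x]
    unfolding is_pole_def .
  have "isCont (schwarzian h) (snd a x)" "isCont (schwarzian k) (snd a x)"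
    by (intro analytic_at_imp_isCont analytic_schwarzian h k)+
  then have "((\<lambda>z. (schwarzian k z - schwarzian h z) * (inverse (\<omega> a z))\<^sup>2) \<longlongrightarrow>
      (schwarzian k (snd a x) - schwarzian h (snd a x)) * 0\<^sup>2) (at (snd a x))"
    unfolding isCont_def by (intro tendsto_intros lim0)
  then have lim: "((\<lambda>z. (schwarzian k z - schwarzian h z) * (inverse (\<omega> a z))\<^sup>2) \<longlongrightarrow> 0) (at (snd a x))"
    by simp
  have evP: "eventually (\<lambda>z. chart_inv a z \<notin> P - {x}) (nhds (snd a x))"
    by (rule eventually_nhds_chart[OF atlas_C a, THEN iffD1]) (rule eventually_notin_P)
  have "eventually (\<lambda>z. \<omega> a z \<noteq> 0) (at (snd a x))"
    using non_zero_neighbour_pole[OF \<omega>_pole[OF a x]] .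
  then have "eventually (\<lambda>z. z \<noteq> snd a x \<longrightarrow> \<omega> a z \<noteq> 0) (nhds (snd a x))"
    by (simp add: eventually_at_filter)
  then have "eventually (\<lambda>z. z \<noteq> snd a x \<longrightarrow> (schwarzian k z - schwarzian h z) * (inverse (\<omega> a z))\<^sup>2 =
      transverse_schwarzian \<V> (chart_inv a z, w\<^sub>0) - transverse_schwarzian \<U> (chart_inv a z, w\<^sub>0)) (nhds (snd a x))"
    using h(3) k(3) evP eventually_in_chart_image[OF atlas_C a]
  proof eventually_elim
    case (elim z)
    show ?case
    proof
      assume z: "z \<noteq> snd a x"
      then have "chart_inv a z \<noteq> x" using chart_inv_right[OF atlas_C a(1) elim(5)] by auto
      with elim(4) have "chart_inv a z \<notin> P" by blast
      then obtain A B where "primitives A B (chart_inv a z, w\<^sub>0)"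
        using exists_primitives[of "(chart_inv a z, w\<^sub>0)"] by auto
      with elim(2,3) z have e: "schwarzian h z = transverse_schwarzian \<U> (chart_inv a z, w\<^sub>0) * (\<omega> a z)\<^sup>2 +
         schwarzian (\<lambda>z. A (chart_inv a z) + B w\<^sub>0) z"
        "schwarzian k z = transverse_schwarzian \<V> (chart_inv a z, w\<^sub>0) * (\<omega> a z)\<^sup>2 +
         schwarzian (\<lambda>z. A (chart_inv a z) + B w\<^sub>0) z" by blast+
      have "schwarzian k z - schwarzian h z = (transverse_schwarzian \<V> (chart_inv a z, w\<^sub>0) -
          transverse_schwarzian \<U> (chart_inv a z, w\<^sub>0)) * (\<omega> a z)\<^sup>2"
        unfolding e by (simp add: left_diff_distrib)
      then show "(schwarzian k z - schwarzian h z) * (inverse (\<omega> a z))\<^sup>2 =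
          transverse_schwarzian \<V> (chart_inv a z, w\<^sub>0) - transverse_schwarzian \<U> (chart_inv a z, w\<^sub>0)"
        using elim(1) z by (simp add: power_inverse)
    qed
  qed
  then have "eventually (\<lambda>z. (schwarzian k z - schwarzian h z) * (inverse (\<omega> a z))\<^sup>2 =
      transverse_schwarzian \<V> (chart_inv a z, w\<^sub>0) - transverse_schwarzian \<U> (chart_inv a z, w\<^sub>0)) (at (snd a x))"
    by (simp add: eventually_at_filter)
  from Lim_transform_eventually[OF lim this] show ?thesis .
qed

lemma transverse_schwarzian_unique:
  assumes \<U>: "projective_F_atlas CX \<F> \<U>" and \<V>: "projective_F_atlas CX \<F> \<V>"
    and c: "c \<notin> P" "c \<notin> Y"
  shows "transverse_schwarzian \<V> (c, w) = transverse_schwarzian \<U> (c, w)"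
proof -
  define \<Delta> where "\<Delta> c = transverse_schwarzian \<V> (c, w\<^sub>0) - transverse_schwarzian \<U> (c, w\<^sub>0)" for c
  \<comment> \<open>The value 0 at the poles is the limit of \<Delta> there, so \<open>Q\<close> is
    continuous; it is nonzero only off \<open>P\<close>, where it is analytic, as the maximum
    principle requires.\<close>
  define Q where "Q c = (if c \<in> P then 0 else \<Delta> c)" for c
  have an: "(\<lambda>z. Q (chart_inv a z)) analytic_on {snd a c}" if c: "c \<notin> P" and a: "a \<in> C" "c \<in> fst a" for a c
  proof -
    have \<Delta>an: "(\<lambda>z. \<Delta> (chart_inv a z)) analytic_on {snd a c}"
      unfolding \<Delta>_def by (intro analytic_on_diff transverse_schwarzian_analytic_fst \<U> \<V> c a)
    have ev: "eventually (\<lambda>z. \<Delta> (chart_inv a z) = Q (chart_inv a z)) (nhds (snd a c))"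
    proof -
      have "eventually (\<lambda>z. chart_inv a z \<notin> P) (nhds (snd a c))"
        by (rule eventually_nhds_chart[OF atlas_C a, THEN iffD1]) (rule eventually_notin_P'[OF c])
      then show ?thesis by eventually_elim (simp add: Q_def)
    qed
    show ?thesis using \<Delta>an analytic_at_cong[OF ev refl] by simp
  qed
  have "isCont Q c" for c
  proof -
    obtain a where a: "a \<in> C" "c \<in> fst a" using chart_C by blast
    have "isCont (\<lambda>z. Q (chart_inv a z)) (snd a c)"
    proof (cases "c \<in> P")
      case False
      then show ?thesis by (rule analytic_at_imp_isCont[OF an[OF _ a]])
    next
      case True
      have evP: "eventually (\<lambda>z. chart_inv a z \<notin> P - {c}) (nhds (snd a c))"
        by (rule eventually_nhds_chart[OF atlas_C a, THEN iffD1]) (rule eventually_notin_P)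
      with eventually_in_chart_image[OF atlas_C a]
      have "eventually (\<lambda>z. z \<noteq> snd a c \<longrightarrow> \<Delta> (chart_inv a z) = Q (chart_inv a z)) (nhds (snd a c))"
      proof eventually_elim
        case (elim z)
        then have "z \<noteq> snd a c \<Longrightarrow> chart_inv a z \<noteq> c" using chart_inv_right[OF atlas_C a(1)] by auto
        then show ?case using elim(2) by (auto simp: Q_def)
      qed
      then have "eventually (\<lambda>z. \<Delta> (chart_inv a z) = Q (chart_inv a z)) (at (snd a c))"
        by (simp add: eventually_at_filter)
      from Lim_transform_eventually[OF transverse_schwarzian_difference_at_pole[OF \<U> \<V> True a, folded \<Delta>_def] this]
      show ?thesis using True by (simp add: isCont_def Q_def chart_inv_left[OF atlas_C a])
    qed
    then show ?thesis by (rule isCont_from_chart[OF atlas_C a])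
  qed
  moreover have "\<exists>a\<in>C. c \<in> fst a \<and> (\<lambda>z. Q (chart_inv a z)) analytic_on {snd a c}" if "Q c \<noteq> 0" for c
  proof -
    have "c \<notin> P" using that by (auto simp: Q_def)
    then show ?thesis using chart_C[of c] an by blast
  qed
  ultimately have "\<exists>k. \<forall>c. Q c = k"
    by (rule maximum_principle_compact[OF atlas_C compact_C connected_C])
  then obtain k where k: "\<And>c. Q c = k" by blast
  obtain x where "x \<in> P" using P_nonempty by blast
  then have "k = 0" using k[of x] by (simp add: Q_def)
  then have "\<Delta> c = 0" using k[of c] c(1) by (simp add: Q_def)
  then have "transverse_schwarzian \<V> (c, w\<^sub>0) = transverse_schwarzian \<U> (c, w\<^sub>0)" by (simp add: \<Delta>_def)
  then show ?thesis
    using transverse_schwarzian_constant_snd[OF \<U> c, of w] transverse_schwarzian_constant_snd[OF \<V> c, of w] by simp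
qed

section \<open>Uniqueness of the projective structure\<close>

lemma eventually_off_zeros:
  assumes "c \<notin> P" "c \<notin> Y"
  shows "eventually (\<lambda>q. fst q \<notin> P \<and> fst q \<notin> Y) (nhds (c, w))"
proof -
  have "open (- (P \<union> Y))" using finite_P finite_Y by (intro open_Compl finite_imp_closed) simp
  then have "eventually (\<lambda>c'. c' \<in> - (P \<union> Y)) (nhds c)" using assms by (intro eventually_nhds_in_open) simp_all
  from eventually_nhds_fst[OF this, of w] show ?thesis by eventually_elim simp
qed

text \<open>Both charts are written as functions of the same \<open>u\<close>, so equality of the
  transverse Schwarzians becomes \<open>S G' = S G\<close> in one complex variable.\<close>

lemma moebius_related_off_zeros:
  assumes \<U>: "projective_F_atlas CX \<F> \<U>" and \<V>: "projective_F_atlas CX \<F> \<V>"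
    and U: "(U, f) \<in> \<U>" "(U', f') \<in> \<V>" and p: "(c, w) \<in> U" "(c, w) \<in> U'" and c: "c \<notin> P" "c \<notin> Y"
  shows "\<exists>T. moebius T \<and> eventually (\<lambda>q. f' q = T (f q)) (nhds (c, w))"
proof -
  let ?p = "(c, w)"
  note F = projective_F_atlasD(1)[OF \<U> U(1)] projective_F_atlasD(1)[OF \<V> U(2)]
  obtain r where r: "r \<in> cp1_atlas" "f ?p \<in> fst r" using cp1_atlas_cover by blast
  obtain r' where r': "r' \<in> cp1_atlas" "f' ?p \<in> fst r'" using cp1_atlas_cover by blast
  obtain A B where pr: "primitives A B ?p" using exists_primitives[of ?p] c by auto
  note reg = regular_off_zeros[OF c, of w]
  obtain G where G: "transverse_coordinate U f r (separated A B) G ?p"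
    using exists_transverse_coordinate[OF F(1) p(1) r reg pr] by blast
  obtain G' where G': "transverse_coordinate U' f' r' (separated A B) G' ?p"
    using exists_transverse_coordinate[OF F(2) p(2) r' reg pr] by blast
  note GD = transverse_coordinateD[OF G] and GD' = transverse_coordinateD[OF G']
  have aG: "atlas_coordinate \<U> A B G ?p" unfolding atlas_coordinate_def using pr U(1) r(1) G by blast
  have aG': "atlas_coordinate \<V> A B G' ?p" unfolding atlas_coordinate_def using pr U(2) r'(1) G' by blast
  have "eventually (\<lambda>q. schwarzian G' (separated A B q) = schwarzian G (separated A B q)) (nhds ?p)"
    using eventually_transverse_schwarzian_eq[OF \<U> aG] eventually_transverse_schwarzian_eq[OF \<V> aG']
      eventually_off_zeros[OF c, of w]
  proof eventually_elim
    case (elim q)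
    have "regular q" using regular_off_zeros[of "fst q" "snd q"] elim(3) by simp
    moreover have "transverse_schwarzian \<V> q = transverse_schwarzian \<U> q"
      using transverse_schwarzian_unique[OF \<U> \<V>, of "fst q" "snd q"] elim(3) by simp
    ultimately show ?case using elim(1,2) by simp
  qed
  then have "eventually (\<lambda>s. schwarzian G' s = schwarzian G s) (nhds (separated A B ?p))"
    by (rule eventually_separated_open[OF reg pr])
  from schwarzian_eq_imp_moebius_related[OF GD(1,2) GD'(1,2) this]
  obtain m1 m2 m3 m4 where det: "m1 * m4 - m2 * m3 \<noteq> 0"
    and m: "eventually (\<lambda>s. G' s * (m3 * G s + m4) = m1 * G s + m2) (nhds (separated A B ?p))"
    by blast
  obtain T where T: "moebius T" "\<forall>y\<in>fst r. \<forall>y'\<in>fst r'.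
      snd r' y' * (m3 * snd r y + m4) = m1 * snd r y + m2 \<longrightarrow> y' = T y"
    using moebius_from_charts[OF r(1) r'(1) det] by blast
  have "eventually (\<lambda>q. f' q = T (f q)) (nhds ?p)"
    using GD(3) GD'(3) eventually_nhds_compose[OF isCont_separated[OF pr] m]
  proof eventually_elim
    case (elim q)
    then have "snd r' (f' q) * (m3 * snd r (f q) + m4) = m1 * snd r (f q) + m2" by simp
    then show ?case using bspec[OF bspec[OF T(2), of "f q"], of "f' q"] elim(1,2) by blast
  qed
  with T(1) show ?thesis by blast
qed

text \<open>Finitely many values would kill both partial derivatives. This supplies the uniqueness
  of local Moebius maps needed for \<open>moebius_globalize\<close>.\<close>

lemma F_chart_infinite_image:
  assumes F: "F_chart CX \<F> (U, f)" and p: "p \<in> U" and N: "open N" "p \<in> N"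
  shows "infinite (f ` N)"
proof
  assume fin: "finite (f ` N)"
  obtain a b where a: "a \<in> C" "fst p \<in> fst a" and b: "b \<in> X" "snd p \<in> fst b"
    using chart_C chart_X by metis
  obtain r where r: "r \<in> cp1_atlas" "f p \<in> fst r" using cp1_atlas_cover by blast
  note inv = chart_inv_left[OF atlas_C a] chart_inv_left[OF atlas_X b]
  have ab: "snd a (fst p) \<in> snd a ` fst a" "snd b (snd p) \<in> snd b ` fst b" using a b by auto
  obtain D1 D2 where D: "D1 \<noteq> 0 \<or> D2 \<noteq> 0"
    "((\<lambda>z. snd r (f (chart_inv a z, snd p))) has_field_derivative D1) (at (snd a (fst p)))"
    "((\<lambda>w. snd r (f (fst p, chart_inv b w))) has_field_derivative D2) (at (snd b (snd p)))"
    using F_chart_partials[OF F a(1) b(1) r(1) ab] p r(2) unfolding inv prod.collapse by blast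
  have "eventually (\<lambda>q. q \<in> N) (nhds (fst p, snd p))"
    using N by (simp add: eventually_nhds_in_open)
  then have ev: "eventually (\<lambda>q. snd r (f q) \<in> snd r ` f ` N) (nhds (fst p, snd p))"
    by eventually_elim blast
  have fin': "finite (snd r ` f ` N)" using fin by (rule finite_imageI)
  have "eventually (\<lambda>z. snd r (f (chart_inv a z, snd p)) \<in> snd r ` f ` N) (nhds (snd a (fst p)))"
    by (rule eventually_nhds_chart[OF atlas_C a, THEN iffD1]) (rule eventually_nhds_slices(1)[OF ev])
  from finite_values_deriv_zero[OF D(2) fin' this] have "D1 = 0" .
  have "eventually (\<lambda>w. snd r (f (fst p, chart_inv b w)) \<in> snd r ` f ` N) (nhds (snd b (snd p)))"
    by (rule eventually_nhds_chart[OF atlas_X b, THEN iffD1]) (rule eventually_nhds_slices(2)[OF ev])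
  from finite_values_deriv_zero[OF D(3) fin' this] have "D2 = 0" .
  with \<open>D1 = 0\<close> D(1) show False by simp
qed

text \<open>Near \<open>(P \<union> Y) \<times> X\<close> the relation is extended by continuity from a punctured polydisc, which is
  still connected.\<close>

lemma moebius_related:
  assumes \<U>: "projective_F_atlas CX \<F> \<U>" and \<V>: "projective_F_atlas CX \<F> \<V>"
    and U: "(U, f) \<in> \<U>" "(U', f') \<in> \<V>" and p: "(c, w) \<in> U" "(c, w) \<in> U'"
  shows "\<exists>T. moebius T \<and> eventually (\<lambda>q. f' q = T (f q)) (nhds (c, w))"
proof -
  let ?p = "(c, w)"
  note F = projective_F_atlasD(1)[OF \<U> U(1)] projective_F_atlasD(1)[OF \<V> U(2)]
  obtain r where r: "r \<in> cp1_atlas" "f ?p \<in> fst r" using cp1_atlas_cover by blast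
  obtain r' where r': "r' \<in> cp1_atlas" "f' ?p \<in> fst r'" using cp1_atlas_cover by blast
  obtain a where a: "a \<in> C" "c \<in> fst a" using chart_C by blast
  obtain b where b: "b \<in> X" "w \<in> fst b" using chart_X by blast
  obtain Pf Pg where Pfg: "eventually Pf (nhds c)" "eventually Pg (nhds w)"
    "\<And>x y. Pf x \<Longrightarrow> Pg y \<Longrightarrow> ((x, y) \<in> U \<and> f (x, y) \<in> fst r) \<and> ((x, y) \<in> U' \<and> f' (x, y) \<in> fst r')"
    using eventually_conj[OF eventually_F_chart[OF F(1) p(1) r] eventually_F_chart[OF F(2) p(2) r']]
    unfolding eventually_nhds_prod by blast
  \<comment> \<open>The point \<open>c\<close> may itself be a pole or a zero, but then it is the
    only one in the neighbourhood being chosen.\<close>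
  have "open (- ((P \<union> Y) - {c}))" using finite_P finite_Y by (intro open_Compl finite_imp_closed) simp
  then have "eventually (\<lambda>c'. c' \<in> - ((P \<union> Y) - {c})) (nhds c)" by (rule eventually_nhds_in_open) simp
  from eventually_conj[OF Pfg(1) this] obtain N1 where N1: "connected (N1 - {c})" "c \<in> N1"
    "\<forall>c'\<in>N1. Pf c' \<and> c' \<in> - ((P \<union> Y) - {c})" "eventually (\<lambda>c'. c' \<in> N1) (nhds c)"
    using riemann_surface_connected_nhd[OF atlas_C a] by blast
  obtain N2 where N2: "connected N2" "w \<in> N2" "\<forall>w'\<in>N2. Pg w' \<and> w' \<in> fst b" "eventually (\<lambda>w'. w' \<in> N2) (nhds w)"
    using riemann_surface_connected_nhd[OF atlas_X b eventually_conj[OF Pfg(2) eventually_in_chart[OF atlas_X b]]]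
    by blast
  have N: "(x, y) \<in> U" "f (x, y) \<in> fst r" "(x, y) \<in> U'" "f' (x, y) \<in> fst r'" if "x \<in> N1" "y \<in> N2" for x y
    using Pfg(3)[of x y] N1(3) N2(3) that by blast+
  define W where "W = (N1 - {c}) \<times> N2"
  have "\<exists>T. moebius T \<and> (\<forall>p\<in>W. f' p = T (f p))"
  proof (rule moebius_globalize)
    show "connected W" unfolding W_def using N1(1) N2(1) by (rule connected_Times)
    fix q assume q: "q \<in> W"
    obtain x y where xy: "q = (x, y)" by (cases q)
    with q have x: "x \<in> N1" "x \<noteq> c" and y: "y \<in> N2" unfolding W_def by auto
    then have "x \<notin> P" "x \<notin> Y" using N1(3) by blast+
    then show "\<exists>T. moebius T \<and> eventually (\<lambda>q. f' q = T (f q)) (nhds q)"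
      unfolding xy by (intro moebius_related_off_zeros[OF \<U> \<V> U] N x(1) y)
    fix V assume "open V" "q \<in> V"
    then show "infinite (f ` V)"
      using F_chart_infinite_image[OF F(1)] N(1)[OF x(1) y] xy by blast
  qed
  then obtain T0 where T0: "moebius T0" "\<forall>p\<in>W. f' p = T0 (f p)" by blast
  obtain m1 m2 m3 m4 where det: "m1 * m4 - m2 * m3 \<noteq> 0"
    and m: "\<forall>y\<in>fst r. \<forall>y'\<in>fst r'. y' = T0 y \<longleftrightarrow> snd r' y' * (m3 * snd r y + m4) = m1 * snd r y + m2"
    using moebius_in_charts[OF r(1) r'(1) T0(1)] by blast
  \<comment> \<open>Without division the relation is still defined over \<open>x = c\<close> and
    continuous in \<open>x\<close>, so its vanishing survives the passage to the fibre over
    \<open>c\<close>.\<close>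
  define \<Phi> where "\<Phi> q = snd r' (f' q) * (m3 * snd r (f q) + m4) - (m1 * snd r (f q) + m2)" for q
  have \<Phi>W: "\<Phi> (x, y) = 0" if "x \<in> N1" "x \<noteq> c" "y \<in> N2" for x y
  proof -
    have "(x, y) \<in> W" using that by (simp add: W_def)
    then have "f' (x, y) = T0 (f (x, y))" by (rule bspec[OF T0(2)])
    then have "snd r' (f' (x, y)) * (m3 * snd r (f (x, y)) + m4) = m1 * snd r (f (x, y)) + m2"
      using bspec[OF bspec[OF m N(2)[OF that(1,3)]] N(4)[OF that(1,3)]] by blast
    then show ?thesis by (simp add: \<Phi>_def)
  qed
  have \<Phi>c: "\<Phi> (c, y) = 0" if y: "y \<in> N2" for y
  proof -
    have yb: "snd b y \<in> snd b ` fst b" and ca: "snd a c \<in> snd a ` fst a" using N2(3) y a by blast+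
    have inv: "chart_inv a (snd a c) = c" "chart_inv b (snd b y) = y"
      using chart_inv_left[OF atlas_C a] chart_inv_left[OF atlas_X b(1)] N2(3) y by blast+
    obtain D1 D2 where "((\<lambda>z. snd r (f (chart_inv a z, y))) has_field_derivative D1) (at (snd a c))"
      using F_chart_partials[OF F(1) a(1) b(1) r(1) ca yb] N[OF N1(2) y] unfolding inv by blast
    note c1 = DERIV_isCont[OF this]
    obtain D1' D2' where "((\<lambda>z. snd r' (f' (chart_inv a z, y))) has_field_derivative D1') (at (snd a c))"
      using F_chart_partials[OF F(2) a(1) b(1) r'(1) ca yb] N[OF N1(2) y] unfolding inv by blast
    note c2 = DERIV_isCont[OF this]
    have "isCont (\<lambda>z. \<Phi> (chart_inv a z, y)) (snd a c)"
      unfolding \<Phi>_def by (intro continuous_intros c1 c2)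
    then have lim: "((\<lambda>z. \<Phi> (chart_inv a z, y)) \<longlongrightarrow> \<Phi> (c, y)) (at (snd a c))"
      by (simp add: isCont_def inv)
    have "eventually (\<lambda>z. chart_inv a z \<in> N1) (nhds (snd a c))"
      by (rule eventually_nhds_chart[OF atlas_C a, THEN iffD1]) (rule N1(4))
    with eventually_in_chart_image[OF atlas_C a]
    have "eventually (\<lambda>z. z \<noteq> snd a c \<longrightarrow> \<Phi> (chart_inv a z, y) = 0) (nhds (snd a c))"
    proof eventually_elim
      case (elim z)
      then have "z \<noteq> snd a c \<Longrightarrow> chart_inv a z \<noteq> c" using chart_inv_right[OF atlas_C a(1)] by auto
      then show ?case using \<Phi>W[OF elim(2) _ y] by blast
    qed
    then have "eventually (\<lambda>z. \<Phi> (chart_inv a z, y) = 0) (at (snd a c))"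
      by (simp add: eventually_at_filter)
    then have "((\<lambda>z. \<Phi> (chart_inv a z, y)) \<longlongrightarrow> 0) (at (snd a c))" by (rule tendsto_eventually)
    with lim show ?thesis using tendsto_unique trivial_limit_at by blast
  qed
  obtain T where T: "moebius T" "\<forall>y\<in>fst r. \<forall>y'\<in>fst r'.
      snd r' y' * (m3 * snd r y + m4) = m1 * snd r y + m2 \<longrightarrow> y' = T y"
    using moebius_from_charts[OF r(1) r'(1) det] by blast
  have "f' (x, y) = T (f (x, y))" if xy: "x \<in> N1" "y \<in> N2" for x y
  proof -
    have "\<Phi> (x, y) = 0" using \<Phi>W[OF xy(1) _ xy(2)] \<Phi>c[OF xy(2)] by (cases "x = c") auto
    then have "snd r' (f' (x, y)) * (m3 * snd r (f (x, y)) + m4) = m1 * snd r (f (x, y)) + m2"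
      by (simp add: \<Phi>_def)
    then show ?thesis using bspec[OF bspec[OF T(2) N(2)[OF xy]] N(4)[OF xy]] by blast
  qed
  then have "eventually (\<lambda>q. f' q = T (f q)) (nhds ?p)"
    unfolding eventually_nhds_prod using N1(4) N2(4) by blast
  with T(1) show ?thesis by blast
qed

lemma projective_F_atlas_compatible:
  assumes \<U>: "projective_F_atlas CX \<F> \<U>" and \<V>: "projective_F_atlas CX \<F> \<V>"
    and U: "(U, f) \<in> \<U>" "(U', f') \<in> \<V>" and W: "W \<in> components (U \<inter> U')"
  shows "\<exists>T. moebius T \<and> (\<forall>p\<in>W. f' p = T (f p))"
proof (rule moebius_globalize)
  show "connected W" using W by (rule in_components_connected)
  fix p assume "p \<in> W"
  then have p: "p \<in> U" "p \<in> U'" using in_components_subset[OF W] by auto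
  show "\<exists>T. moebius T \<and> eventually (\<lambda>q. f' q = T (f q)) (nhds p)"
    using moebius_related[OF \<U> \<V> U, of "fst p" "snd p"] p by simp
  fix N assume "open N" "p \<in> N"
  then show "infinite (f ` N)"
    by (rule F_chart_infinite_image[OF projective_F_atlasD(1)[OF \<U> U(1)] p(1)])
qed

text \<open>Overlaps within one atlas and overlaps between the two are all instances of
  \<open>projective_F_atlas_compatible\<close>, which allows its two atlases to coincide.\<close>

lemma projective_F_atlas_Un:
  assumes \<U>: "projective_F_atlas CX \<F> \<U>" and \<V>: "projective_F_atlas CX \<F> \<V>"
  shows "projective_F_atlas CX \<F> (\<U> \<union> \<V>)"
proof -
  have "F_atlas CX \<F> (\<U> \<union> \<V>)"
    using \<U> \<V> unfolding projective_F_atlas_def F_atlas_def by auto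
  moreover have "\<exists>T. moebius T \<and> (\<forall>p\<in>W. snd u' p = T (snd u p))"
    if u: "u \<in> \<U> \<union> \<V>" "u' \<in> \<U> \<union> \<V>" and W: "W \<in> components (fst u \<inter> fst u')" for u u' W
  proof -
    have *: "projective_F_atlas CX \<F> \<W> \<and> (fst u, snd u) \<in> \<W>"
      if "u \<in> \<W>" "\<W> = \<U> \<or> \<W> = \<V>" for u \<W>
      using that \<U> \<V> by auto
    obtain \<W> where W1: "projective_F_atlas CX \<F> \<W>" "(fst u, snd u) \<in> \<W>" using u(1) * by blast
    obtain \<W>' where W2: "projective_F_atlas CX \<F> \<W>'" "(fst u', snd u') \<in> \<W>'" using u(2) * by blast
    show ?thesis by (rule projective_F_atlas_compatible[OF W1(1) W2(1) W1(2) W2(2) W])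
  qed
  ultimately show ?thesis
    unfolding projective_F_atlas_def case_prod_beta' by (intro conjI ballI)
qed

text \<open>Any two atlases are equivalent, so every equivalence class is the set of all of
  them.\<close>

lemma F_projective_structure_unique:
  assumes "S \<in> F_projective_structures CX \<F>" "S' \<in> F_projective_structures CX \<F>"
  shows "S = S'"
proof -
  have *: "S = {\<V>. projective_F_atlas CX \<F> \<V>}" if "S \<in> F_projective_structures CX \<F>" for S
    using that unfolding F_projective_structures_def
  proof (rule quotientE)
    fix \<U> assume \<U>: "\<U> \<in> {\<U>. projective_F_atlas CX \<F> \<U>}"
      and S: "S = {(\<U>, \<V>). projective_F_atlas CX \<F> \<U> \<and> projective_F_atlas CX \<F> \<V> \<and>
        projective_F_atlas CX \<F> (\<U> \<union> \<V>)} `` {\<U>}"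
    show "S = {\<V>. projective_F_atlas CX \<F> \<V>}"
      unfolding S using \<U> projective_F_atlas_Un[of \<U>] by auto
  qed
  show ?thesis unfolding *[OF assms(1)] *[OF assms(2)] ..
qed

end

section \<open>From divisors to the local behaviour of \<omega>\<close>

lemma sum_of_points_pos_iff: "sum_of_points d x p > 0 \<longleftrightarrow> p \<in> x ` {1..d}"
proof -
  have "sum_of_points d x p > 0 \<longleftrightarrow> (\<exists>i\<in>{1..d}. p = x i)"
  proof
    assume "\<exists>i\<in>{1..d}. p = x i"
    then obtain i where i: "i \<in> {1..d}" "p = x i" by blast
    have "(\<Sum>j=1..d. if p = x j then 1 else (0::int)) > 0"
      by (rule sum_pos2[OF _ i(1)]) (use i(2) in auto)
    then show "sum_of_points d x p > 0" by (simp add: sum_of_points_def)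
  next
    assume pos: "sum_of_points d x p > 0"
    show "\<exists>i\<in>{1..d}. p = x i"
    proof (rule ccontr)
      assume "\<not> (\<exists>i\<in>{1..d}. p = x i)"
      then have "sum_of_points d x p = 0"
        unfolding sum_of_points_def by (intro sum.neutral) auto
      with pos show False by simp
    qed
  qed
  then show ?thesis by blast
qed

text \<open>Nice meromorphy fixes the value at each point to be the limit, or 0 at a pole. So
  nonnegative order means analytic as it stands, and order 0 means that the actual value is
  nonzero.\<close>

lemma nicely_meromorphic_order:
  assumes f: "f nicely_meromorphic_on S" "z \<in> S" and fr: "\<exists>\<^sub>F w in at z. f w \<noteq> 0"
  shows "zorder f z < 0 \<longleftrightarrow> is_pole f z" and "zorder f z \<ge> 0 \<Longrightarrow> f analytic_on {z}"
    and "zorder f z = 0 \<Longrightarrow> f z \<noteq> 0"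
proof -
  have "f meromorphic_on {z}"
    using f meromorphic_on_subset unfolding nicely_meromorphic_on_def by blast
  then have iso: "isolated_singularity_at f z" and ness: "not_essential f z"
    by (auto simp: meromorphic_at_iff)
  show 1: "zorder f z < 0 \<longleftrightarrow> is_pole f z"
    using neg_zorder_imp_is_pole[OF iso ness _ fr] isolated_pole_imp_neg_zorder[OF iso] by blast
  show 2: "zorder f z \<ge> 0 \<Longrightarrow> f analytic_on {z}"
    using nicely_meromorphic_on_imp_analytic_at[OF f] 1 by linarith
  show "zorder f z = 0 \<Longrightarrow> f z \<noteq> 0"
    using zorder_eq_0_iff[OF 2 fr] by simp
qed

theorem proposition5p1:
  fixes C :: "('a::t2_space, complex) chart set"
    and X :: "('b::t2_space, complex) chart set"
    and d :: nat
    and x y :: "nat \<Rightarrow> 'a"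
    and \<omega> :: "'a one_form"
    and \<beta> :: "'b one_form"
  assumes "compact_connected_riemann_surface C"
    and "has_genus (euclidean :: 'a topology) 1"
    and "compact_connected_riemann_surface X"
    and "has_genus (euclidean :: 'b topology) 1"
    and "d \<ge> 2"
    and "meromorphic_one_form C \<omega>"
    and "polar_divisor_is C \<omega> (sum_of_points d x)"
    and "zero_divisor_is C \<omega> (sum_of_points d y)"
    and "inj_on x {1..d}"
    and "inj_on y {1..d}"
    and "x ` {1..d} \<inter> y ` {1..d} = {}"
    and "holomorphic_one_form X \<beta>"
    and "nonzero_form X \<beta>"
  shows "\<forall>S \<in> F_projective_structures (product_atlas C X)
              (product_foliation C X (x ` {1..d}) \<omega> \<beta>).
         \<forall>S' \<in> F_projective_structures (product_atlas C X)
              (product_foliation C X (x ` {1..d}) \<omega> \<beta>). S = S'"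
proof -
  have atC: "complex_atlas C" and atX: "complex_atlas X"
    using assms(1,3) unfolding compact_connected_riemann_surface_def by blast+
  obtain b0 w0 where b0: "b0 \<in> X" "w0 \<in> fst b0" "\<beta> b0 (snd b0 w0) \<noteq> 0"
    using assms(13) unfolding nonzero_form_def by blast
  have mero: "\<omega> a nicely_meromorphic_on (snd a ` fst a)" if "a \<in> C" for a
    using assms(6) that unfolding meromorphic_one_form_def by blast
  \<comment> \<open>\<open>max 0 (- n)\<close> is positive exactly for \<open>n < 0\<close>, and
    \<open>max 0 n\<close> exactly for \<open>n > 0\<close>, so the supports of the two divisors are
    the poles and the zeros.\<close>
  have ord: "\<exists>\<^sub>F z in at (snd a c). \<omega> a z \<noteq> 0"
      "c \<in> x ` {1..d} \<longleftrightarrow> zorder (\<omega> a) (snd a c) < 0" "c \<in> y ` {1..d} \<longleftrightarrow> zorder (\<omega> a) (snd a c) > 0"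
    if a: "a \<in> C" "c \<in> fst a" for a c
  proof -
    obtain n where n: "form_has_order C \<omega> c n" "sum_of_points d x c = max 0 (- n)"
      using assms(7) unfolding polar_divisor_is_def by blast
    obtain m where m: "form_has_order C \<omega> c m" "sum_of_points d y c = max 0 m"
      using assms(8) unfolding zero_divisor_is_def by blast
    have z: "zorder (\<omega> a) (snd a c) = n" "zorder (\<omega> a) (snd a c) = m"
      and "\<exists>\<^sub>F z in at (snd a c). \<omega> a z \<noteq> 0"
      using n(1) m(1) a unfolding form_has_order_def by blast+
    then show "\<exists>\<^sub>F z in at (snd a c). \<omega> a z \<noteq> 0" by blast
    show "c \<in> x ` {1..d} \<longleftrightarrow> zorder (\<omega> a) (snd a c) < 0"
      unfolding sum_of_points_pos_iff[symmetric] n(2) z(1) by auto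
    show "c \<in> y ` {1..d} \<longleftrightarrow> zorder (\<omega> a) (snd a c) > 0"
      unfolding sum_of_points_pos_iff[symmetric] m(2) z(2) by auto
  qed
  note mo = nicely_meromorphic_order[OF mero _ ord(1)]
  \<comment> \<open>Off both sets of points the order is 0, which makes the coefficient analytic and
    nonzero; the nonvanishing of \<beta> at one point provides \<open>w\<^sub>0\<close>.\<close>
  interpret foliated_product C X "x ` {1..d}" "y ` {1..d}" \<omega> \<beta> b0 w0
  proof
    show "complex_atlas C" "complex_atlas X" by (fact atC atX)+
    show "compact (UNIV :: 'a set)" "connected (UNIV :: 'a set)" "compact (UNIV :: 'b set)" "connected (UNIV :: 'b set)"
      using assms(1,3) unfolding compact_connected_riemann_surface_def by blast+
    show "finite (x ` {1..d})" "finite (y ` {1..d})" by simp_all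
    show "x ` {1..d} \<noteq> {}" using assms(5) by simp
    show "compatible_coefficients C \<omega>" "compatible_coefficients X \<beta>"
      using assms(6,12) unfolding meromorphic_one_form_def holomorphic_one_form_def by blast+
    show "b0 \<in> X" "w0 \<in> fst b0" "\<beta> b0 (snd b0 w0) \<noteq> 0" by (fact b0)+
    show "\<beta> b analytic_on {snd b w}" if b: "b \<in> X" "w \<in> fst b" for b w
    proof -
      have "\<beta> b holomorphic_on (snd b ` fst b)"
        using assms(12) b(1) unfolding holomorphic_one_form_def by blast
      then show ?thesis
        using open_chart_image[OF atX b(1)] b(2) analytic_at by blast
    qed
    fix a c assume a: "a \<in> C" "c \<in> fst a"
    have m: "snd a c \<in> snd a ` fst a" using a(2) by blast
    show "\<omega> a analytic_on {snd a c}" if "c \<notin> x ` {1..d}"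
      using mo(2)[OF a(1) m a] ord(2)[OF a] that by simp
    show "\<omega> a (snd a c) \<noteq> 0" if "c \<notin> x ` {1..d}" "c \<notin> y ` {1..d}"
      using mo(3)[OF a(1) m a] ord(2,3)[OF a] that by simp
    show "is_pole (\<omega> a) (snd a c)" if "c \<in> x ` {1..d}"
      using mo(1)[OF a(1) m a] ord(2)[OF a] that by simp
  qed
  show ?thesis using F_projective_structure_unique by blast
qed

end
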